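(* Let $K>0$ and $E<0$, and consider the spatial fiber of the de Sitter Schwarzschild spacetime $(M^3,g_{K,E})$ as a warped product space $M=[\widehat s,0)\times\mathbb{S}^2$, $g_{K,E}=ds^2+r(s)^2(d\theta^2+\sin^2\theta\,d\phi^2)$. Then the family $\{\Omega_s\}_{s\in(\widehat s,0)}$, where $\Omega_s=(\widehat s,s)\times\mathbb{S}^2$, has infinitely many bifurcation points.
   Context: The metric. Let $\psi_{K,E}(r)=\sqrt{1-2K/r+Er^2}$ and $$g_{K,E}=\psi_{K,E}(r)^{-2}dr^2+r^2(d\theta^2+\sin^2\theta\,d\phi^2)$$ on $(\widehat r,0)\times\mathbb{S}^2$, where $\widehat r<0$ is a zero of $\psi_{K,E}$ and $(\widehat r,0)$ is a maximal open interval on which $\psi_{K,E}$ is well defined (so the coordinate $r$ takes negative values). The metric extends smoothly to $[\widehat r,0)\times\mathbb{S}^2$. The change of variable $ds=\psi_{K,E}(r)^{-1}dr$, normalized so that $s=\widehat s$ corresponds to $r=\widehat r$ and $s\to0^-$ corresponds to $r\to0^-$, gives the warped form $g_{K,E}=ds^2+r(s)^2(d\theta^2+\sin^2\theta\,d\phi^2)$ on $[\widehat s,0)\times\mathbb{S}^2$. Variational setting. The boundary of $\Omega_s$ consists of a fixed part $\Sigma_1=\{\widehat s\}\times\mathbb{S}^2$ and the constant mean curvature sphere $\Sigma_2=\{s\}\times\mathbb{S}^2$. More generally one considers the space $\mathcal M$ of open sets $\Omega$ with compact closure whose boundary is the disjoint union of the fixed set $\Sigma_1$ and a smooth connected orientable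 surface $\Sigma_2$. On it, for $\lambda\in\mathbb R$, one takes the functional $\mathcal F^\lambda(\Omega)=\mathrm{Area}(\partial\Omega)+\lambda\,\mathrm{Vol}(\Omega)$. The variations considered are normal variations of $\Sigma_2$ that preserve volume; the normal component $f$ of the variation field satisfies $\int_{\Sigma_2}f\,d\sigma=0$. The critical points of $\mathcal F^\lambda$ are taken to be the sets $\Omega$ for which $\Sigma_2$ has constant mean curvature $\lambda$ (mean curvature as the sum of principal curvatures, with the sign convention in which $\{s\}\times\mathbb{S}^2$ has mean curvature $-2\dot r(s)/r(s)$, the dot denoting $d/ds$). Thus $\Omega_s$ is a critical point of $\mathcal F^{\lambda(s)}$ with $\lambda(s)=-2\dot r(s)/r(s)$. Bifurcation. In general, for a continuous path of functionals $\mathcal F^{\lambda}$ and a continuous path of critical points $x_\lambda$, $d\mathcal F^\lambda(x_\lambda)=0$, a parameter value $\lambda_*$ is a bifurcation point if there are sequences $\lambda_k\to\lambda_*$ and $x_k\to x_{\lambda_*}$ with $d\mathcal F^{\lambda_k}(x_k)=0$ and $x_k\ne x_{\lambda_k}$ for all $k$. Here the path is parametrized by $s$, with functionals $\mathcal F^{\lambda(s)}$ and critical points $\Omega_s$: $s_*$ is a bifurcation point if there are $\sigma_k\to s_*$ and $x_k\in\mathcal M$, $x_k\to\Omega_{s_*}$, such that each $x_k$ is a critical point of $\mathcal F^{\lambda(\sigma_k)}$ and $x_k\ne\Omega_{\sigma_k}$ for all $k$. The space $\mathcal M$ is treated as a Banach space, with no specific topology prescribed. *)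

theory Defs
  imports "HOL-Analysis.Analysis"
begin

section \<open>The de Sitter--Schwarzschild fiber as a warped product\<close>

text \<open>The coordinate \<open>r\<close> is negative throughout.\<close>

definition psi_sq :: "real \<Rightarrow> real \<Rightarrow> real \<Rightarrow> real" where
  "psi_sq K E r = 1 - 2 * K / r + E * r\<^sup>2"

definition psi :: "real \<Rightarrow> real \<Rightarrow> real \<Rightarrow> real" where
  "psi K E r = sqrt (psi_sq K E r)"

text \<open>The negative zero of \<open>psi\<close> for which \<open>(rhat, 0)\<close> is a maximal open interval where the square
  root is well defined. (\<open>sqrt\<close> is total in HOL, hence the explicit conditions on the radicand; no
  interval extends beyond \<open>0\<close> on the right, where the radicand is singular.)\<close>

definition rhat :: "real \<Rightarrow> real \<Rightarrow> real" where
  "rhat K E = (THE r. r < 0 \<and> psi K E r = 0 \<and>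
     (\<forall>t\<in>{r<..<0}. 0 \<le> psi_sq K E t) \<and> (\<forall>a<r. \<exists>t\<in>{a<..<r}. psi_sq K E t < 0))"

text \<open>\<open>ds = dr / psi\<close>, normalized by \<open>s \<longlonglongrightarrow> 0\<close> as \<open>r \<longlonglongrightarrow> 0\<close> from the left. The integrand is singular at
  \<open>rhat\<close>, but the integral converges.\<close>

definition arclength :: "real \<Rightarrow> real \<Rightarrow> real \<Rightarrow> real" where
  "arclength K E r = - integral {r..0} (\<lambda>t. 1 / psi K E t)"

definition shat :: "real \<Rightarrow> real \<Rightarrow> real" where
  "shat K E = arclength K E (rhat K E)"

definition radius :: "real \<Rightarrow> real \<Rightarrow> real \<Rightarrow> real" where
  "radius K E = the_inv_into {rhat K E..<0} (arclength K E)"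

type_synonym point = "real \<times> (real^3)"

definition fiber :: "real \<Rightarrow> real \<Rightarrow> point set" where
  "fiber K E = {shat K E..<0} \<times> sphere 0 1"

text \<open>The tangent space of the fiber at \<open>(s, x)\<close> consists of the \<open>(a, v)\<close> with \<open>v \<bullet> x = 0\<close>. The
  expression below makes sense for all vectors, so it also defines a metric on the open subset
  \<open>{shat<..<0} \<times> UNIV\<close> of the ambient space; its restriction to the fiber is
  \<open>ds\<^sup>2 + r(s)\<^sup>2 (d\<theta>\<^sup>2 + sin\<^sup>2 \<theta> d\<phi>\<^sup>2)\<close>.\<close>

definition warped_metric :: "real \<Rightarrow> real \<Rightarrow> point \<Rightarrow> point \<Rightarrow> point \<Rightarrow> real" where
  "warped_metric K E p V W = fst V * fst W + (radius K E (fst p))\<^sup>2 * (snd V \<bullet> snd W)"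

text \<open>Christoffel symbols of the first kind of a metric \<open>G\<close> on an open set of a Euclidean space (the
  Koszul formula for constant vector fields): the value of \<open>G (\<nabla>\<^sub>V W) Z\<close> for constant \<open>V, W, Z\<close>.\<close>

definition christoffel ::
  "('a::euclidean_space \<Rightarrow> 'a \<Rightarrow> 'a \<Rightarrow> real) \<Rightarrow> 'a \<Rightarrow> 'a \<Rightarrow> 'a \<Rightarrow> 'a \<Rightarrow> real" where
  "christoffel G p V W Z =
     (frechet_derivative (\<lambda>q. G q W Z) (at p) V
      + frechet_derivative (\<lambda>q. G q V Z) (at p) W
      - frechet_derivative (\<lambda>q. G q V W) (at p) Z) / 2"

section \<open>Smooth surfaces\<close>

text \<open>Differentiability of class \<open>C\<^sup>k\<close> on an open set.\<close>

primrec Ck_on :: "nat \<Rightarrow> 'a::euclidean_space set \<Rightarrow> ('a \<Rightarrow> 'b::euclidean_space) \<Rightarrow> bool" where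
  "Ck_on 0 S f \<longleftrightarrow> continuous_on S f"
| "Ck_on (Suc k) S f \<longleftrightarrow> (\<forall>x\<in>S. f differentiable (at x)) \<and>
     (\<forall>v. Ck_on k S (\<lambda>x. frechet_derivative f (at x) v))"

definition smooth_on :: "'a::euclidean_space set \<Rightarrow> ('a \<Rightarrow> 'b::euclidean_space) \<Rightarrow> bool" where
  "smooth_on S f \<longleftrightarrow> (\<forall>k. Ck_on k S f)"

definition local_param :: "point set \<Rightarrow> (real^2) set \<Rightarrow> (real^2 \<Rightarrow> point) \<Rightarrow> bool" where
  "local_param S U X \<longleftrightarrow> open U \<and> smooth_on U X \<and>
     (\<forall>u\<in>U. inj (frechet_derivative X (at u))) \<and>
     openin (top_of_set S) (X ` U) \<and> (\<exists>Y. homeomorphism U (X ` U) X Y)"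

text \<open>An atlas of local parametrizations all of whose coordinate changes have positive Jacobian;
  \<open>L\<close> is the differential of the coordinate change.\<close>

definition orientable_surface :: "point set \<Rightarrow> bool" where
  "orientable_surface S \<longleftrightarrow> (\<exists>A.
     (\<forall>(U, X)\<in>A. local_param S U X) \<and> S = (\<Union>(U, X)\<in>A. X ` U) \<and>
     (\<forall>(U, X)\<in>A. \<forall>(V, Y)\<in>A. \<forall>u\<in>U. \<forall>v\<in>V. X u = Y v \<longrightarrow>
        (\<exists>L. linear L \<and> frechet_derivative X (at u) = frechet_derivative Y (at v) \<circ> L \<and>
             0 < det (matrix L))))"

section \<open>Admissible domains and their mean curvature\<close>

definition fixed_boundary :: "real \<Rightarrow> real \<Rightarrow> point set" where
  "fixed_boundary K E = {shat K E} \<times> sphere 0 1"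

definition free_boundary :: "real \<Rightarrow> real \<Rightarrow> point set \<Rightarrow> point set" where
  "free_boundary K E D = (top_of_set (fiber K E)) frontier_of D - fixed_boundary K E"

text \<open>Open and boundary refer to the topology of the fiber. Compactness of the free boundary expresses
  that the boundary is the disjoint union of its two parts as a topological space.\<close>

definition admissible :: "real \<Rightarrow> real \<Rightarrow> point set \<Rightarrow> bool" where
  "admissible K E D \<longleftrightarrow>
     openin (top_of_set (fiber K E)) D \<and>
     compact ((top_of_set (fiber K E)) closure_of D) \<and>
     fixed_boundary K E \<subseteq> (top_of_set (fiber K E)) frontier_of D \<and>
     free_boundary K E D \<noteq> {} \<and> compact (free_boundary K E D) \<and>
     connected (free_boundary K E D) \<and> orientable_surface (free_boundary K E D)"

text \<open>\<open>N\<close> is the unit normal at \<open>X u\<close>, tangent to the fiber, pointing out of \<open>D\<close>. The curve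
  \<open>t \<mapsto> (s + t a, sgn (x + t v))\<close> lies in the fiber and has velocity \<open>(a, v)\<close> at \<open>t = 0\<close>, because
  \<open>sgn y = y / norm y\<close> and \<open>v \<bullet> x = 0\<close>.\<close>

definition outward_unit_normal ::
  "real \<Rightarrow> real \<Rightarrow> point set \<Rightarrow> (real^2 \<Rightarrow> point) \<Rightarrow> real^2 \<Rightarrow> point \<Rightarrow> bool" where
  "outward_unit_normal K E D X u N \<longleftrightarrow>
     snd N \<bullet> snd (X u) = 0 \<and> warped_metric K E (X u) N N = 1 \<and>
     (\<forall>h. warped_metric K E (X u) (frechet_derivative X (at u) h) N = 0) \<and>
     (let c = (\<lambda>t. (fst (X u) + t * fst N, sgn (snd (X u) + t *\<^sub>R snd N))) in
        (\<forall>\<^sub>F t in at_right 0. c t \<notin> D) \<and> (\<forall>\<^sub>F t in at_left 0. c t \<in> D))"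

definition first_form ::
  "real \<Rightarrow> real \<Rightarrow> (real^2 \<Rightarrow> point) \<Rightarrow> real^2 \<Rightarrow> real^2 \<Rightarrow> real^2 \<Rightarrow> real" where
  "first_form K E X u h k =
     warped_metric K E (X u) (frechet_derivative X (at u) h) (frechet_derivative X (at u) k)"

text \<open>\<open>II(h, k) = g(\<nabla>\<^sub>h (DX k), N)\<close>. The Levi-Civita connection of the fiber is the tangential part of that
  of the ambient metric, and \<open>N\<close> is tangent to the fiber, so the ambient connection may be used.
  With the outward normal \<open>N = (1, 0)\<close>, the slice \<open>{s} \<times> S\<^sup>2\<close> has principal curvatures
  \<open>- r'(s) / r(s)\<close>.\<close>

definition second_form ::
  "real \<Rightarrow> real \<Rightarrow> (real^2 \<Rightarrow> point) \<Rightarrow> point \<Rightarrow> real^2 \<Rightarrow> real^2 \<Rightarrow> real^2 \<Rightarrow> real" where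
  "second_form K E X N u h k =
     warped_metric K E (X u)
       (frechet_derivative (\<lambda>w. frechet_derivative X (at w) k) (at u) h) N
     + christoffel (warped_metric K E) (X u)
         (frechet_derivative X (at u) h) (frechet_derivative X (at u) k) N"

text \<open>\<open>h\<close> and \<open>k\<close> represent orthonormal principal directions, with principal curvatures
  \<open>II(h, h)\<close> and \<open>II(k, k)\<close>.\<close>

definition has_mean_curvature_at :: "real \<Rightarrow> real \<Rightarrow> point set \<Rightarrow> point \<Rightarrow> real \<Rightarrow> bool" where
  "has_mean_curvature_at K E D p H \<longleftrightarrow> (\<exists>U X u N h k.
     local_param (free_boundary K E D) U X \<and> u \<in> U \<and> X u = p \<and>
     outward_unit_normal K E D X u N \<and>
     first_form K E X u h h = 1 \<and> first_form K E X u k k = 1 \<and> first_form K E X u h k = 0 \<and>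
     second_form K E X N u h k = 0 \<and>
     H = second_form K E X N u h h + second_form K E X N u k k)"

text \<open>The critical points of \<open>D \<mapsto> Area (\<partial>D) + l Vol D\<close> under variations of the free boundary:
  constant mean curvature \<open>l\<close>.\<close>

definition critical :: "real \<Rightarrow> real \<Rightarrow> real \<Rightarrow> point set \<Rightarrow> bool" where
  "critical K E l D \<longleftrightarrow>
     admissible K E D \<and> (\<forall>p\<in>free_boundary K E D. has_mean_curvature_at K E D p l)"

section \<open>Bifurcation\<close>

definition slab :: "real \<Rightarrow> real \<Rightarrow> real \<Rightarrow> point set" where
  "slab K E s = {shat K E<..<s} \<times> sphere 0 1"

definition slice_curvature :: "real \<Rightarrow> real \<Rightarrow> real \<Rightarrow> real" where
  "slice_curvature K E s = - 2 * deriv (radius K E) s / radius K E s"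

text \<open>\<open>w\<close> is of class \<open>C\<^sup>2\<^sup>,\<^sup>\<alpha>\<close> on the unit sphere with Hoelder norm at most \<open>c\<close>. Derivatives are taken of
  the extension \<open>w \<circ> sgn\<close> of \<open>w\<close> that is constant along rays.\<close>

definition holder_norm_le :: "real \<Rightarrow> (real^3 \<Rightarrow> real) \<Rightarrow> real \<Rightarrow> bool" where
  "holder_norm_le \<alpha> w c \<longleftrightarrow>
     (let W = (\<lambda>y. w (sgn y));
          D1 = (\<lambda>a y. frechet_derivative W (at y) a);
          D2 = (\<lambda>a b y. frechet_derivative (D1 b) (at y) a)
      in Ck_on 2 (- {0}) W \<and>
         (\<forall>x\<in>sphere 0 1. \<bar>W x\<bar> \<le> c \<and>
           (\<forall>a\<in>sphere 0 1. \<bar>D1 a x\<bar> \<le> c \<and>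
             (\<forall>b\<in>sphere 0 1. \<bar>D2 a b x\<bar> \<le> c \<and>
               (\<forall>y\<in>sphere 0 1. \<bar>D2 a b x - D2 a b y\<bar> \<le> c * dist x y powr \<alpha>)))))"

text \<open>Convergence to a slab: eventually the domains are bounded by normal graphs over the limiting
  slice, and the graph functions converge in \<open>C\<^sup>2\<^sup>,\<^sup>\<alpha>\<close>. The normal geodesics of the slices are the
  lines \<open>s \<mapsto> (s, x)\<close>, parametrized by arc length.\<close>

definition converges_to_slab ::
  "real \<Rightarrow> real \<Rightarrow> real \<Rightarrow> (nat \<Rightarrow> point set) \<Rightarrow> real \<Rightarrow> bool" where
  "converges_to_slab K E \<alpha> D s \<longleftrightarrow>
     (\<forall>\<epsilon>>0. \<forall>\<^sub>F n in sequentially. \<exists>u.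
        D n = {(t, x). x \<in> sphere 0 1 \<and> shat K E < t \<and> t < u x} \<and>
        holder_norm_le \<alpha> (\<lambda>x. u x - s) \<epsilon>)"

definition bifurcation_point :: "real \<Rightarrow> real \<Rightarrow> real \<Rightarrow> real \<Rightarrow> bool" where
  "bifurcation_point K E \<alpha> s \<longleftrightarrow> s \<in> {shat K E<..<0} \<and>
     (\<exists>\<sigma> D. (\<forall>n. \<sigma> n \<in> {shat K E<..<0}) \<and> \<sigma> \<longlonglongrightarrow> s \<and>
        converges_to_slab K E \<alpha> D s \<and>
        (\<forall>n. critical K E (slice_curvature K E (\<sigma> n)) (D n) \<and> D n \<noteq> slab K E (\<sigma> n)))"

end

theory Submission
  imports Defs
begin

text \<open>
  A slice \<open>{s} \<times> S\<^sup>2\<close> at \<open>r = - q\<close> has the Jacobi operator \<open>- (\<Delta> + \<nu>) / q\<^sup>2\<close> on the unit sphere, where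
  \<open>\<nu> = 2 + 6 K / q\<close>, so it degenerates whenever \<open>\<nu> = k (k + 1)\<close> with \<open>k \<ge> 2\<close>, and this happens infinitely
  often as \<open>q \<longlonglongrightarrow> 0\<close>. Bifurcating surfaces are found among graphs that are symmetric about an axis and
  about the equator: such a surface of constant mean curvature is a solution of an ordinary
  differential equation that leaves the pole regularly and whose slope vanishes at the equator. In
  the variable \<open>t = 1 - cos \<theta>\<close> the solution leaving the pole at distance \<open>\<delta>\<close> from the slice is a power
  series of radius of convergence larger than \<open>1\<close>, obtained by a contraction in a weighted
  \<open>\<ell>\<^sup>1\<close> algebra of coefficients around the Legendre function of parameter \<open>\<nu>\<close>. Its slope at the equator is
  \<open>\<delta>\<close> times the derivative of this Legendre function up to \<open>O(\<delta>\<^sup>2)\<close>, and for \<open>\<nu> = k (k + 1)\<close> with \<open>k\<close>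
  odd the derivative has the alternating sign \<open>(- 1)\<^bsup>(k - 1) / 2\<^esup>\<close>. By the intermediate value theorem in \<open>q\<close>,
  at fixed small \<open>\<delta> > 0\<close> and with the mean curvature of the slice, there is a nontrivial solution in each
  interval between consecutive odd \<open>k\<close>; letting \<open>\<delta> \<longlonglongrightarrow> 0\<close> gives a bifurcation point there. Only
  continuity in \<open>q\<close> is used, and the bifurcation point need not be located exactly.
\<close>

section \<open>Power series converging absolutely on a disk of radius 3/2\<close>

text \<open>Degeneracy of the slice does not obstruct the contraction, because shooting from the
  pole is an initial value problem: \<open>dleg\<close> raises the order of vanishing by one, its
  powers have norm at most \<open>3 ^ N / fact N\<close>, and \<open>1 + \<nu> dleg\<close> is
  invertible for every \<nu>. The degenerate case shows up only in the condition at the equator. For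
  the linear problem this condition is \<open>P'(0) = 0\<close>, which among integers happens at
  even \<open>k\<close>; the odd \<open>k\<close> are safe endpoints where the slope has a definite
  sign, and two consecutive ones enclose a degenerate slice. The radius 3/2 is a compromise. It
  exceeds 1, so the series continues past the equator and can be compared there with its own
  reflection; uniqueness for the initial value problem at the equator then makes the mirrored
  profile smooth. It is below 2, so the factor \<open>1 / (2 - t)\<close>, singular at the opposite
  pole, still lies in the algebra. Nontriviality is built in: the displacement at the pole is a
  fixed positive number while the slice is varied to meet the equatorial condition.\<close>

typedef dseries = "{c :: nat \<Rightarrow> real. summable (\<lambda>n. \<bar>c n\<bar> * (3/2) ^ n)}"
  morphisms dcoeff Abs_dseries
  by (rule exI[of _ "\<lambda>_. 0"]) simp

setup_lifting type_definition_dseries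

lemma summable_dcoeff: "summable (\<lambda>n. \<bar>dcoeff a n\<bar> * (3/2) ^ n)"
  using dcoeff[of a] by simp

lemma dseries_eqI: "(\<And>n. dcoeff a n = dcoeff b n) \<Longrightarrow> a = b"
  by (metis dcoeff_inject ext)

instantiation dseries :: real_normed_vector
begin

lift_definition zero_dseries :: dseries is "\<lambda>_. 0" by simp

lift_definition plus_dseries :: "dseries \<Rightarrow> dseries \<Rightarrow> dseries" is "\<lambda>a b n. a n + b n"
proof -
  fix a b :: "nat \<Rightarrow> real"
  assume "summable (\<lambda>n. \<bar>a n\<bar> * (3/2) ^ n)" "summable (\<lambda>n. \<bar>b n\<bar> * (3/2) ^ n)"
  from summable_add[OF this] show "summable (\<lambda>n. \<bar>a n + b n\<bar> * (3/2) ^ n)"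
    by (rule summable_comparison_test[rotated])
       (auto simp: abs_mult simp flip: distrib_right intro!: exI[of _ 0] mult_right_mono)
qed

lift_definition uminus_dseries :: "dseries \<Rightarrow> dseries" is "\<lambda>a n. - a n" by simp

lift_definition minus_dseries :: "dseries \<Rightarrow> dseries \<Rightarrow> dseries" is "\<lambda>a b n. a n - b n"
proof -
  fix a b :: "nat \<Rightarrow> real"
  assume "summable (\<lambda>n. \<bar>a n\<bar> * (3/2) ^ n)" "summable (\<lambda>n. \<bar>b n\<bar> * (3/2) ^ n)"
  from summable_add[OF this] show "summable (\<lambda>n. \<bar>a n - b n\<bar> * (3/2) ^ n)"
    by (rule summable_comparison_test[rotated])
       (auto simp: abs_mult simp flip: distrib_right intro!: exI[of _ 0] mult_right_mono)
qed

lift_definition scaleR_dseries :: "real \<Rightarrow> dseries \<Rightarrow> dseries" is "\<lambda>r a n. r * a n"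
  by (auto simp: abs_mult mult.assoc intro: summable_mult)

lift_definition norm_dseries :: "dseries \<Rightarrow> real" is "\<lambda>a. \<Sum>n. \<bar>a n\<bar> * (3/2) ^ n" .

definition dist_dseries :: "dseries \<Rightarrow> dseries \<Rightarrow> real" where
  "dist_dseries a b = norm (a - b)"
definition sgn_dseries :: "dseries \<Rightarrow> dseries" where
  "sgn_dseries a = inverse (norm a) *\<^sub>R a"
definition uniformity_dseries :: "(dseries \<times> dseries) filter" where
  "uniformity_dseries = (INF e\<in>{0<..}. principal {(x, y). dist x y < e})"
definition open_dseries :: "dseries set \<Rightarrow> bool" where
  "open_dseries U = (\<forall>x\<in>U. eventually (\<lambda>(x', y). x' = x \<longrightarrow> y \<in> U) uniformity)"

lemma dcoeff_scaleR [simp]: "dcoeff (r *\<^sub>R a) n = r * dcoeff a n"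
  by (simp add: scaleR_dseries.rep_eq)

instance
proof
  fix x y :: dseries and r :: real
  show "dist x y = norm (x - y)" by (simp add: dist_dseries_def)
  show "sgn x = inverse (norm x) *\<^sub>R x" by (simp add: sgn_dseries_def)
  show "(norm x = 0) = (x = 0)"
  proof
    assume "norm x = 0"
    then have "(\<Sum>n. \<bar>dcoeff x n\<bar> * (3/2) ^ n) = 0" by (simp add: norm_dseries.rep_eq)
    then have "\<bar>dcoeff x n\<bar> * (3/2) ^ n = 0" for n
      using suminf_eq_zero_iff[OF summable_dcoeff[of x]] by auto
    then show "x = 0" by (intro dseries_eqI) (auto simp: zero_dseries.rep_eq)
  qed (simp add: norm_dseries.rep_eq zero_dseries.rep_eq)
  show "norm (x + y) \<le> norm x + norm y"
    unfolding norm_dseries.rep_eq suminf_add[OF summable_dcoeff summable_dcoeff]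
    by (intro suminf_le summable_dcoeff summable_add)
       (auto simp: plus_dseries.rep_eq simp flip: distrib_right intro!: mult_right_mono)
  show "norm (r *\<^sub>R x) = \<bar>r\<bar> * norm x"
    unfolding norm_dseries.rep_eq suminf_mult[OF summable_dcoeff, symmetric]
    by (simp add: abs_mult mult.assoc)
qed (unfold uniformity_dseries_def open_dseries_def,
     auto intro!: dseries_eqI simp: plus_dseries.rep_eq zero_dseries.rep_eq minus_dseries.rep_eq
       uminus_dseries.rep_eq algebra_simps)

end

lemma dcoeff_simps [simp]:
  "dcoeff 0 n = 0" "dcoeff (a + b) n = dcoeff a n + dcoeff b n" "dcoeff (- a) n = - dcoeff a n"
  "dcoeff (a - b) n = dcoeff a n - dcoeff b n"
  by (simp_all add: zero_dseries.rep_eq plus_dseries.rep_eq uminus_dseries.rep_eq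
      minus_dseries.rep_eq)

lemma dcoeff_Abs: "summable (\<lambda>n. \<bar>c n\<bar> * (3/2) ^ n) \<Longrightarrow> dcoeff (Abs_dseries c) = c"
  by (simp add: Abs_dseries_inverse)

lemma weighted_coeff_le_norm: "\<bar>dcoeff a n\<bar> * (3/2) ^ n \<le> norm a"
  using sum_le_suminf[OF summable_dcoeff, of "{n}" a] by (simp add: norm_dseries.rep_eq)

lemma coeff_le_norm: "\<bar>dcoeff a n\<bar> \<le> norm a * (2/3) ^ n"
  using weighted_coeff_le_norm[of a n] by (simp add: power_divide field_simps)

lemma coeff_le_norm': "\<bar>dcoeff a n\<bar> \<le> norm a"
  using coeff_le_norm[of a n] mult_left_le[of "(2/3) ^ n" "norm a"] by (simp add: power_le_one)

text \<open>Bounds on finite partial sums survive coefficientwise limits. They give membership in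
  the algebra and a norm bound at once for a sequence that is known only coefficient by
  coefficient.\<close>

lemma norm_le_partial_sums:
  assumes "\<And>N. (\<Sum>n<N. \<bar>c n\<bar> * (3/2) ^ n) \<le> B"
  shows "summable (\<lambda>n. \<bar>c n\<bar> * (3/2) ^ n)" "norm (Abs_dseries c) \<le> B"
proof -
  show s: "summable (\<lambda>n. \<bar>c n\<bar> * (3/2) ^ n)"
    by (rule summableI_nonneg_bounded[OF _ assms]) auto
  show "norm (Abs_dseries c) \<le> B"
    unfolding norm_dseries.rep_eq dcoeff_Abs[OF s] using suminf_le_const[OF s assms] .
qed

instance dseries :: banach
proof
  fix X :: "nat \<Rightarrow> dseries"
  assume X: "Cauchy X"
  have "Cauchy (\<lambda>m. dcoeff (X m) n)" for n
  proof (rule metric_CauchyI)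
    fix e :: real assume "0 < e"
    from metric_CauchyD[OF X this] obtain M where M: "\<forall>m\<ge>M. \<forall>k\<ge>M. dist (X m) (X k) < e" by blast
    have "dist (dcoeff (X m) n) (dcoeff (X k) n) \<le> dist (X m) (X k)" for m k
      using coeff_le_norm'[of "X m - X k" n] by (simp add: dist_norm)
    with M show "\<exists>M. \<forall>m\<ge>M. \<forall>k\<ge>M. dist (dcoeff (X m) n) (dcoeff (X k) n) < e"
      by (meson le_less_trans)
  qed
  then have "\<exists>l. (\<lambda>m. dcoeff (X m) n) \<longlonglongrightarrow> l" for n
    using Cauchy_convergent_iff convergent_def by blast
  then obtain c where c: "\<And>n. (\<lambda>m. dcoeff (X m) n) \<longlonglongrightarrow> c n" by metis
  have part: "(\<Sum>n<N. \<bar>dcoeff (X m) n - c n\<bar> * (3/2) ^ n) \<le> e"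
    if "0 < e" and M: "\<forall>m\<ge>M. \<forall>k\<ge>M. dist (X m) (X k) < e" and "m \<ge> M" for e m M N
  proof (rule tendsto_upperbound)
    show "(\<lambda>k. \<Sum>n<N. \<bar>dcoeff (X m) n - dcoeff (X k) n\<bar> * (3/2) ^ n)
      \<longlonglongrightarrow> (\<Sum>n<N. \<bar>dcoeff (X m) n - c n\<bar> * (3/2) ^ n)"
      by (intro tendsto_intros c)
    show "\<forall>\<^sub>F k in sequentially. (\<Sum>n<N. \<bar>dcoeff (X m) n - dcoeff (X k) n\<bar> * (3/2) ^ n) \<le> e"
    proof (rule eventually_sequentiallyI[of M])
      fix k assume "M \<le> k"
      have "(\<Sum>n<N. \<bar>dcoeff (X m) n - dcoeff (X k) n\<bar> * (3/2) ^ n) \<le> norm (X m - X k)"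
        unfolding norm_dseries.rep_eq using sum_le_suminf[OF summable_dcoeff, of "{..<N}" "X m - X k"]
        by simp
      also have "\<dots> \<le> e" using M \<open>M \<le> k\<close> \<open>M \<le> m\<close> by (force simp: dist_norm)
      finally show "(\<Sum>n<N. \<bar>dcoeff (X m) n - dcoeff (X k) n\<bar> * (3/2) ^ n) \<le> e" .
    qed
  qed simp
  obtain M1 where M1: "\<forall>m\<ge>M1. \<forall>k\<ge>M1. dist (X m) (X k) < 1"
    using metric_CauchyD[OF X zero_less_one] by blast
  \<comment> \<open>Summability of \<open>c\<close> itself is not yet known. Its difference from
    \<open>X M1\<close> is summable by \<open>part\<close> with bound 1, so the limit is built as
    \<open>X M1\<close> minus this difference.\<close>
  define Y where "Y = X M1 - Abs_dseries (\<lambda>n. dcoeff (X M1) n - c n)"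
  have s1: "summable (\<lambda>n. \<bar>dcoeff (X M1) n - c n\<bar> * (3/2) ^ n)"
    by (rule norm_le_partial_sums(1)[OF part[OF zero_less_one M1 order_refl]])
  have Y: "dcoeff Y n = c n" for n
    unfolding Y_def by (simp add: dcoeff_Abs[OF s1])
  have "X \<longlonglongrightarrow> Y"
  proof (rule metric_LIMSEQ_I)
    fix e :: real assume "0 < e"
    then have e2: "0 < e / 2" by simp
    from metric_CauchyD[OF X this] obtain M where M: "\<forall>m\<ge>M. \<forall>k\<ge>M. dist (X m) (X k) < e / 2" by blast
    have "dist (X m) Y < e" if "m \<ge> M" for m
    proof -
      have s: "summable (\<lambda>n. \<bar>dcoeff (X m) n - c n\<bar> * (3/2) ^ n)"
        by (rule norm_le_partial_sums(1)[OF part[OF e2 M that]])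
      have "X m - Y = Abs_dseries (\<lambda>n. dcoeff (X m) n - c n)"
        by (rule dseries_eqI) (simp add: dcoeff_Abs[OF s] Y)
      then have "norm (X m - Y) \<le> e / 2"
        using norm_le_partial_sums(2)[OF part[OF e2 M that]] by simp
      with \<open>0 < e\<close> show ?thesis by (simp add: dist_norm)
    qed
    then show "\<exists>no. \<forall>n\<ge>no. dist (X n) Y < e" by blast
  qed
  then show "convergent X" by (auto simp: convergent_def)
qed

section \<open>The Banach algebra structure given by the Cauchy product\<close>

lemma cauchy_product_weighted:
  fixes a b :: "nat \<Rightarrow> real"
  assumes a: "summable (\<lambda>n. \<bar>a n\<bar> * (3/2) ^ n)" and b: "summable (\<lambda>n. \<bar>b n\<bar> * (3/2) ^ n)"
  shows "summable (\<lambda>n. \<bar>\<Sum>i\<le>n. a i * b (n - i)\<bar> * (3/2) ^ n)"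
    and "(\<Sum>n. \<bar>\<Sum>i\<le>n. a i * b (n - i)\<bar> * (3/2) ^ n)
      \<le> (\<Sum>n. \<bar>a n\<bar> * (3/2) ^ n) * (\<Sum>n. \<bar>b n\<bar> * (3/2) ^ n)"
proof -
  let ?a = "\<lambda>n. \<bar>a n\<bar> * (3/2) ^ n" and ?b = "\<lambda>n. \<bar>b n\<bar> * (3/2) ^ n"
  have na: "summable (\<lambda>n. norm (?a n))" and nb: "summable (\<lambda>n. norm (?b n))"
    using a b by (simp_all add: abs_mult)
  have le: "\<bar>\<Sum>i\<le>n. a i * b (n - i)\<bar> * (3/2) ^ n \<le> (\<Sum>i\<le>n. ?a i * ?b (n - i))" for n
  proof -
    have "\<bar>\<Sum>i\<le>n. a i * b (n - i)\<bar> * (3/2) ^ n \<le> (\<Sum>i\<le>n. \<bar>a i\<bar> * \<bar>b (n - i)\<bar>) * (3/2) ^ n"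
      by (intro mult_right_mono order_trans[OF sum_abs]) (auto simp: abs_mult)
    also have "\<dots> = (\<Sum>i\<le>n. ?a i * ?b (n - i))"
      unfolding sum_distrib_right
      by (intro sum.cong refl) (simp add: algebra_simps flip: power_add)
    finally show ?thesis .
  qed
  have S: "summable (\<lambda>n. \<Sum>i\<le>n. ?a i * ?b (n - i))"
    by (rule summable_Cauchy_product[OF na nb])
  show s: "summable (\<lambda>n. \<bar>\<Sum>i\<le>n. a i * b (n - i)\<bar> * (3/2) ^ n)"
    by (rule summable_comparison_test[OF _ S]) (auto simp: abs_mult intro!: exI[of _ 0] le)
  show "(\<Sum>n. \<bar>\<Sum>i\<le>n. a i * b (n - i)\<bar> * (3/2) ^ n) \<le> (\<Sum>n. ?a n) * (\<Sum>n. ?b n)"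
    unfolding Cauchy_product[OF na nb] by (intro suminf_le le s S)
qed

instantiation dseries :: "{comm_ring_1, real_normed_algebra_1}"
begin

lift_definition one_dseries :: dseries is "\<lambda>n. if n = 0 then 1 else 0"
  by (rule summable_finite[of "{0}"]) auto

lift_definition times_dseries :: "dseries \<Rightarrow> dseries \<Rightarrow> dseries"
  is "\<lambda>a b n. \<Sum>i\<le>n. a i * b (n - i)"
  by (rule cauchy_product_weighted)

text \<open>Formal power series are already a commutative ring, so associativity, commutativity and
  the unit law are pulled back along the coefficients.\<close>

lemma times_dseries_fps:
  "dcoeff (a * b) n = fps_nth (Abs_fps (dcoeff a) * Abs_fps (dcoeff b)) n"
  by (simp add: times_dseries.rep_eq fps_mult_nth atLeast0AtMost)

lemma times_dseries_fps':
  "Abs_fps (dcoeff (a * b)) = Abs_fps (dcoeff a) * Abs_fps (dcoeff b)"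
  by (rule fps_ext) (simp add: times_dseries_fps)

instance
proof
  fix a b c :: dseries and r :: real
  show "a * b * c = a * (b * c)"
    by (rule dseries_eqI) (simp add: times_dseries_fps times_dseries_fps' mult.assoc)
  have ab: "a * b = b * a" for a b :: dseries
    by (rule dseries_eqI) (simp add: times_dseries_fps mult.commute)
  have one: "Abs_fps (dcoeff 1) = 1"
    by (rule fps_ext) (simp add: one_dseries.rep_eq)
  show "a * b = b * a" by (rule ab)
  show "1 * a = a"
    by (rule dseries_eqI) (simp add: times_dseries_fps one)
  then show "a * 1 = a" by (simp add: ab)
  have dist: "(a + b) * c = a * c + b * c" for a b c :: dseries
    by (rule dseries_eqI) (simp add: times_dseries.rep_eq distrib_right sum.distrib)
  then show "(a + b) * c = a * c + b * c" .
  show "a * (b + c) = a * b + a * c" by (metis ab dist)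
  show "r *\<^sub>R a * b = r *\<^sub>R (a * b)"
    by (rule dseries_eqI) (simp add: times_dseries.rep_eq sum_distrib_left mult.assoc)
  show "a * r *\<^sub>R b = r *\<^sub>R (a * b)"
    by (rule dseries_eqI) (simp add: times_dseries.rep_eq sum_distrib_left algebra_simps)
  show "norm (a * b) \<le> norm a * norm b"
    unfolding norm_dseries.rep_eq times_dseries.rep_eq
    by (rule cauchy_product_weighted(2)[OF summable_dcoeff summable_dcoeff])
  show "norm (1::dseries) = 1"
    unfolding norm_dseries.rep_eq one_dseries.rep_eq
    by (subst suminf_finite[of "{0}"]) auto
  show "0 \<noteq> (1::dseries)"
  proof
    assume "0 = (1::dseries)"
    then have "dcoeff 0 0 = dcoeff 1 0" by simp
    then show False by (simp add: one_dseries.rep_eq)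
  qed
qed

end

lemma dcoeff_one: "dcoeff 1 n = (if n = 0 then 1 else 0)"
  by (simp add: one_dseries.rep_eq)

lemma dcoeff_of_real: "dcoeff (of_real c) n = (if n = 0 then c else 0)"
  by (simp add: of_real_def dcoeff_one)

section \<open>Evaluation as a homomorphism on the disk\<close>

definition dval :: "dseries \<Rightarrow> real \<Rightarrow> real" where
  "dval a t = (\<Sum>n. dcoeff a n * t ^ n)"

lemma abs_summable_dval:
  assumes "\<bar>t\<bar> \<le> 3/2"
  shows "summable (\<lambda>n. \<bar>dcoeff a n * t ^ n\<bar>)"
  by (rule summable_comparison_test[OF _ summable_dcoeff[of a]])
     (use assms in \<open>auto simp: abs_mult power_abs intro!: exI[of _ 0] mult_left_mono power_mono\<close>)

lemma summable_dval: "\<bar>t\<bar> \<le> 3/2 \<Longrightarrow> summable (\<lambda>n. dcoeff a n * t ^ n)"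
  by (rule summable_rabs_cancel[OF abs_summable_dval])

lemma abs_dval_le_norm:
  assumes "\<bar>t\<bar> \<le> 3/2"
  shows "\<bar>dval a t\<bar> \<le> norm a"
proof -
  have "\<bar>dval a t\<bar> \<le> (\<Sum>n. \<bar>dcoeff a n * t ^ n\<bar>)"
    unfolding dval_def by (rule summable_rabs[OF abs_summable_dval[OF assms]])
  also have "\<dots> \<le> norm a"
    unfolding norm_dseries.rep_eq
    by (intro suminf_le abs_summable_dval assms summable_dcoeff)
       (use assms in \<open>auto simp: abs_mult power_abs intro!: mult_left_mono power_mono\<close>)
  finally show ?thesis .
qed

lemma dval_add: "\<bar>t\<bar> \<le> 3/2 \<Longrightarrow> dval (a + b) t = dval a t + dval b t"
  unfolding dval_def by (simp add: suminf_add summable_dval distrib_right)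

lemma dval_diff: "\<bar>t\<bar> \<le> 3/2 \<Longrightarrow> dval (a - b) t = dval a t - dval b t"
  unfolding dval_def by (simp add: suminf_diff summable_dval left_diff_distrib)

lemma dval_scaleR: "\<bar>t\<bar> \<le> 3/2 \<Longrightarrow> dval (c *\<^sub>R a) t = c * dval a t"
  unfolding dval_def by (simp add: suminf_mult summable_dval mult.assoc)

lemma dval_minus: "\<bar>t\<bar> \<le> 3/2 \<Longrightarrow> dval (- a) t = - dval a t"
  unfolding dval_def by (simp add: suminf_minus summable_dval)

lemma dval_of_real [simp]: "dval (of_real c) t = c"
  unfolding dval_def by (subst suminf_finite[of "{0}"]) (auto simp: dcoeff_of_real)

lemma dval_one [simp]: "dval 1 t = 1"
  using dval_of_real[of 1] by simp

lemma dval_numeral [simp]: "dval (numeral w) t = numeral w"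
  using dval_of_real[of "numeral w"] by simp

lemma dval_zero [simp]: "dval 0 t = 0"
  using dval_of_real[of 0] by simp

lemma dval_mult:
  assumes "\<bar>t\<bar> \<le> 3/2"
  shows "dval (a * b) t = dval a t * dval b t"
proof -
  have "dval a t * dval b t = (\<Sum>n. \<Sum>i\<le>n. (dcoeff a i * t ^ i) * (dcoeff b (n - i) * t ^ (n - i)))"
    unfolding dval_def
    by (rule Cauchy_product) (simp_all add: abs_summable_dval[OF assms])
  also have "\<dots> = dval (a * b) t"
    unfolding dval_def times_dseries.rep_eq sum_distrib_right
    by (intro suminf_cong sum.cong refl) (simp add: algebra_simps flip: power_add)
  finally show ?thesis ..
qed

lemma bounded_linear_dval:
  assumes "\<bar>t\<bar> \<le> 3/2"
  shows "bounded_linear (\<lambda>a. dval a t)"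
  by (rule bounded_linear_intro[of _ 1])
     (use abs_dval_le_norm[OF assms] in \<open>auto simp: dval_add[OF assms] dval_scaleR[OF assms]\<close>)

lemmas dval_simps = dval_add dval_diff dval_scaleR dval_minus dval_mult

definition dvar :: dseries where
  "dvar = Abs_dseries (\<lambda>n. if n = 1 then 1 else 0)"

lemma dcoeff_dvar: "dcoeff dvar n = (if n = 1 then 1 else 0)"
  unfolding dvar_def by (subst dcoeff_Abs) (rule summable_finite[of "{1}"], auto)

lemma dval_dvar [simp]: "dval dvar t = t"
  unfolding dval_def by (subst suminf_finite[of "{1}"]) (auto simp: dcoeff_dvar)

text \<open>The average \<open>t\<^sup>-\<^sup>1 \<integral>\<^sub>0\<^sup>t a\<close>.\<close>

lift_definition davg :: "dseries \<Rightarrow> dseries" is "\<lambda>c n. c n / (Suc n)"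
proof -
  fix c :: "nat \<Rightarrow> real"
  assume c: "summable (\<lambda>n. \<bar>c n\<bar> * (3/2) ^ n)"
  have "\<bar>c n / Suc n\<bar> \<le> \<bar>c n\<bar>" for n
    using divide_left_mono[of 1 "real (Suc n)" "\<bar>c n\<bar>"] by (simp add: abs_divide)
  then show "summable (\<lambda>n. \<bar>c n / Suc n\<bar> * (3/2) ^ n)"
    by (intro summable_comparison_test[OF _ c])
       (auto simp del: of_nat_Suc times_divide_eq_left intro!: exI[of _ 0] mult_right_mono)
qed

definition dint :: "dseries \<Rightarrow> dseries" where
  "dint a = dvar * davg a"

lemma dcoeff_dvar_mult: "dcoeff (dvar * a) n = (if n = 0 then 0 else dcoeff a (n - 1))"
proof -
  have "Abs_fps (dcoeff dvar) = fps_X" by (rule fps_ext) (simp add: dcoeff_dvar)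
  then show ?thesis by (simp add: times_dseries_fps)
qed

lemma dcoeff_dint: "dcoeff (dint a) n = (if n = 0 then 0 else dcoeff a (n - 1) / n)"
  by (simp add: dint_def dcoeff_dvar_mult davg.rep_eq del: of_nat_Suc)

text \<open>The geometric series of \<open>1 / (2 - t)\<close>, whose radius of convergence 2
  exceeds 3/2.\<close>

lift_definition half_inverse :: dseries is "\<lambda>n. (1/2) ^ Suc n"
proof -
  have "summable (\<lambda>n. (1/2) * (3/4::real) ^ n)" by (intro summable_mult summable_geometric) simp
  also have "(\<lambda>n. (1/2) * (3/4::real) ^ n) = (\<lambda>n. \<bar>(1/2) ^ Suc n\<bar> * (3/2) ^ n)"
    by (rule ext) (simp add: abs_mult power_abs flip: power_mult_distrib)
  finally show "summable (\<lambda>n. \<bar>(1/2) ^ Suc n\<bar> * (3/2::real) ^ n)" .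
qed

lemma norm_half_inverse: "norm half_inverse = 2"
proof -
  have "(\<lambda>n. \<bar>(1/2) ^ Suc n\<bar> * (3/2::real) ^ n) = (\<lambda>n. (1/2) * (3/4::real) ^ n)"
    by (rule ext) (simp add: abs_mult power_abs flip: power_mult_distrib)
  moreover have "(\<lambda>n. (1/2) * (3/4::real) ^ n) sums ((1/2) * (1 / (1 - 3/4)))"
    by (intro sums_mult geometric_sums) simp
  ultimately show ?thesis
    unfolding norm_dseries.rep_eq half_inverse.rep_eq by (simp add: sums_iff)
qed

lemma half_inverse: "(2 - dvar) * half_inverse = 1"
proof (rule dseries_eqI)
  fix n
  have "dcoeff (2 * half_inverse) n = 2 * dcoeff half_inverse n"
    by (simp only: mult_2 dcoeff_simps)
  then show "dcoeff ((2 - dvar) * half_inverse) n = dcoeff 1 n"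
    by (cases n)
       (simp_all add: left_diff_distrib dcoeff_dvar_mult half_inverse.rep_eq dcoeff_one)
qed

section \<open>Legendre's operator and its inverse\<close>

definition dtau :: dseries where
  "dtau = dvar * (2 - dvar)"

lemma dval_dtau: "\<bar>t\<bar> \<le> 3/2 \<Longrightarrow> dval dtau t = t * (2 - t)"
  by (simp add: dtau_def dval_simps)

text \<open>The primitive of \<open>a\<close> divided by \<open>t (2 - t)\<close>, i.e. by the
  squared sine of the polar angle: averaging cancels the factor \<open>t\<close> at the pole, and
  \<open>half_inverse\<close> divides by \<open>2 - t\<close>. Being a series at 0, the quotient is
  the solution regular at the pole.\<close>

definition dflux :: "dseries \<Rightarrow> dseries" where
  "dflux a = half_inverse * davg a"

lemma dtau_dflux: "dtau * dflux a = dint a"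
proof -
  have "dtau * dflux a = dvar * (((2 - dvar) * half_inverse) * davg a)"
    by (simp only: dtau_def dflux_def mult.assoc)
  then show ?thesis by (simp add: half_inverse dint_def)
qed

lemma davg_linear: "davg (a + b) = davg a + davg b" "davg (r *\<^sub>R a) = r *\<^sub>R davg a"
  by (auto intro!: dseries_eqI simp: davg.rep_eq add_divide_distrib)

lemma norm_le_of_coeff_le:
  assumes "\<And>n. \<bar>dcoeff a n\<bar> \<le> B * \<bar>dcoeff b n\<bar>"
  shows "norm a \<le> B * norm b"
  unfolding norm_dseries.rep_eq suminf_mult[OF summable_dcoeff, symmetric]
  by (intro suminf_le summable_mult summable_dcoeff)
     (use assms in \<open>auto simp flip: mult.assoc intro!: mult_right_mono\<close>)

lemma norm_dvar: "norm dvar = 3/2"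
  unfolding norm_dseries.rep_eq by (subst suminf_finite[of "{1}"]) (auto simp: dcoeff_dvar)

lemma norm_davg_le:
  assumes "\<And>n. n < N \<Longrightarrow> dcoeff a n = 0"
  shows "norm (davg a) \<le> norm a / Suc N"
proof -
  have "norm (davg a) \<le> (1 / Suc N) * norm a"
  proof (rule norm_le_of_coeff_le)
    fix n
    show "\<bar>dcoeff (davg a) n\<bar> \<le> (1 / Suc N) * \<bar>dcoeff a n\<bar>"
    proof (cases "n < N")
      case False
      then have "1 / real (Suc n) \<le> 1 / real (Suc N)" by (intro divide_left_mono) auto
      from mult_right_mono[OF this, of "\<bar>dcoeff a n\<bar>"] show ?thesis
        by (simp add: davg.rep_eq abs_divide)
    qed (simp add: assms davg.rep_eq)
  qed
  then show ?thesis by simp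
qed

lemma norm_davg: "norm (davg a) \<le> norm a"
  using norm_davg_le[of 0 a] by simp

lemma bounded_linear_davg: "bounded_linear davg"
  by (rule bounded_linear_intro[of _ 1]) (simp_all add: davg_linear norm_davg)

lemma bounded_linear_dint: "bounded_linear dint"
  unfolding dint_def [abs_def]
  by (intro bounded_linear_mult_right[THEN bounded_linear_compose] bounded_linear_davg)

lemma bounded_linear_dflux: "bounded_linear dflux"
  unfolding dflux_def [abs_def]
  by (intro bounded_linear_mult_right[THEN bounded_linear_compose] bounded_linear_davg)

text \<open>In the variable \<open>t = 1 - z\<close>, Legendre's equation with eigenvalue \<open>\<nu>\<close> and the regular solution at the
  pole \<open>t = 0\<close> become \<open>a + \<nu> dleg a = const\<close>.\<close>

definition dleg :: "dseries \<Rightarrow> dseries" where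
  "dleg a = dint (dflux a)"

lemma bounded_linear_dleg: "bounded_linear dleg"
  unfolding dleg_def [abs_def]
  by (intro bounded_linear_dint[THEN bounded_linear_compose] bounded_linear_dflux)

lemmas dleg_simps = linear_add[OF bounded_linear.linear[OF bounded_linear_dleg]]
  linear_diff[OF bounded_linear.linear[OF bounded_linear_dleg]]
  linear_scale[OF bounded_linear.linear[OF bounded_linear_dleg]]

lemma mult_low_coeff:
  assumes "\<And>n. n < N \<Longrightarrow> dcoeff a n = 0" and "n < N"
  shows "dcoeff (b * a) n = 0"
  unfolding times_dseries.rep_eq using assms by (intro sum.neutral) auto

text \<open>The gain \<open>1 / Suc N\<close> comes from the inner average of a series that starts
  at degree \<open>N\<close>; the outer average is only bounded by 1. The constant 3 is the product
  of the norms 3/2 of \<open>dvar\<close> and 2 of \<open>half_inverse\<close>. Iteration turns the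
  gains into a factorial.\<close>

lemma dleg_order:
  assumes "\<And>n. n < N \<Longrightarrow> dcoeff a n = 0"
  shows "\<And>n. n < Suc N \<Longrightarrow> dcoeff (dleg a) n = 0"
    and "norm (dleg a) \<le> 3 / Suc N * norm a"
proof -
  have 1: "dcoeff (davg a) n = 0" if "n < N" for n using assms that by (simp add: davg.rep_eq)
  have 2: "dcoeff (dflux a) n = 0" if "n < N" for n
    unfolding dflux_def using mult_low_coeff[OF 1 that] .
  show "dcoeff (dleg a) n = 0" if "n < Suc N" for n
    using that 2 by (auto simp: dleg_def dcoeff_dint)
  have "norm (dleg a) \<le> 3/2 * norm (davg (dflux a))"
    unfolding dleg_def dint_def using norm_mult_ineq[of dvar] by (simp add: norm_dvar)
  also have "\<dots> \<le> 3/2 * norm (dflux a)" using norm_davg by simp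
  also have "\<dots> \<le> 3/2 * (2 * norm (davg a))"
    unfolding dflux_def using norm_mult_ineq[of half_inverse] by (simp add: norm_half_inverse)
  also have "\<dots> \<le> 3/2 * (2 * (norm a / Suc N))"
    using norm_davg_le[of N a, OF assms] by simp
  finally show "norm (dleg a) \<le> 3 / Suc N * norm a" by simp
qed

lemma dleg_power_order:
  "(\<forall>n<N. dcoeff ((dleg ^^ N) a) n = 0) \<and> norm ((dleg ^^ N) a) \<le> 3 ^ N / fact N * norm a"
proof (induction N)
  case (Suc N)
  have "norm ((dleg ^^ Suc N) a) \<le> 3 / Suc N * norm ((dleg ^^ N) a)"
    using dleg_order(2)[of N "(dleg ^^ N) a"] Suc by simp
  also have "\<dots> \<le> 3 / Suc N * (3 ^ N / fact N * norm a)"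
    using Suc by (intro mult_left_mono) auto
  finally show ?case using dleg_order(1)[of N "(dleg ^^ N) a"] Suc by simp
qed simp

text \<open>The Neumann series for the inverse of \<open>1 + \<nu> dleg\<close>, dominated by an
  exponential series. In particular \<open>dsolve \<nu> 1\<close> is the Legendre function of
  parameter \<nu> that is regular and equal to 1 at the pole.\<close>

definition dsolve :: "real \<Rightarrow> dseries \<Rightarrow> dseries" where
  "dsolve \<nu> a = (\<Sum>N. (- \<nu>) ^ N *\<^sub>R (dleg ^^ N) a)"

lemma norm_dsolve_term: "norm ((- \<nu>) ^ N *\<^sub>R (dleg ^^ N) a) \<le> (3 * \<bar>\<nu>\<bar>) ^ N /\<^sub>R fact N * norm a"
  using mult_left_mono[OF conjunct2[OF dleg_power_order[of N a]], of "\<bar>\<nu>\<bar> ^ N"]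
  by (simp add: power_abs power_mult_distrib divide_simps mult_ac)

lemma summable_dsolve_bound: "summable (\<lambda>N. (3 * \<bar>\<nu>\<bar>) ^ N /\<^sub>R fact N * norm (a::dseries))"
  by (intro summable_mult2 summable_exp_generic)

lemma summable_norm_dsolve: "summable (\<lambda>N. norm ((- \<nu>) ^ N *\<^sub>R (dleg ^^ N) a))"
  by (rule summable_comparison_test[OF _ summable_dsolve_bound[of \<nu> a]])
     (use norm_dsolve_term in auto)

lemma summable_dsolve: "summable (\<lambda>N. (- \<nu>) ^ N *\<^sub>R (dleg ^^ N) a)"
  by (rule summable_norm_cancel[OF summable_norm_dsolve])

lemma norm_dsolve: "norm (dsolve \<nu> a) \<le> exp (3 * \<bar>\<nu>\<bar>) * norm a"
proof -
  have "norm (dsolve \<nu> a) \<le> (\<Sum>N. norm ((- \<nu>) ^ N *\<^sub>R (dleg ^^ N) a))"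
    unfolding dsolve_def by (rule summable_norm[OF summable_norm_dsolve])
  also have "\<dots> \<le> (\<Sum>N. (3 * \<bar>\<nu>\<bar>) ^ N /\<^sub>R fact N * norm a)"
    by (intro suminf_le summable_norm_dsolve summable_dsolve_bound norm_dsolve_term)
  also have "\<dots> = exp (3 * \<bar>\<nu>\<bar>) * norm a"
    unfolding exp_def by (rule suminf_mult2[symmetric, OF summable_exp_generic])
  finally show ?thesis .
qed

lemma dsolve_eq: "dsolve \<nu> a + \<nu> *\<^sub>R dleg (dsolve \<nu> a) = a"
proof -
  have "dsolve \<nu> a = a + (\<Sum>N. (- \<nu>) ^ Suc N *\<^sub>R (dleg ^^ Suc N) a)"
    using suminf_split_head[OF summable_dsolve[of \<nu> a]] by (simp add: dsolve_def)
  also have "(\<Sum>N. (- \<nu>) ^ Suc N *\<^sub>R (dleg ^^ Suc N) a)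
      = (\<Sum>N. (- \<nu>) *\<^sub>R dleg ((- \<nu>) ^ N *\<^sub>R (dleg ^^ N) a))"
    by (intro suminf_cong) (simp add: dleg_simps)
  also have "\<dots> = (- \<nu>) *\<^sub>R dleg (dsolve \<nu> a)"
    unfolding dsolve_def
    by (intro bounded_linear.suminf[symmetric, OF _ summable_dsolve]
        bounded_linear_scaleR_right[THEN bounded_linear_compose] bounded_linear_dleg)
  finally have "dsolve \<nu> a = a + (- \<nu>) *\<^sub>R dleg (dsolve \<nu> a)" .
  then show ?thesis by (metis add.commute diff_add_cancel scaleR_minus_left uminus_add_conv_diff)
qed

text \<open>The difference \<open>d\<close> of two solutions satisfies
  \<open>d = - \<nu> dleg d\<close>, hence equals every term of its own Neumann series, and the
  terms of a convergent series tend to 0.\<close>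

lemma dsolve_unique:
  assumes "a + \<nu> *\<^sub>R dleg a = b"
  shows "a = dsolve \<nu> b"
proof -
  define d where "d = a - dsolve \<nu> b"
  have d: "d = (- \<nu>) *\<^sub>R dleg d"
    using assms dsolve_eq[of \<nu> b]
    by (simp add: d_def dleg_simps algebra_simps)
  have "d = (- \<nu>) ^ N *\<^sub>R (dleg ^^ N) d" for N
  proof (induction N)
    case (Suc N)
    have "d = (- \<nu>) *\<^sub>R dleg ((- \<nu>) ^ N *\<^sub>R (dleg ^^ N) d)"
      using d Suc by simp
    then show ?case by (simp add: dleg_simps)
  qed simp
  then have "(\<lambda>N. (- \<nu>) ^ N *\<^sub>R (dleg ^^ N) d) = (\<lambda>_. d)" by metis
  with summable_dsolve[of \<nu> d] have "d = 0"
    using summable_LIMSEQ_zero LIMSEQ_const_iff by metis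
  then show ?thesis by (simp add: d_def)
qed

lemma bounded_linear_dsolve: "bounded_linear (dsolve \<nu>)"
proof (rule bounded_linear_intro[of _ "exp (3 * \<bar>\<nu>\<bar>)"])
  fix a b r
  have "(dsolve \<nu> a + dsolve \<nu> b) + \<nu> *\<^sub>R dleg (dsolve \<nu> a + dsolve \<nu> b) = a + b"
    using dsolve_eq[of \<nu> a] dsolve_eq[of \<nu> b]
    by (simp add: dleg_simps algebra_simps)
  from dsolve_unique[OF this] show "dsolve \<nu> (a + b) = dsolve \<nu> a + dsolve \<nu> b" ..
  have "(r *\<^sub>R dsolve \<nu> a) + \<nu> *\<^sub>R dleg (r *\<^sub>R dsolve \<nu> a) = r *\<^sub>R a"
    using arg_cong[OF dsolve_eq[of \<nu> a], of "(*\<^sub>R) r"]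
    by (simp add: dleg_simps algebra_simps)
  from dsolve_unique[OF this] show "dsolve \<nu> (r *\<^sub>R a) = r *\<^sub>R dsolve \<nu> a" ..
  show "norm (dsolve \<nu> a) \<le> norm a * exp (3 * \<bar>\<nu>\<bar>)"
    using norm_dsolve by (simp add: mult.commute)
qed

text \<open>The resolvent identity; with the exponential norm bound it yields continuity in the
  parameter.\<close>

lemma dsolve_resolvent: "dsolve \<nu> a - dsolve \<mu> a = (\<mu> - \<nu>) *\<^sub>R dsolve \<nu> (dleg (dsolve \<mu> a))"
proof -
  have "(dsolve \<nu> a - dsolve \<mu> a) + \<nu> *\<^sub>R dleg (dsolve \<nu> a - dsolve \<mu> a)
      = (\<mu> - \<nu>) *\<^sub>R dleg (dsolve \<mu> a)"
    using dsolve_eq[of \<nu> a] dsolve_eq[of \<mu> a]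
    by (simp add: dleg_simps algebra_simps)
  from dsolve_unique[OF this] show ?thesis
    by (simp add: linear_scale[OF bounded_linear.linear[OF bounded_linear_dsolve]])
qed

lemma continuous_dsolve: "continuous_on UNIV (\<lambda>\<nu>. dsolve \<nu> a)"
proof -
  have "isCont (\<lambda>\<nu>. dsolve \<nu> a) \<mu>" for \<mu>
  proof -
    let ?b = "\<lambda>\<nu>. \<bar>\<mu> - \<nu>\<bar> * (exp (3 * \<bar>\<nu>\<bar>) * norm (dleg (dsolve \<mu> a)))"
    have "((\<lambda>\<nu>. dsolve \<nu> a - dsolve \<mu> a) \<longlongrightarrow> 0) (at \<mu>)"
    proof (rule Lim_null_comparison)
      have "(?b \<longlongrightarrow> \<bar>\<mu> - \<mu>\<bar> * (exp (3 * \<bar>\<mu>\<bar>) * norm (dleg (dsolve \<mu> a)))) (at \<mu>)"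
        by (intro tendsto_intros)
      then show "(?b \<longlongrightarrow> 0) (at \<mu>)" by simp
      show "\<forall>\<^sub>F \<nu> in at \<mu>. norm (dsolve \<nu> a - dsolve \<mu> a) \<le> ?b \<nu>"
        by (auto simp: dsolve_resolvent intro!: always_eventually mult_left_mono norm_dsolve)
    qed
    then show ?thesis by (simp add: isCont_def LIM_zero_iff)
  qed
  then show ?thesis by (simp add: continuous_on_eq_continuous_at)
qed

lemma continuous_on_dsolve [continuous_intros]:
  fixes \<nu> :: "'a::topological_space \<Rightarrow> real"
  assumes n: "continuous_on S \<nu>" and a: "continuous_on S a"
  shows "continuous_on S (\<lambda>s. dsolve (\<nu> s) (a s))"
  unfolding continuous_on_def
proof
  fix x assume x: "x \<in> S"
  have "((\<lambda>s. dsolve (\<nu> s) (a s - a x)) \<longlongrightarrow> 0) (at x within S)"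
  proof (rule Lim_null_comparison)
    show "\<forall>\<^sub>F s in at x within S. norm (dsolve (\<nu> s) (a s - a x)) \<le> exp (3 * \<bar>\<nu> s\<bar>) * norm (a s - a x)"
      by (intro always_eventually allI norm_dsolve)
    have "((\<lambda>s. exp (3 * \<bar>\<nu> s\<bar>) * norm (a s - a x)) \<longlongrightarrow> exp (3 * \<bar>\<nu> x\<bar>) * norm (a x - a x)) (at x within S)"
      using n a x by (intro tendsto_intros) (auto simp: continuous_on_def)
    then show "((\<lambda>s. exp (3 * \<bar>\<nu> s\<bar>) * norm (a s - a x)) \<longlongrightarrow> 0) (at x within S)" by simp
  qed
  moreover have "((\<lambda>s. dsolve (\<nu> s) (a x)) \<longlongrightarrow> dsolve (\<nu> x) (a x)) (at x within S)"
    using continuous_on_compose2[OF continuous_dsolve n] x by (auto simp: continuous_on_def)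
  ultimately have "((\<lambda>s. dsolve (\<nu> s) (a s - a x) + dsolve (\<nu> s) (a x)) \<longlongrightarrow> 0 + dsolve (\<nu> x) (a x))
      (at x within S)"
    by (rule tendsto_add)
  then show "((\<lambda>s. dsolve (\<nu> s) (a s)) \<longlongrightarrow> dsolve (\<nu> x) (a x)) (at x within S)"
    by (simp add: linear_diff[OF bounded_linear.linear[OF bounded_linear_dsolve]])
qed

section \<open>The sign of Legendre functions at the equator\<close>

text \<open>The point \<open>t = 0\<close> is a regular singular point, and expansion there gives a
  two-term recursion of hypergeometric type. The third equation is
  \<open>y' = - \<nu> dflux y\<close> read on coefficients; combined with
  \<open>(2 - dvar) * dflux y = davg y\<close> it gives the second.\<close>

lemma legendre_series_recursion:
  fixes k :: nat
  defines "\<nu> \<equiv> real k * (real k + 1)"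
  assumes "0 < k"
  defines "c \<equiv> dcoeff (dsolve \<nu> 1)" and "h \<equiv> dcoeff (dflux (dsolve \<nu> 1))"
  shows "c 0 = 1" "2 * (real n + 1)\<^sup>2 * c (Suc n) = (real n * (real n + 1) - \<nu>) * c n"
    "(real n + 1) * c (Suc n) = - \<nu> * h n"
proof -
  have nu: "\<nu> > 0" using \<open>0 < k\<close> by (simp add: \<nu>_def)
  have eq: "c n + \<nu> * (if n = 0 then 0 else h (n - 1) / n) = (if n = 0 then 1 else 0)" for n
    using arg_cong[OF dsolve_eq[of \<nu> 1], of "\<lambda>a. dcoeff a n"]
    by (cases "n = 0") (simp_all add: c_def h_def dleg_def dcoeff_dint dcoeff_one)
  show "c 0 = 1" using eq[of 0] by simp
  show ch: "(real n + 1) * c (Suc n) = - \<nu> * h n" for n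
    using eq[of "Suc n"] by (simp add: field_simps add_eq_0_iff)
  have "(2 - dvar) * dflux (dsolve \<nu> 1) = davg (dsolve \<nu> 1)"
    by (simp add: dflux_def half_inverse flip: mult.assoc)
  then have "dcoeff ((2 - dvar) * dflux (dsolve \<nu> 1)) n = dcoeff (davg (dsolve \<nu> 1)) n"
    by simp
  moreover have "dcoeff (2 * dflux (dsolve \<nu> 1)) n = 2 * h n"
    unfolding h_def by (simp only: mult_2 dcoeff_simps)
  ultimately have hh: "2 * h n - (if n = 0 then 0 else h (n - 1)) = c n / (real n + 1)"
    by (cases "n = 0")
       (simp_all add: left_diff_distrib dcoeff_dvar_mult davg.rep_eq c_def h_def add.commute)
  have "\<nu> * (c n / (real n + 1)) = - 2 * (real n + 1) * c (Suc n) + real n * c n"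
  proof (cases n)
    case (Suc m)
    have "\<nu> * (c n / (real n + 1)) = 2 * (\<nu> * h n) - \<nu> * h m"
      unfolding hh[symmetric] by (simp add: Suc algebra_simps)
    then show ?thesis using ch[of n] ch[of m] by (simp add: Suc algebra_simps)
  next
    case 0
    have "\<nu> * (c n / (real n + 1)) = 2 * (\<nu> * h n)"
      unfolding hh[symmetric] by (simp add: 0)
    then show ?thesis using ch[of n] by (simp add: 0)
  qed
  then have "\<nu> * c n = (- 2 * (real n + 1) * c (Suc n) + real n * c n) * (real n + 1)"
    by (simp add: field_simps)
  then show "2 * (real n + 1)\<^sup>2 * c (Suc n) = (real n * (real n + 1) - \<nu>) * c n"
    by (simp add: algebra_simps power2_eq_square)
qed

text \<open>For odd \<open>k\<close> the solution is the Legendre polynomial \<open>P\<close>. Its expansion around \<open>z = 1\<close>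
  (i.e. \<open>t = 0\<close>) shows that the leading coefficient is positive, and the two-step recursion for
  the coefficients in powers of \<open>z\<close> then determines the sign of \<open>P'(0)\<close>.\<close>

lemma legendre_sign:
  fixes m :: nat
  defines "k \<equiv> 2 * m + 1"
  shows "0 < (- 1) ^ m * dval (dflux (dsolve (real k * (real k + 1)) 1)) 1"
proof -
  define \<nu> where "\<nu> = real k * (real k + 1)"
  have k: "0 < k" by (simp add: k_def)
  then have nu: "0 < \<nu>" by (simp add: \<nu>_def)
  define c where "c = dcoeff (dsolve \<nu> 1)"
  define h where "h = dcoeff (dflux (dsolve \<nu> 1))"
  note rec = legendre_series_recursion[OF k, folded \<nu>_def, folded c_def h_def]
  have lt: "real n * (real n + 1) < \<nu>" if "n < k" for n
    unfolding \<nu>_def using that by (intro mult_strict_mono') auto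
  \<comment> \<open>The factor \<open>n (n + 1) - \<nu>\<close> is negative for \<open>n < k\<close>
    and zero for \<open>n = k\<close>, so the coefficients alternate in sign and then stop.\<close>
  have sgnc: "0 < (- 1) ^ n * c n" if "n \<le> k" for n
    using that
  proof (induction n)
    case (Suc n)
    have "(2 * (real n + 1)\<^sup>2) * ((- 1) ^ Suc n * c (Suc n))
      = (\<nu> - real n * (real n + 1)) * ((- 1) ^ n * c n)"
      using arg_cong[OF rec(2)[of n], of "\<lambda>x. (- 1) ^ Suc n * x"] by (simp add: algebra_simps)
    also have "\<dots> > 0" using Suc lt[of n] by (intro mult_pos_pos[of "_ - _"]) auto
    finally show ?case by (rule zero_less_mult_pos) simp
  qed (simp add: rec(1))
  have zero: "c n = 0" if "k < n" for n
    using that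
  proof (induction n)
    case (Suc n)
    have "2 * (real n + 1)\<^sup>2 * c (Suc n) = 0"
      using Suc rec(2)[of n] by (cases "n = k") (auto simp: \<nu>_def)
    then show ?case by (simp add: add_nonneg_eq_0_iff)
  qed simp
  define p where "p = Poly (map c [0..<Suc k])"
  have cp: "coeff p n = c n" for n
    using zero[of n] by (auto simp: p_def coeff_Poly_eq nth_default_def simp del: upt_Suc)
  have degp: "degree p = k"
    using sgnc[of k] zero by (intro antisym degree_le le_degree) (auto simp: cp)
  have ode_p: "[:0, 2, -1:] * pderiv (pderiv p) + [:2, -2:] * pderiv p + smult \<nu> p = 0"
  proof (rule poly_eqI)
    fix n
    show "coeff ([:0, 2, -1:] * pderiv (pderiv p) + [:2, -2:] * pderiv p + smult \<nu> p) n = coeff 0 n"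
      using rec(2)[of n]
      by (cases n; cases "n - 1")
         (auto simp: coeff_pderiv cp algebra_simps power2_eq_square coeff_pCons split: nat.splits)
  qed
  define P where "P = pcompose p [:1, -1:]"
  have dP: "pderiv P = - pcompose (pderiv p) [:1, -1:]"
    by (simp add: P_def pderiv_pcompose pderiv_pCons)
  have ddP: "pderiv (pderiv P) = pcompose (pderiv (pderiv p)) [:1, -1:]"
    by (simp add: dP pderiv_minus pderiv_pcompose pderiv_pCons)
  have "pcompose ([:0, 2, -1:] * pderiv (pderiv p) + [:2, -2:] * pderiv p + smult \<nu> p) [:1, -1:] = 0"
    unfolding ode_p by simp
  then have ode_P: "[:1, 0, -1:] * pderiv (pderiv P) - [:0, 2:] * pderiv P + smult \<nu> P = 0"
  proof -
    have 1: "pcompose [:0, 2, -1:] [:1, -1:] = [:1, 0, -1::real:]"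
      and 2: "pcompose [:2, -2:] [:1, -1:] = [:0, 2::real:]"
      by (simp_all add: pcompose_pCons)
    have 3: "pcompose (pderiv p) [:1, -1:] = - pderiv P" by (simp add: dP)
    assume "pcompose ([:0, 2, -1:] * pderiv (pderiv p) + [:2, -2:] * pderiv p + smult \<nu> p) [:1, -1:] = 0"
    then have "[:1, 0, -1:] * pderiv (pderiv P) + [:0, 2:] * (- pderiv P) + smult \<nu> P = 0"
      unfolding pcompose_add pcompose_mult pcompose_smult 1 2 3 ddP[symmetric] P_def[symmetric] .
    then show ?thesis by (simp only: mult_minus_right add_uminus_conv_diff)
  qed
  define a where "a = coeff P"
  have reca: "(real j + 1) * (real j + 2) * a (j + 2) = (real j * (real j + 1) - \<nu>) * a j" for j
    using arg_cong[OF ode_P, of "\<lambda>q. coeff q j"]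
    by (cases j; cases "j - 1")
       (auto simp: coeff_pderiv a_def algebra_simps coeff_pCons split: nat.splits)
  have "lead_coeff P = lead_coeff p * lead_coeff [:1, -1:] ^ degree p"
    unfolding P_def by (rule lead_coeff_comp) simp
  moreover have "degree P = k" by (simp add: P_def degp degree_pcompose)
  ultimately have "a k = c k * (- 1) ^ k" by (simp add: a_def degp cp)
  then have ak: "0 < a k" using sgnc[of k] by (simp add: mult.commute)
  \<comment> \<open>Powers of the same parity are linked. Since \<open>k\<close> is odd, the descent
    from the leading degree in steps of two reaches degree 1 after \<open>m\<close> steps, with one
    change of sign in each.\<close>
  have sgna: "0 < (- 1) ^ i * a (k - 2 * i)" if "2 * i \<le> k" for i
    using that
  proof (induction i)
    case (Suc i)
    define j where "j = k - 2 * Suc i"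
    have j: "k - 2 * i = j + 2" "j < k" using Suc.prems by (auto simp: j_def)
    have "(\<nu> - real j * (real j + 1)) * ((- 1) ^ Suc i * a j)
        = (real j + 1) * (real j + 2) * ((- 1) ^ i * a (j + 2))"
      using arg_cong[OF reca[of j], of "\<lambda>x. (- 1) ^ i * x"] by (simp add: algebra_simps)
    also have "\<dots> > 0" using Suc j(1) by (intro mult_pos_pos[of "_ * _"]) auto
    finally show ?case using lt[OF j(2)] unfolding j_def
      by (metis diff_gt_0_iff_gt zero_less_mult_pos)
  qed (simp add: ak)
  have "0 < (- 1) ^ m * a 1" using sgna[of m] by (simp add: k_def)
  \<comment> \<open>From \<open>P(z) = p(1 - z)\<close> one has \<open>P'(0) = - p'(1)\<close>, and
    \<open>- p'\<close> has the coefficients of \<open>\<nu> dflux\<close>; the point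
    \<open>t = 1\<close> is the equator.\<close>
  moreover have "a 1 = \<nu> * dval (dflux (dsolve \<nu> 1)) 1"
  proof -
    have "a 1 = poly (pderiv P) 0" by (simp add: a_def poly_0_coeff_0 coeff_pderiv)
    also have "\<dots> = - poly (pderiv p) 1" by (simp add: dP poly_pcompose)
    also have "\<dots> = - (\<Sum>n\<le>k. coeff (pderiv p) n)"
      by (auto simp: poly_altdef degree_pderiv degp intro!: sum.mono_neutral_left coeff_eq_0)
    also have "\<dots> = (\<Sum>n\<le>k. \<nu> * h n)"
    proof -
      have "coeff (pderiv p) n = - (\<nu> * h n)" for n
        using rec(3)[of n] by (simp add: coeff_pderiv cp add.commute)
      then show ?thesis by (simp add: sum_negf)
    qed
    also have "\<dots> = \<nu> * (\<Sum>n. h n * 1 ^ n)"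
    proof (subst suminf_finite[of "{..k}"])
      fix n assume "n \<notin> {..k}"
      then show "h n * 1 ^ n = 0" using rec(3)[of n] zero[of "Suc n"] nu by auto
    qed (auto simp: sum_distrib_left)
    finally show ?thesis by (simp add: dval_def h_def)
  qed
  ultimately have "0 < \<nu> * ((- 1) ^ m * dval (dflux (dsolve \<nu> 1)) 1)"
    by (metis mult.left_commute)
  then show ?thesis
    unfolding \<nu>_def[symmetric] using nu by (rule zero_less_mult_pos)
qed

section \<open>Fixed points of small nonlinear perturbations\<close>

text \<open>One Lipschitz constant on the unit ball serves all parameters, while continuity in the
  parameter is asked for each fixed argument separately. A product of two such maps is of second
  order, so the rules \<open>lip_intros\<close> read off the order of a polynomial expression from
  its form.\<close>

definition lip1 :: "'p::topological_space set \<Rightarrow> ('p \<Rightarrow> 'x::real_normed_vector \<Rightarrow> 'y::real_normed_vector) \<Rightarrow> bool"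
  where "lip1 S f \<longleftrightarrow> (\<forall>z. continuous_on S (\<lambda>s. f s z)) \<and> (\<exists>M\<ge>0. \<forall>s\<in>S. f s 0 = 0 \<and>
    (\<forall>z w. norm z \<le> 1 \<longrightarrow> norm w \<le> 1 \<longrightarrow> norm (f s z - f s w) \<le> M * norm (z - w)))"

text \<open>Maps that vanish to second order at the origin, uniformly in the parameter.\<close>

definition lip2 :: "'p::topological_space set \<Rightarrow> ('p \<Rightarrow> 'x::real_normed_vector \<Rightarrow> 'y::real_normed_vector) \<Rightarrow> bool"
  where "lip2 S f \<longleftrightarrow> (\<forall>z. continuous_on S (\<lambda>s. f s z)) \<and> (\<exists>M\<ge>0. \<forall>s\<in>S. f s 0 = 0 \<and>
    (\<forall>e z w. e \<le> 1 \<longrightarrow> norm z \<le> e \<longrightarrow> norm w \<le> e \<longrightarrow> norm (f s z - f s w) \<le> M * e * norm (z - w)))"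

named_theorems lip_intros

lemma lip2_imp_lip1:
  assumes "lip2 S f"
  shows "lip1 S f"
proof -
  obtain M where M: "0 \<le> M" "\<forall>s\<in>S. f s 0 = 0 \<and>
    (\<forall>e z w. e \<le> 1 \<longrightarrow> norm z \<le> e \<longrightarrow> norm w \<le> e \<longrightarrow> norm (f s z - f s w) \<le> M * e * norm (z - w))"
    using assms unfolding lip2_def by blast
  have "norm (f s z - f s w) \<le> M * norm (z - w)" if "s \<in> S" "norm z \<le> 1" "norm w \<le> 1" for s z w
    using M(2)[rule_format, OF that(1), THEN conjunct2, rule_format, OF order_refl that(2,3)] by simp
  with M assms show ?thesis unfolding lip1_def lip2_def by blast
qed

lemma lip1_linear:
  assumes "bounded_linear L"
  shows "lip1 S (\<lambda>s z. L z)"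
proof -
  interpret bounded_linear L by fact
  from nonneg_bounded obtain M where "M \<ge> 0" "\<And>x. norm (L x) \<le> norm x * M" by blast
  then show ?thesis unfolding lip1_def by (auto simp: zero mult.commute simp flip: diff)
qed

lemma lip2_mult [lip_intros]:
  fixes f g :: "'p::topological_space \<Rightarrow> 'x::real_normed_vector \<Rightarrow> 'y::real_normed_algebra"
  assumes "lip1 S f" "lip1 S g"
  shows "lip2 S (\<lambda>s z. f s z * g s z)"
proof -
  obtain M N where M: "0 \<le> M" "\<forall>s\<in>S. f s 0 = 0 \<and>
      (\<forall>z w. norm z \<le> 1 \<longrightarrow> norm w \<le> 1 \<longrightarrow> norm (f s z - f s w) \<le> M * norm (z - w))"
    and N: "0 \<le> N" "\<forall>s\<in>S. g s 0 = 0 \<and>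
      (\<forall>z w. norm z \<le> 1 \<longrightarrow> norm w \<le> 1 \<longrightarrow> norm (g s z - g s w) \<le> N * norm (z - w))"
    using assms unfolding lip1_def by blast
  have "norm (f s z * g s z - f s w * g s w) \<le> (2 * M * N) * e * norm (z - w)"
    if s: "s \<in> S" and e: "e \<le> 1" "norm z \<le> e" "norm w \<le> e" for s e z w
  proof -
    have z1: "norm z \<le> 1" "norm w \<le> 1" using e by auto
    have gz: "norm (g s z) \<le> N * e"
      using N(2)[rule_format, OF s, THEN conjunct2, rule_format, of z 0] N(2) s z1
        mult_left_mono[OF e(2) N(1)] by auto
    have fw: "norm (f s w) \<le> M * e"
      using M(2)[rule_format, OF s, THEN conjunct2, rule_format, of w 0] M(2) s z1
        mult_left_mono[OF e(3) M(1)] by auto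
    have "f s z * g s z - f s w * g s w = (f s z - f s w) * g s z + f s w * (g s z - g s w)"
      by (simp add: algebra_simps)
    then have "norm (f s z * g s z - f s w * g s w)
        \<le> norm (f s z - f s w) * norm (g s z) + norm (f s w) * norm (g s z - g s w)"
      by (metis add_mono norm_mult_ineq norm_triangle_le)
    also have "\<dots> \<le> (M * norm (z - w)) * (N * e) + (M * e) * (N * norm (z - w))"
      using M N s z1 gz fw by (intro add_mono mult_mono') auto
    finally show ?thesis by (simp add: algebra_simps)
  qed
  with M N assms show ?thesis
    unfolding lip2_def lip1_def
    by (intro conjI exI[of _ "2 * M * N"]) (auto intro!: continuous_intros)
qed

lemmas lip1_mult [lip_intros] = lip2_imp_lip1[OF lip2_mult]

lemma lip2_add [lip_intros]:
  assumes "lip2 S f" "lip2 S g"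
  shows "lip2 S (\<lambda>s z. f s z + g s z)"
proof -
  obtain M N where M: "0 \<le> M" "\<forall>s\<in>S. f s 0 = 0 \<and>
    (\<forall>e z w. e \<le> 1 \<longrightarrow> norm z \<le> e \<longrightarrow> norm w \<le> e \<longrightarrow> norm (f s z - f s w) \<le> M * e * norm (z - w))"
    and N: "0 \<le> N" "\<forall>s\<in>S. g s 0 = 0 \<and>
    (\<forall>e z w. e \<le> 1 \<longrightarrow> norm z \<le> e \<longrightarrow> norm w \<le> e \<longrightarrow> norm (g s z - g s w) \<le> N * e * norm (z - w))"
    using assms unfolding lip2_def by blast
  have "norm ((f s z + g s z) - (f s w + g s w)) \<le> (M + N) * e * norm (z - w)"
    if "s \<in> S" "e \<le> 1" "norm z \<le> e" "norm w \<le> e" for s e z w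
  proof -
    have "norm ((f s z + g s z) - (f s w + g s w)) \<le> norm (f s z - f s w) + norm (g s z - g s w)"
      by (simp add: add_diff_add norm_triangle_ineq)
    also have "\<dots> \<le> M * e * norm (z - w) + N * e * norm (z - w)"
      using M N that by (intro add_mono) auto
    finally show ?thesis by (simp add: algebra_simps)
  qed
  with M N assms show ?thesis
    unfolding lip2_def
    by (intro conjI exI[of _ "M + N"]) (auto intro!: continuous_intros)
qed

text \<open>The common source of the rules for scalar coefficients and for \<open>dsolve\<close>: a
  linear operator that varies with the parameter, with uniformly bounded norm, preserves second
  order.\<close>

lemma lip2_operator:
  assumes f: "lip2 S f" and L: "\<And>s. s \<in> S \<Longrightarrow> bounded_linear (L s)"
    and B: "\<And>s x. s \<in> S \<Longrightarrow> norm (L s x) \<le> B * norm x" "0 \<le> B"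
    and cont: "\<And>z. continuous_on S (\<lambda>s. f s z) \<Longrightarrow> continuous_on S (\<lambda>s. L s (f s z))"
  shows "lip2 S (\<lambda>s z. L s (f s z))"
proof -
  obtain M where M: "0 \<le> M" "\<forall>s\<in>S. f s 0 = 0 \<and>
    (\<forall>e z w. e \<le> 1 \<longrightarrow> norm z \<le> e \<longrightarrow> norm w \<le> e \<longrightarrow> norm (f s z - f s w) \<le> M * e * norm (z - w))"
    using f unfolding lip2_def by blast
  have "norm (L s (f s z) - L s (f s w)) \<le> (B * M) * e * norm (z - w)"
    if "s \<in> S" "e \<le> 1" "norm z \<le> e" "norm w \<le> e" for s e z w
  proof -
    have "norm (L s (f s z) - L s (f s w)) = norm (L s (f s z - f s w))"
      using L[OF that(1)] by (simp add: linear_diff bounded_linear.linear)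
    also have "\<dots> \<le> B * norm (f s z - f s w)" using B that by blast
    also have "\<dots> \<le> B * (M * e * norm (z - w))" using M that B by (intro mult_left_mono) auto
    finally show ?thesis by (simp add: algebra_simps)
  qed
  moreover have "L s 0 = 0" if "s \<in> S" for s using L[OF that] by (simp add: linear_0 bounded_linear.linear)
  ultimately show ?thesis
    using M B f cont unfolding lip2_def by (intro conjI exI[of _ "B * M"]) auto
qed

lemma lip2_linear:
  assumes "bounded_linear L" "lip2 S f"
  shows "lip2 S (\<lambda>s z. L (f s z))"
proof -
  obtain B where "B \<ge> 0" "\<And>x. norm (L x) \<le> norm x * B"
    using bounded_linear.nonneg_bounded[OF assms(1)] by blast
  then show ?thesis
    by (intro lip2_operator[OF assms(2), where B = B] assms(1) bounded_linear.continuous_on[OF assms(1)])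
       (simp_all add: mult.commute)
qed

lemma lip2_scaleR:
  assumes "compact S" "continuous_on S c" "lip2 S f"
  shows "lip2 S (\<lambda>s z. c s *\<^sub>R f s z)"
proof -
  obtain B where "\<forall>x\<in>c ` S. norm x \<le> B"
    using compact_imp_bounded[OF compact_continuous_image[OF assms(2,1)]] bounded_iff by blast
  then have B: "\<bar>c s\<bar> \<le> \<bar>B\<bar>" if "s \<in> S" for s using that by force
  show ?thesis
  proof (rule lip2_operator[OF assms(3)])
    show "norm (c s *\<^sub>R x) \<le> \<bar>B\<bar> * norm x" if "s \<in> S" for s x
      using mult_right_mono[OF B[OF that], of "norm x"] by simp
    show "continuous_on S (\<lambda>s. c s *\<^sub>R f s z)" if "continuous_on S (\<lambda>s. f s z)" for z
      using assms(2) that by (rule continuous_on_scaleR)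
  qed (auto intro: bounded_linear_scaleR_right)
qed

lemma lip2_dsolve:
  assumes "compact S" "continuous_on S \<nu>" "lip2 S f"
  shows "lip2 S (\<lambda>s z. dsolve (\<nu> s) (f s z))"
proof -
  obtain B where "\<forall>x\<in>\<nu> ` S. norm x \<le> B"
    using compact_imp_bounded[OF compact_continuous_image[OF assms(2,1)]] bounded_iff by blast
  then have B: "\<bar>\<nu> s\<bar> \<le> \<bar>B\<bar>" if "s \<in> S" for s using that by force
  show ?thesis
  proof (rule lip2_operator[OF assms(3)])
    show "norm (dsolve (\<nu> s) x) \<le> exp (3 * \<bar>B\<bar>) * norm x" if "s \<in> S" for s x
      using mult_right_mono[of "exp (3 * \<bar>\<nu> s\<bar>)" "exp (3 * \<bar>B\<bar>)" "norm x"] B[OF that]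
        norm_dsolve[of "\<nu> s" x] by simp
    show "continuous_on S (\<lambda>s. dsolve (\<nu> s) (f s z))" if "continuous_on S (\<lambda>s. f s z)" for z
      using assms(2) that by (rule continuous_on_dsolve)
  qed (auto intro: bounded_linear_dsolve)
qed

lemma lip2_uminus [lip_intros]: "lip2 S f \<Longrightarrow> lip2 S (\<lambda>s z. - f s z)"
  by (rule lip2_linear[OF bounded_linear_minus[OF bounded_linear_ident]])

lemma lip2_diff [lip_intros]: "lip2 S f \<Longrightarrow> lip2 S g \<Longrightarrow> lip2 S (\<lambda>s z. f s z - g s z)"
  using lip2_add[OF _ lip2_uminus, of S f g] by simp

lemma lip2_Pair [lip_intros]:
  assumes "lip2 S f" "lip2 S g"
  shows "lip2 S (\<lambda>s z. (f s z, g s z))"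
proof -
  have 1: "bounded_linear (\<lambda>x. (x, 0))" and 2: "bounded_linear (\<lambda>x. (0, x))"
    by (auto intro!: bounded_linear_Pair bounded_linear_ident bounded_linear_zero)
  have "lip2 S (\<lambda>s z. (f s z, 0) + (0, g s z))"
    by (intro lip2_add lip2_linear[OF 1] lip2_linear[OF 2] assms)
  then show ?thesis by simp
qed

text \<open>On a ball of radius proportional to \<open>d\<close> the remainder has Lipschitz
  constant at most 1/2, so the contraction principle applies. Inserting the size of the fixed point
  into \<open>R\<close> once more gives the quadratic error \<open>C * d\<^sup>2\<close>, which
  later lets the linear response decide signs.\<close>

lemma perturbed_fixed_point:
  fixes B :: "'p::topological_space \<Rightarrow> 'x::banach"
  assumes R: "lip2 S R" and B: "continuous_on S B" "\<And>s. s \<in> S \<Longrightarrow> norm (B s) \<le> b"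
  obtains C d0 where "0 < d0" "0 \<le> C"
    "\<And>d. 0 \<le> d \<Longrightarrow> d < d0 \<Longrightarrow> \<exists>Z. continuous_on S Z \<and>
      (\<forall>s\<in>S. Z s = d *\<^sub>R B s + R s (Z s) \<and> norm (Z s) \<le> C * d \<and> norm (Z s - d *\<^sub>R B s) \<le> C * d\<^sup>2)"
proof -
  obtain M where M: "0 \<le> M" and R0: "\<And>s. s \<in> S \<Longrightarrow> R s 0 = 0"
    and RM: "\<And>s e z w. s \<in> S \<Longrightarrow> e \<le> 1 \<Longrightarrow> norm z \<le> e \<Longrightarrow> norm w \<le> e
       \<Longrightarrow> norm (R s z - R s w) \<le> M * e * norm (z - w)"
    and Rc: "\<And>z. continuous_on S (\<lambda>s. R s z)"
    using R unfolding lip2_def by metis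
  define b' where "b' = \<bar>b\<bar> + 1"
  have b': "0 < b'" "\<And>s. s \<in> S \<Longrightarrow> norm (B s) \<le> b'" using B(2) by (force simp: b'_def)+
  \<comment> \<open>For \<open>e = 2 * b' * d\<close> this ensures
    \<open>e * (2 * M + 1) < 1\<close>, whence both \<open>e \<le> 1\<close> and
    \<open>M * e \<le> 1/2\<close>.\<close>
  define d0 where "d0 = 1 / (2 * b' * (2 * M + 1))"
  define C where "C = 2 * b' + 4 * M * b'\<^sup>2"
  show thesis
  proof
    show "0 < d0" using b' M by (simp add: d0_def)
    show "0 \<le> C" using b' M by (simp add: C_def)
    fix d :: real assume d: "0 \<le> d" "d < d0"
    define e where "e = 2 * b' * d"
    have e0: "0 \<le> e" using b' d by (simp add: e_def)
    have "e * (2 * M + 1) < 1"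
    proof -
      have "0 < 2 * b' * (2 * M + 1)" using b' M by simp
      then show ?thesis using d(2) by (simp add: e_def d0_def field_simps)
    qed
    then have e1: "e \<le> 1" "M * e \<le> 1/2"
      using mult_nonneg_nonneg[OF e0 M] e0 by (auto simp: algebra_simps)
    define T where "T = (\<lambda>s z. d *\<^sub>R B s + R s z)"
    have Rle: "norm (R s z) \<le> M * e * norm z" if "s \<in> S" "norm z \<le> e" for s z
      using RM[OF that(1) e1(1) that(2), of 0] R0[OF that(1)] e0 by simp
    have ball: "T s z \<in> cball 0 e" if s: "s \<in> S" and z: "norm z \<le> e" for s z
    proof -
      have "norm (T s z) \<le> norm (d *\<^sub>R B s) + norm (R s z)" unfolding T_def by (rule norm_triangle_ineq)
      also have "\<dots> \<le> d * b' + (1/2) * e"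
      proof (intro add_mono)
        show "norm (d *\<^sub>R B s) \<le> d * b'" using d b'(2)[OF s] by (simp add: mult_left_mono)
        have "norm (R s z) \<le> M * e * e"
          using Rle[OF s z] mult_left_mono[OF z, of "M * e"] M e0 by simp
        also have "\<dots> \<le> (1/2) * e" using e1 e0 by (intro mult_right_mono)
        finally show "norm (R s z) \<le> (1/2) * e" .
      qed
      also have "\<dots> = e" by (simp add: e_def)
      finally show ?thesis by simp
    qed
    have contr: "norm (T s z - T s w) \<le> (1/2) * norm (z - w)"
      if "s \<in> S" "norm z \<le> e" "norm w \<le> e" for s z w
      using RM[OF that(1) e1(1) that(2,3)] mult_right_mono[OF e1(2), of "norm (z - w)"]
      by (simp add: T_def)
    have "\<exists>z. norm z \<le> e \<and> T s z = z" if s: "s \<in> S" for s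
    proof -
      have "\<exists>!x\<in>cball 0 e. T s x = x"
      proof (rule Banach_fix[where c = "1/2"])
        show "cball (0::'x) e \<noteq> {}" using e0 by auto
        show "dist (T s x) (T s y) \<le> (1/2) * dist x y" if "x \<in> cball 0 e" "y \<in> cball 0 e" for x y
          using contr[OF s, of x y] that by (simp add: dist_norm)
        show "T s ` cball 0 e \<subseteq> cball 0 e" using ball[OF s] by auto
      qed (auto simp: complete_eq_closed)
      then show ?thesis by auto
    qed
    then obtain Z where Z: "\<And>s. s \<in> S \<Longrightarrow> norm (Z s) \<le> e" "\<And>s. s \<in> S \<Longrightarrow> T s (Z s) = Z s"
      by metis
    have "continuous_on S Z"
      unfolding continuous_on_def
    proof
      fix x assume x: "x \<in> S"
      \<comment> \<open>The contraction absorbs half of the distance between two fixed points. What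
        remains varies the parameter at the fixed argument \<open>Z x\<close>, where continuity is
        known.\<close>
      have le: "norm (Z s - Z x) \<le> 2 * norm (T s (Z x) - T x (Z x))" if s: "s \<in> S" for s
      proof -
        have "Z s - Z x = (T s (Z s) - T s (Z x)) + (T s (Z x) - T x (Z x))"
          using Z(2) s x by simp
        then have "norm (Z s - Z x) \<le> norm (T s (Z s) - T s (Z x)) + norm (T s (Z x) - T x (Z x))"
          by (metis norm_triangle_ineq)
        with contr[OF s Z(1)[OF s] Z(1)[OF x]] show ?thesis by simp
      qed
      have "continuous_on S (\<lambda>s. norm (T s (Z x) - T x (Z x)))"
        unfolding T_def by (intro continuous_intros B Rc)
      then have "((\<lambda>s. norm (T s (Z x) - T x (Z x))) \<longlongrightarrow> norm (T x (Z x) - T x (Z x))) (at x within S)"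
        using x unfolding continuous_on_def by blast
      then have "((\<lambda>s. norm (T s (Z x) - T x (Z x))) \<longlongrightarrow> 0) (at x within S)" by simp
      then have "((\<lambda>s. 2 * norm (T s (Z x) - T x (Z x))) \<longlongrightarrow> 0) (at x within S)"
        by (rule tendsto_mult_right_zero)
      then have "((\<lambda>s. Z s - Z x) \<longlongrightarrow> 0) (at x within S)"
        by (rule Lim_null_comparison[rotated]) (auto simp: eventually_at_filter le)
      then show "(Z \<longlongrightarrow> Z x) (at x within S)" by (rule LIM_zero_cancel)
    qed
    moreover have "Z s = d *\<^sub>R B s + R s (Z s)" if "s \<in> S" for s
      using Z(2)[OF that] by (simp add: T_def)
    moreover have "norm (Z s) \<le> C * d" if "s \<in> S" for s
      using Z(1)[OF that] d M by (auto simp: e_def C_def algebra_simps intro: order_trans)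
    moreover have "norm (Z s - d *\<^sub>R B s) \<le> C * d\<^sup>2" if s: "s \<in> S" for s
    proof -
      have "Z s - d *\<^sub>R B s = R s (Z s)" using Z(2)[OF s] by (simp add: T_def algebra_simps)
      then have "norm (Z s - d *\<^sub>R B s) \<le> M * e * norm (Z s)" using Rle[OF s Z(1)[OF s]] by simp
      also have "\<dots> \<le> M * e * e" using Z(1)[OF s] M e0 by (intro mult_left_mono) auto
      also have "\<dots> = (4 * M * b'\<^sup>2) * d\<^sup>2" by (simp add: e_def power2_eq_square)
      also have "\<dots> \<le> C * d\<^sup>2" using b' by (intro mult_right_mono) (auto simp: C_def)
      finally show ?thesis .
    qed
    ultimately show "\<exists>Z. continuous_on S Z \<and>
      (\<forall>s\<in>S. Z s = d *\<^sub>R B s + R s (Z s) \<and> norm (Z s) \<le> C * d \<and> norm (Z s - d *\<^sub>R B s) \<le> C * d\<^sup>2)"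
      by blast
  qed
qed

section \<open>Shooting from the pole\<close>

text \<open>Everything is written in terms of \<open>q = - r > 0\<close>; \<open>psi K E (- q)\<close> is \<open>\<psi>\<close> at \<open>r = - q\<close>.\<close>

lemma psi_sq_neg: "psi_sq K E (- q) = 1 + 2 * K / q + E * q\<^sup>2"
  by (simp add: psi_sq_def)

text \<open>The equations of a rotationally symmetric surface of constant mean curvature \<open>l\<close> in the variable
  \<open>t = 1 - cos \<theta>\<close>: \<open>p\<close> is \<open>\<psi>\<close>, \<open>n\<close> is the slope \<open>dw/dt\<close> for \<open>dw = ds / q\<close>, and \<open>x\<close> is the cosine of the
  angle between the normal and \<open>\<partial>\<^sub>s\<close>. The last equation is the equation for the mean curvature,
  integrated once and divided by \<open>sin\<^sup>2 \<theta> = t (2 - t)\<close>. All equations are polynomial, so that no functional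
  calculus is needed in the algebra of series.\<close>

definition profile_eqs :: "real \<Rightarrow> real \<Rightarrow> real \<Rightarrow> real \<Rightarrow> dseries \<Rightarrow> dseries \<Rightarrow> dseries \<Rightarrow> dseries \<Rightarrow> bool" where
  "profile_eqs K E l a q p x n \<longleftrightarrow>
     q = of_real a - dint (q * p * n) \<and>
     p * p * q = q + of_real (2 * K) + of_real E * (q * q * q) \<and>
     x * x = 1 - dtau * (x * x * n * n) \<and>
     x * n = dflux (of_real l * q - 2 * (p * x))"

lemma norm_snd_le_norm: "norm (snd z) \<le> norm z"
  by (cases z) (simp add: norm_snd_le)

locale shooting =
  fixes K E q1 q2 :: real
  assumes q1: "0 < q1" and q12: "q1 \<le> q2"
    and pos: "\<And>q. q \<in> {q1..q2} \<Longrightarrow> 0 < psi_sq K E (- q)"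
    and K: "0 < K"
begin

definition "I = {q1..q2}"
definition "\<psi> q = psi K E (- q)"
definition "lam q = 2 * \<psi> q / q"
text \<open>\<open>dpsi\<close> is \<open>d\<psi>/dq\<close>, and \<open>nu\<close> the eigenvalue parameter of the linearization at the slice.\<close>
definition "dpsi q = (1 + 3 * E * q\<^sup>2 - (\<psi> q)\<^sup>2) / (2 * \<psi> q * q)"
definition "nu q = 2 + 6 * K / q"

lemma compact_I: "compact I" by (simp add: I_def)

lemma psi_pos: "q \<in> I \<Longrightarrow> 0 < \<psi> q" using pos by (simp add: I_def \<psi>_def psi_def)
lemma psi_square: "q \<in> I \<Longrightarrow> (\<psi> q)\<^sup>2 = 1 + 2 * K / q + E * q\<^sup>2"
  using pos[of q] by (simp add: I_def \<psi>_def psi_def psi_sq_neg less_imp_le)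
lemma q_pos: "q \<in> I \<Longrightarrow> 0 < q" using q1 by (simp add: I_def)

lemma psi_cont [continuous_intros]: "continuous_on I \<psi>"
  unfolding \<psi>_def psi_def psi_sq_neg by (intro continuous_intros) (auto dest: q_pos)
lemma lam_cont [continuous_intros]: "continuous_on I lam"
  unfolding lam_def by (intro continuous_intros) (auto dest: q_pos)
lemma dpsi_cont [continuous_intros]: "continuous_on I dpsi"
  unfolding dpsi_def by (intro continuous_intros) (auto dest: q_pos psi_pos)
lemma nu_cont [continuous_intros]: "continuous_on I nu"
  unfolding nu_def by (intro continuous_intros) (auto dest: q_pos)

text \<open>Linearizing at the slice gives \<open>\<eta> = dpsi \<xi>\<close>,
  \<open>n = (lam - 2 dpsi) dflux \<xi>\<close> and \<open>\<xi> = d - q \<psi> dint n\<close>.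
  Eliminating \<open>n\<close> leaves Legendre's equation for \<xi> with this product as its
  parameter; the terms in \<open>E\<close> cancel by the formula for the square of \<psi>.\<close>

lemma nu_eq:
  assumes "q \<in> I"
  shows "q * \<psi> q * (lam q - 2 * dpsi q) = nu q"
proof -
  note p = q_pos[OF assms] psi_pos[OF assms] psi_square[OF assms]
  have "q * \<psi> q * (lam q - 2 * dpsi q) = 2 * (\<psi> q)\<^sup>2 - (1 + 3 * E * q\<^sup>2 - (\<psi> q)\<^sup>2)"
    using p(1,2) by (simp add: lam_def dpsi_def field_simps power2_eq_square)
  also have "\<dots> = nu q" by (simp add: p(3) nu_def)
  finally show ?thesis .
qed

text \<open>This is the factor between the slope of the linear response and \<open>dflux\<close> of
  the Legendre function; its positivity carries the Legendre sign over to the slope.\<close>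

lemma lam_dpsi_pos: "q \<in> I \<Longrightarrow> 0 < lam q - 2 * dpsi q"
  using nu_eq[of q] q_pos[of q] psi_pos[of q] K
  by (metis add_pos_pos divide_pos_pos mult_pos_pos nu_def zero_less_mult_pos zero_less_numeral)

type_synonym state = "dseries \<times> dseries \<times> dseries \<times> dseries"

text \<open>The unknown is \<open>(\<xi>, \<eta>, \<zeta>, n)\<close> with \<open>q = s + \<xi>\<close>, \<open>p = \<psi> s + \<eta>\<close>, \<open>x = 1 + \<zeta>\<close>. The functions \<open>rem\<close> are
  the nonlinear parts of the profile equations; \<open>res\<close> arises from them by solving the linear part.\<close>

definition rem_q :: "real \<Rightarrow> state \<Rightarrow> dseries" where
  "rem_q s = (\<lambda>(\<xi>, \<eta>, \<zeta>, n). - dint (s *\<^sub>R (\<eta> * n) + \<psi> s *\<^sub>R (\<xi> * n) + \<xi> * \<eta> * n))"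

definition rem_psi :: "real \<Rightarrow> state \<Rightarrow> dseries" where
  "rem_psi s = (\<lambda>(\<xi>, \<eta>, \<zeta>, n). (1 / (2 * \<psi> s * s)) *\<^sub>R
     ((E * (3 * s)) *\<^sub>R (\<xi> * \<xi>) + E *\<^sub>R (\<xi> * \<xi> * \<xi>)
      - (\<eta> * \<eta> * \<xi> + s *\<^sub>R (\<eta> * \<eta>) + (2 * \<psi> s) *\<^sub>R (\<eta> * \<xi>))))"

definition rem_x :: "real \<Rightarrow> state \<Rightarrow> dseries" where
  "rem_x s = (\<lambda>(\<xi>, \<eta>, \<zeta>, n). (- 1 / 2) *\<^sub>R
     (\<zeta> * \<zeta> + dtau * (n * n) + 2 *\<^sub>R (dtau * (\<zeta> * n * n)) + dtau * (\<zeta> * \<zeta> * n * n)))"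

definition rem_w :: "real \<Rightarrow> state \<Rightarrow> dseries" where
  "rem_w s z = (case z of (\<xi>, \<eta>, \<zeta>, n) \<Rightarrow>
     - dflux (2 *\<^sub>R rem_psi s z + (2 * \<psi> s) *\<^sub>R rem_x s z) - dflux (2 *\<^sub>R (\<eta> * \<zeta>)) - \<zeta> * n)"

definition res_q :: "real \<Rightarrow> state \<Rightarrow> dseries" where
  "res_q s z = dsolve (nu s) (rem_q s z - (s * \<psi> s) *\<^sub>R dint (rem_w s z))"

definition res :: "real \<Rightarrow> state \<Rightarrow> state" where
  "res s z = (res_q s z, dpsi s *\<^sub>R res_q s z + rem_psi s z, rem_x s z,
     (lam s - 2 * dpsi s) *\<^sub>R dflux (res_q s z) + rem_w s z)"

text \<open>The linear response to a unit displacement at the pole. The third component is 0 because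
  the cosine of the angle of inclination deviates from 1 only to second order.\<close>

definition lead :: "real \<Rightarrow> state" where
  "lead s = (dsolve (nu s) 1, dpsi s *\<^sub>R dsolve (nu s) 1, 0,
     (lam s - 2 * dpsi s) *\<^sub>R dflux (dsolve (nu s) 1))"

lemma lip1_comps [lip_intros]:
  "lip1 I (\<lambda>s z :: state. fst z)" "lip1 I (\<lambda>s z :: state. fst (snd z))"
  "lip1 I (\<lambda>s z :: state. fst (snd (snd z)))" "lip1 I (\<lambda>s z :: state. snd (snd (snd z)))"
  by (intro lip1_linear bounded_linear_fst bounded_linear_snd
      bounded_linear_compose[OF bounded_linear_fst] bounded_linear_compose[OF bounded_linear_snd])+

lemma coeff_cont:
  "continuous_on I (\<lambda>s. s)" "continuous_on I \<psi>" "continuous_on I (\<lambda>s. c)"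
  "continuous_on I (\<lambda>s. 1 / (2 * \<psi> s * s))" "continuous_on I (\<lambda>s. E * (3 * s))"
  "continuous_on I (\<lambda>s. 2 * \<psi> s)" "continuous_on I (\<lambda>s. s * \<psi> s)"
  "continuous_on I (\<lambda>s. lam s - 2 * dpsi s)"
  by (intro continuous_intros ballI; force dest: q_pos psi_pos)+

lemmas lip2_rules = lip_intros lip2_scaleR[OF compact_I] coeff_cont nu_cont dpsi_cont
  lip2_linear[OF bounded_linear_dint] lip2_linear[OF bounded_linear_dflux] lip2_dsolve[OF compact_I]

lemma lip2_rem_q: "lip2 I rem_q"
  unfolding rem_q_def case_prod_beta by (rule lip2_rules)+

lemma lip2_rem_psi: "lip2 I rem_psi"
  unfolding rem_psi_def case_prod_beta by (rule lip2_rules)+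

lemma lip2_rem_x: "lip2 I rem_x"
  unfolding rem_x_def case_prod_beta
  by (rule lip2_linear[OF bounded_linear_mult_right[of dtau]] | rule lip2_rules)+

lemma lip2_rem_w: "lip2 I rem_w"
  unfolding rem_w_def [abs_def] case_prod_beta prod.collapse by (rule lip2_rem_psi lip2_rem_x lip2_rules)+

lemma lip2_res_q: "lip2 I res_q"
  unfolding res_q_def [abs_def] by (rule lip2_rem_q lip2_rem_w lip2_rules)+

lemma lip2_res: "lip2 I res"
  unfolding res_def [abs_def] by (rule lip2_rem_psi lip2_rem_x lip2_rem_w lip2_res_q lip2_rules)+

lemma continuous_on_lead: "continuous_on I lead"
  unfolding lead_def [abs_def]
  by (intro continuous_intros bounded_linear.continuous_on[OF bounded_linear_dflux])

text \<open>The elimination is undone: \<open>\<eta>\<close> and \<open>n\<close> are expressed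
  through \<xi> again, and each profile equation is its linear part plus the matching
  remainder.\<close>

lemma fixed_point_profile:
  assumes s: "s \<in> I" and fp: "(\<xi>, \<eta>, \<zeta>, n) = d *\<^sub>R lead s + res s (\<xi>, \<eta>, \<zeta>, n)"
  shows "profile_eqs K E (lam s) (s + d) (of_real s + \<xi>) (of_real (\<psi> s) + \<eta>) (1 + \<zeta>) n"
proof -
  note sp = q_pos[OF s] psi_pos[OF s] psi_square[OF s]
  let ?z = "(\<xi>, \<eta>, \<zeta>, n)"
  note lin = linear_add[OF bounded_linear.linear] linear_diff[OF bounded_linear.linear]
    linear_scale[OF bounded_linear.linear]
  note lint = lin[OF bounded_linear_dint] and lfl = lin[OF bounded_linear_dflux]
  have xi: "\<xi> = d *\<^sub>R dsolve (nu s) 1 + res_q s ?z"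
    and eta: "\<eta> = d *\<^sub>R dpsi s *\<^sub>R dsolve (nu s) 1 + dpsi s *\<^sub>R res_q s ?z + rem_psi s ?z"
    and chi: "\<zeta> = rem_x s ?z"
    and n: "n = d *\<^sub>R (lam s - 2 * dpsi s) *\<^sub>R dflux (dsolve (nu s) 1)
      + (lam s - 2 * dpsi s) *\<^sub>R dflux (res_q s ?z) + rem_w s ?z"
    using fp by (simp_all add: lead_def res_def add.assoc)
  have eta': "\<eta> = dpsi s *\<^sub>R \<xi> + rem_psi s ?z"
    by (subst eta, subst xi) (simp add: algebra_simps)
  have n': "n = (lam s - 2 * dpsi s) *\<^sub>R dflux \<xi> + rem_w s ?z"
    by (subst n, subst (2) xi) (simp add: lfl algebra_simps)
  have "\<xi> = dsolve (nu s) (of_real d + rem_q s ?z - (s * \<psi> s) *\<^sub>R dint (rem_w s ?z))"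
    by (subst xi) (simp add: res_q_def of_real_def lin[OF bounded_linear_dsolve])
  then have "\<xi> + nu s *\<^sub>R dint (dflux \<xi>)
      = of_real d + rem_q s ?z - (s * \<psi> s) *\<^sub>R dint (rem_w s ?z)"
    using dsolve_eq by (metis dleg_def)
  \<comment> \<open>Read backwards, \<open>nu_eq\<close> factors the Legendre parameter, so that the
    term in \<open>dflux \<xi>\<close> and the correction in \<open>rem_w\<close> merge into one
    integral of the full slope \<open>n\<close>.\<close>
  then have xi': "\<xi> = of_real d + (rem_q s ?z - (s * \<psi> s) *\<^sub>R dint n)"
    by (subst (asm) nu_eq[OF s, symmetric], subst n') (simp add: lint algebra_simps)
  have "rem_q s ?z - (s * \<psi> s) *\<^sub>R dint n = - dint ((of_real s + \<xi>) * (of_real (\<psi> s) + \<eta>) * n)"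
  proof -
    have "(of_real s + \<xi>) * (of_real (\<psi> s) + \<eta>) * n
       = (s * \<psi> s) *\<^sub>R n + (s *\<^sub>R (\<eta> * n) + \<psi> s *\<^sub>R (\<xi> * n) + \<xi> * \<eta> * n)"
      by (simp add: algebra_simps scaleR_conv_of_real)
    then show ?thesis unfolding rem_q_def by (simp only: lint split: prod.split) simp
  qed
  with xi' have "\<xi> = of_real d + - dint ((of_real s + \<xi>) * (of_real (\<psi> s) + \<eta>) * n)"
    by simp
  then have 1: "of_real s + \<xi> = of_real (s + d) - dint ((of_real s + \<xi>) * (of_real (\<psi> s) + \<eta>) * n)"
    by (metis add.assoc add_uminus_conv_diff of_real_add)
  have "(2 * \<psi> s * s) *\<^sub>R \<eta> = (1 + 3 * E * s\<^sup>2 - (\<psi> s)\<^sup>2) *\<^sub>R \<xi> +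
     ((E * (3 * s)) *\<^sub>R (\<xi> * \<xi>) + E *\<^sub>R (\<xi> * \<xi> * \<xi>)
      - (\<eta> * \<eta> * \<xi> + s *\<^sub>R (\<eta> * \<eta>) + (2 * \<psi> s) *\<^sub>R (\<eta> * \<xi>)))"
    by (subst eta') (use sp in \<open>simp add: rem_psi_def dpsi_def scaleR_right_distrib\<close>)
  moreover have "(of_real (\<psi> s) + \<eta>) * (of_real (\<psi> s) + \<eta>) * (of_real s + \<xi>) =
     of_real ((\<psi> s)\<^sup>2 * s) + (\<psi> s)\<^sup>2 *\<^sub>R \<xi> + (2 * \<psi> s * s) *\<^sub>R \<eta> + (2 * \<psi> s) *\<^sub>R (\<eta> * \<xi>)
      + \<eta> * \<eta> * \<xi> + s *\<^sub>R (\<eta> * \<eta>)"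
    by (simp add: algebra_simps scaleR_conv_of_real power2_eq_square)
  ultimately have "(of_real (\<psi> s) + \<eta>) * (of_real (\<psi> s) + \<eta>) * (of_real s + \<xi>) =
     of_real ((\<psi> s)\<^sup>2 * s) + (1 + 3 * E * s\<^sup>2) *\<^sub>R \<xi> + (E * (3 * s)) *\<^sub>R (\<xi> * \<xi>) + E *\<^sub>R (\<xi> * \<xi> * \<xi>)"
    by (simp add: algebra_simps)
  also have "(\<psi> s)\<^sup>2 * s = s + 2 * K + E * s ^ 3"
    using sp by (simp add: field_simps power2_eq_square power3_eq_cube)
  finally have 2: "(of_real (\<psi> s) + \<eta>) * (of_real (\<psi> s) + \<eta>) * (of_real s + \<xi>) =
     (of_real s + \<xi>) + of_real (2 * K) + of_real E * ((of_real s + \<xi>) * (of_real s + \<xi>) * (of_real s + \<xi>))"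
    by (simp add: algebra_simps scaleR_conv_of_real power2_eq_square power3_eq_cube)
  have "2 *\<^sub>R \<zeta> = - (\<zeta> * \<zeta> + dtau * (n * n) + 2 *\<^sub>R (dtau * (\<zeta> * n * n)) + dtau * (\<zeta> * \<zeta> * n * n))"
    by (subst chi) (simp add: rem_x_def)
  then have 3: "(1 + \<zeta>) * (1 + \<zeta>) = 1 - dtau * ((1 + \<zeta>) * (1 + \<zeta>) * n * n)"
    by (simp add: algebra_simps scaleR_conv_of_real)
  have P: "rem_psi s ?z = \<eta> - dpsi s *\<^sub>R \<xi>" using eta' by (metis add_diff_cancel_left')
  have "n = (lam s - 2 * dpsi s) *\<^sub>R dflux \<xi> + (- dflux (2 *\<^sub>R (\<eta> - dpsi s *\<^sub>R \<xi>) + (2 * \<psi> s) *\<^sub>R \<zeta>)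
    - dflux (2 *\<^sub>R (\<eta> * \<zeta>)) - \<zeta> * n)"
    using n' unfolding rem_w_def prod.case P chi[symmetric] .
  also have "\<dots> = dflux (lam s *\<^sub>R \<xi> - 2 *\<^sub>R \<eta> - (2 * \<psi> s) *\<^sub>R \<zeta> - 2 *\<^sub>R (\<eta> * \<zeta>)) - \<zeta> * n"
    by (simp add: lfl algebra_simps)
  finally have nA: "n = dflux (lam s *\<^sub>R \<xi> - 2 *\<^sub>R \<eta> - (2 * \<psi> s) *\<^sub>R \<zeta> - 2 *\<^sub>R (\<eta> * \<zeta>)) - \<zeta> * n" .
  have AB: "lam s *\<^sub>R \<xi> - 2 *\<^sub>R \<eta> - (2 * \<psi> s) *\<^sub>R \<zeta> - 2 *\<^sub>R (\<eta> * \<zeta>)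
      = of_real (lam s) * (of_real s + \<xi>) - 2 * ((of_real (\<psi> s) + \<eta>) * (1 + \<zeta>))"
  proof -
    have "lam s * s = 2 * \<psi> s" using sp by (simp add: lam_def)
    then have "of_real (lam s) * of_real s = (2 * of_real (\<psi> s) :: dseries)"
      by (metis of_real_mult of_real_numeral)
    then show ?thesis by (simp add: algebra_simps scaleR_conv_of_real)
  qed
  have "(1 + \<zeta>) * n = n + \<zeta> * n" by (simp add: distrib_right)
  also have "\<dots> = dflux (lam s *\<^sub>R \<xi> - 2 *\<^sub>R \<eta> - (2 * \<psi> s) *\<^sub>R \<zeta> - 2 *\<^sub>R (\<eta> * \<zeta>))"
    using nA unfolding eq_diff_eq .
  finally have 4: "(1 + \<zeta>) * n
     = dflux (of_real (lam s) * (of_real s + \<xi>) - 2 * ((of_real (\<psi> s) + \<eta>) * (1 + \<zeta>)))"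
    unfolding AB .
  show ?thesis
    unfolding profile_eqs_def using 1 2 3 4 by blast
qed

text \<open>The equatorial slope \<open>f\<close> differs from \<open>d * g\<close> by less than
  \<open>d * m\<close>, where \<open>m\<close> is the smaller of the values of
  \<open>\<bar>g\<bar>\<close> at the two ends. So \<open>f\<close> has the signs of
  \<open>g\<close> there, which are opposite, and the continuous dependence of the fixed point on
  the slice gives a zero in between.\<close>

lemma shooting:
  assumes sgn: "dval (dflux (dsolve (nu q1) 1)) 1 * dval (dflux (dsolve (nu q2) 1)) 1 < 0"
    and e: "0 < e"
  obtains d s \<xi> \<eta> \<zeta> n where "0 < d" "d < e" "s \<in> {q1..q2}"
    "norm \<xi> < e" "norm \<eta> < e" "norm \<zeta> < e" "norm n < e" "dval n 1 = 0"
    "profile_eqs K E (lam s) (s + d) (of_real s + \<xi>) (of_real (\<psi> s) + \<eta>) (1 + \<zeta>) n"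
proof -
  let ?n = "\<lambda>z :: state. snd (snd (snd z))"
  obtain b where b: "\<And>s. s \<in> I \<Longrightarrow> norm (lead s) \<le> b"
    using compact_imp_bounded[OF compact_continuous_image[OF continuous_on_lead compact_I]]
    by (auto simp: bounded_iff)
  obtain C d0 where C: "0 < d0" "0 \<le> C" and
    fp: "\<And>d. 0 \<le> d \<Longrightarrow> d < d0 \<Longrightarrow> \<exists>Z. continuous_on I Z \<and>
      (\<forall>s\<in>I. Z s = d *\<^sub>R lead s + res s (Z s) \<and> norm (Z s) \<le> C * d \<and> norm (Z s - d *\<^sub>R lead s) \<le> C * d\<^sup>2)"
    by (rule perturbed_fixed_point[OF lip2_res continuous_on_lead b]) auto
  define g where "g s = dval (?n (lead s)) 1" for s
  have g: "g s = (lam s - 2 * dpsi s) * dval (dflux (dsolve (nu s) 1)) 1" for s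
    by (simp add: g_def lead_def dval_scaleR)
  have qI: "q1 \<in> I" "q2 \<in> I" using q12 by (auto simp: I_def)
  have "g q1 * g q2 = ((lam q1 - 2 * dpsi q1) * (lam q2 - 2 * dpsi q2)) *
    (dval (dflux (dsolve (nu q1) 1)) 1 * dval (dflux (dsolve (nu q2) 1)) 1)"
    unfolding g by (simp add: algebra_simps)
  then have gg: "g q1 * g q2 < 0"
    using sgn lam_dpsi_pos[OF qI(1)] lam_dpsi_pos[OF qI(2)] by (simp add: mult_pos_neg)
  define m where "m = min \<bar>g q1\<bar> \<bar>g q2\<bar>"
  have m: "0 < m" using gg by (auto simp: m_def)
  \<comment> \<open>The bound by \<open>m / (2 * (C + 1))\<close> makes the quadratic error smaller
    than the linear response at the ends; the bounds by \<open>e\<close> make the displacement and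
    the whole state small.\<close>
  define d where "d = min (min (d0 / 2) (e / 2)) (min (m / (2 * (C + 1))) (e / (2 * (C + 1))))"
  have d: "0 < d" "d < d0" "d < e" using C e m by (auto simp: d_def)
  have "d \<le> m / (2 * (C + 1))" "d \<le> e / (2 * (C + 1))" by (simp_all add: d_def)
  then have "d * (2 * (C + 1)) \<le> m" "d * (2 * (C + 1)) \<le> e"
    using C by (simp_all add: pos_le_divide_eq)
  then have "2 * d + 2 * (C * d) \<le> m" "2 * d + 2 * (C * d) \<le> e" by (simp_all add: algebra_simps)
  then have Cd: "C * d < m" "C * d < e" using d C mult_nonneg_nonneg[of C d] by linarith+
  obtain Z where Z: "continuous_on I Z" "\<And>s. s \<in> I \<Longrightarrow> Z s = d *\<^sub>R lead s + res s (Z s)"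
    "\<And>s. s \<in> I \<Longrightarrow> norm (Z s) \<le> C * d" "\<And>s. s \<in> I \<Longrightarrow> norm (Z s - d *\<^sub>R lead s) \<le> C * d\<^sup>2"
    using fp[of d] d by (meson less_imp_le)
  define f where "f s = dval (?n (Z s)) 1" for s
  have bl: "bounded_linear (\<lambda>z :: state. dval (?n z) 1)"
    by (intro bounded_linear_compose[OF bounded_linear_dval]
        bounded_linear_compose[OF bounded_linear_snd] bounded_linear_snd) auto
  have fcont: "continuous_on I f"
    unfolding f_def by (rule bounded_linear.continuous_on[OF bl Z(1)])
  have fg: "\<bar>f s - d * g s\<bar> < d * m" if "s \<in> I" for s
  proof -
    have "f s - d * g s = dval (?n (Z s - d *\<^sub>R lead s)) 1"
      by (simp add: f_def g_def dval_diff dval_scaleR)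
    also have "\<bar>\<dots>\<bar> \<le> norm (?n (Z s - d *\<^sub>R lead s))" by (rule abs_dval_le_norm) simp
    also have "\<dots> \<le> norm (Z s - d *\<^sub>R lead s)"
      by (intro order_trans[OF norm_snd_le_norm] order_refl)
    also have "\<dots> \<le> C * d\<^sup>2" using Z(4) that .
    also have "\<dots> < d * m" using Cd d by (simp add: power2_eq_square)
    finally show ?thesis .
  qed
  have fsgn: "f s * g s > 0" if "s \<in> I" "m \<le> \<bar>g s\<bar>" for s
  proof -
    have "d * m \<le> d * \<bar>g s\<bar>" using that d by simp
    with fg[OF that(1)] have "\<bar>f s - d * g s\<bar> < \<bar>d * g s\<bar>" using d(1) by (simp only: abs_mult abs_of_pos)
    moreover have "g s \<noteq> 0" using that m by auto
    ultimately show ?thesis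
      using d by (cases "g s > 0") (auto simp: zero_less_mult_iff abs_if mult_less_0_iff split: if_splits)
  qed
  have "f q1 * f q2 < 0"
    using fsgn[OF qI(1)] fsgn[OF qI(2)] gg
    by (auto simp: m_def zero_less_mult_iff mult_less_0_iff)
  then have "\<exists>s\<in>{q1..q2}. f s = 0"
    using IVT'[of f q1 0 q2] IVT2'[of f q2 0 q1] fcont q12
    by (fastforce simp: mult_less_0_iff I_def)
  then obtain s where s: "s \<in> I" "f s = 0" by (auto simp: I_def)
  obtain \<xi> \<eta> \<zeta> n where z: "Z s = (\<xi>, \<eta>, \<zeta>, n)" by (metis prod.collapse)
  have "norm \<xi> \<le> norm (Z s)" "norm (\<eta>, \<zeta>, n) \<le> norm (Z s)" "norm \<eta> \<le> norm (\<eta>, \<zeta>, n)"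
    "norm (\<zeta>, n) \<le> norm (\<eta>, \<zeta>, n)" "norm \<zeta> \<le> norm (\<zeta>, n)" "norm n \<le> norm (\<zeta>, n)"
    by (simp_all add: z norm_fst_le norm_snd_le)
  with Z(3)[OF s(1)] Cd(2) have "norm \<xi> < e" "norm \<eta> < e" "norm \<zeta> < e" "norm n < e" by auto
  moreover have "dval n 1 = 0" using s(2) by (simp add: f_def z)
  moreover have "profile_eqs K E (lam s) (s + d) (of_real s + \<xi>) (of_real (\<psi> s) + \<eta>) (1 + \<zeta>) n"
    using fixed_point_profile[OF s(1)] Z(2)[OF s(1)] z by auto
  ultimately show thesis using that d s by (auto simp: I_def)
qed

end

section \<open>From series to smooth even profiles\<close>

definition dder :: "nat \<Rightarrow> dseries \<Rightarrow> real \<Rightarrow> real" where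
  "dder k a t = (\<Sum>n. (diffs ^^ k) (dcoeff a) n * t ^ n)"

lemma diffs_apply: "diffs c n = real (Suc n) * (c (Suc n) :: real)"
  by (simp add: diffs_def)

lemma dder_0: "dder 0 a t = dval a t"
  by (simp add: dder_def dval_def)

lemma summable_dder: "\<bar>t\<bar> < 3/2 \<Longrightarrow> summable (\<lambda>n. (diffs ^^ k) (dcoeff a) n * t ^ n)"
proof (induction k arbitrary: t)
  case (Suc k)
  show ?case
    using termdiff_converges[of t "3/2" "(diffs ^^ k) (dcoeff a)"] Suc by simp
qed (simp add: summable_dval)

lemma has_derivative_dder:
  assumes "\<bar>t\<bar> < 3/2"
  shows "(dder k a has_real_derivative dder (Suc k) a t) (at t)"
proof -
  obtain r where r: "\<bar>t\<bar> < r" "r < 3/2" using assms dense by blast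
  have "summable (\<lambda>n. (diffs ^^ k) (dcoeff a) n * r ^ n)" using r by (intro summable_dder) auto
  from termdiffs_strong[OF this, of t] r show ?thesis
    by (simp add: dder_def [abs_def])
qed

lemma has_derivative_dval:
  "\<bar>t\<bar> < 3/2 \<Longrightarrow> (dval a has_real_derivative dder 1 a t) (at t)"
  using has_derivative_dder[of t 0 a] by (simp add: dder_0 [abs_def])

lemma has_derivative_dval_dint:
  assumes "\<bar>t\<bar> < 3/2"
  shows "(dval (dint a) has_real_derivative dval a t) (at t)"
proof -
  have "diffs (dcoeff (dint a)) = dcoeff a"
    by (rule ext) (simp add: diffs_def dcoeff_dint del: of_nat_Suc)
  then have "dder 1 (dint a) t = dval a t" by (simp add: dder_def dval_def)
  then show ?thesis using has_derivative_dval[OF assms, of "dint a"] by simp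
qed

lemma dder_dint: "dder (Suc k) (dint a) t = dder k a t"
proof -
  have "diffs (dcoeff (dint a)) = dcoeff a"
    by (rule ext) (simp add: diffs_def dcoeff_dint del: of_nat_Suc)
  then show ?thesis by (simp add: dder_def funpow_Suc_right del: funpow.simps)
qed

text \<open>Coefficients are dominated by \<open>norm a * (2/3) ^ n\<close>, and
  \<open>diffs\<close> preserves the domination, so each derivative is bounded by that of a
  geometric series at 1. Smallness in the algebra thus becomes smallness of all derivatives needed
  for the Hoelder norm.\<close>

lemma dder_bound:
  obtains D where "0 \<le> D" "\<And>a t. \<bar>t\<bar> \<le> 1 \<Longrightarrow> \<bar>dder k a t\<bar> \<le> D * norm a"
proof -
  define g where "g = (\<lambda>n. (2/3::real) ^ n)"
  have sg: "summable (\<lambda>n. (diffs ^^ k) g n * t ^ n)" if "\<bar>t\<bar> < 3/2" for t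
    using that
  proof (induction k arbitrary: t)
    case 0
    then have "norm (2/3 * t) < 1" by (simp add: abs_mult)
    then have "summable (\<lambda>n. (2/3 * t) ^ n)" by (rule summable_geometric)
    then show ?case unfolding g_def power_mult_distrib by simp
  next
    case (Suc k)
    then show ?case using termdiff_converges[of t "3/2" "(diffs ^^ k) g"] by simp
  qed
  have le: "\<bar>(diffs ^^ k) (dcoeff a) n\<bar> \<le> norm a * (diffs ^^ k) g n" for a n
  proof (induction k arbitrary: n)
    case 0
    then show ?case by (simp add: g_def coeff_le_norm)
  next
    case (Suc k)
    have "\<bar>(diffs ^^ Suc k) (dcoeff a) n\<bar> = real (Suc n) * \<bar>(diffs ^^ k) (dcoeff a) (Suc n)\<bar>"
      by (simp add: diffs_apply abs_mult)
    also have "\<dots> \<le> real (Suc n) * (norm a * (diffs ^^ k) g (Suc n))"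
      by (intro mult_left_mono Suc.IH) auto
    also have "\<dots> = norm a * (diffs ^^ Suc k) g n" by (simp add: diffs_apply)
    finally show ?case .
  qed
  have s1: "summable ((diffs ^^ k) g)" using sg[of 1] by simp
  show thesis
  proof
    fix a t assume t: "\<bar>t :: real\<bar> \<le> 1"
    have term_le: "\<bar>(diffs ^^ k) (dcoeff a) n * t ^ n\<bar> \<le> norm a * (diffs ^^ k) g n" for n
    proof -
      have "\<bar>t\<bar> ^ n \<le> 1" using t by (simp add: power_le_one)
      then have "\<bar>(diffs ^^ k) (dcoeff a) n * t ^ n\<bar> \<le> \<bar>(diffs ^^ k) (dcoeff a) n\<bar>"
        by (simp add: abs_mult power_abs mult_left_le)
      also have "\<dots> \<le> norm a * (diffs ^^ k) g n" by (rule le)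
      finally show ?thesis .
    qed
    have sa: "summable (\<lambda>n. \<bar>(diffs ^^ k) (dcoeff a) n * t ^ n\<bar>)"
      by (rule summable_comparison_test[OF _ summable_mult[OF s1, of "norm a"]])
         (use term_le in auto)
    have "\<bar>dder k a t\<bar> \<le> (\<Sum>n. \<bar>(diffs ^^ k) (dcoeff a) n * t ^ n\<bar>)"
      unfolding dder_def by (rule summable_rabs[OF sa])
    also have "\<dots> \<le> (\<Sum>n. norm a * (diffs ^^ k) g n)"
      by (intro suminf_le term_le sa summable_mult s1)
    also have "\<dots> = norm a * (\<Sum>n. (diffs ^^ k) g n)" by (rule suminf_mult[OF s1])
    also have "\<dots> \<le> \<bar>\<Sum>n. (diffs ^^ k) g n\<bar> * norm a"
      by (subst mult.commute) (intro mult_right_mono abs_ge_self norm_ge_zero)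
    finally show "\<bar>dder k a t\<bar> \<le> \<bar>\<Sum>n. (diffs ^^ k) g n\<bar> * norm a" .
  qed simp
qed

text \<open>Gronwall's argument: \<open>W = u\<^sup>2 + v\<^sup>2\<close> satisfies
  \<open>W' \<le> C * W\<close>, so \<open>W z * exp (- C * z)\<close> cannot rise from its initial
  value 0. With all coefficients 0 it also serves to show that a function with vanishing derivative
  stays 0.\<close>

lemma linear_ode_zero:
  fixes u v \<alpha> \<beta> \<gamma> \<delta> :: "real \<Rightarrow> real"
  assumes u: "\<And>z. 0 \<le> z \<Longrightarrow> z \<le> b \<Longrightarrow> (u has_real_derivative \<alpha> z * u z + \<beta> z * v z) (at z)"
    and v: "\<And>z. 0 \<le> z \<Longrightarrow> z \<le> b \<Longrightarrow> (v has_real_derivative \<gamma> z * u z + \<delta> z * v z) (at z)"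
    and cont: "continuous_on {0..b} \<alpha>" "continuous_on {0..b} \<beta>" "continuous_on {0..b} \<gamma>" "continuous_on {0..b} \<delta>"
    and 0: "u 0 = 0" "v 0 = 0" and b: "0 \<le> b"
  shows "u b = 0" "v b = 0"
proof -
  define c where "c z = 2 * (\<bar>\<alpha> z\<bar> + \<bar>\<beta> z\<bar> + \<bar>\<gamma> z\<bar> + \<bar>\<delta> z\<bar>)" for z
  have "continuous_on {0..b} c" unfolding c_def by (intro continuous_intros cont)
  from compact_imp_bounded[OF compact_continuous_image[OF this compact_Icc]]
  obtain C where "\<forall>y\<in>c ` {0..b}. norm y \<le> C" by (auto simp: bounded_iff)
  then have C: "c z \<le> C" if "0 \<le> z" "z \<le> b" for z using that by force
  define W where "W z = (u z)\<^sup>2 + (v z)\<^sup>2" for z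
  define W' where "W' z = 2 * u z * (\<alpha> z * u z + \<beta> z * v z) + 2 * v z * (\<gamma> z * u z + \<delta> z * v z)" for z
  have W': "(W has_real_derivative W' z) (at z)" if "0 \<le> z" "z \<le> b" for z
    unfolding W_def [abs_def] W'_def
    by (auto intro!: derivative_eq_intros u v that simp: algebra_simps)
  have le: "W' z \<le> C * W z" if "0 \<le> z" "z \<le> b" for z
  proof -
    have uv: "2 * \<bar>u z * v z\<bar> \<le> W z"
      using sum_squares_bound[of "\<bar>u z\<bar>" "\<bar>v z\<bar>"] by (simp add: W_def abs_mult)
    have "W' z = 2 * \<alpha> z * (u z)\<^sup>2 + 2 * (\<beta> z + \<gamma> z) * (u z * v z) + 2 * \<delta> z * (v z)\<^sup>2"
      by (simp add: W'_def algebra_simps power2_eq_square)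
    also have "\<dots> \<le> 2 * \<bar>\<alpha> z\<bar> * W z + (\<bar>\<beta> z\<bar> + \<bar>\<gamma> z\<bar>) * W z + 2 * \<bar>\<delta> z\<bar> * W z"
    proof (intro add_mono)
      have "\<alpha> z * (u z)\<^sup>2 \<le> \<bar>\<alpha> z\<bar> * W z" "\<delta> z * (v z)\<^sup>2 \<le> \<bar>\<delta> z\<bar> * W z"
        by (auto simp: W_def intro!: mult_mono)
      then show "2 * \<alpha> z * (u z)\<^sup>2 \<le> 2 * \<bar>\<alpha> z\<bar> * W z" "2 * \<delta> z * (v z)\<^sup>2 \<le> 2 * \<bar>\<delta> z\<bar> * W z"
        by simp_all
      have "2 * s * w \<le> \<bar>s\<bar> * (2 * \<bar>w\<bar>)" for s w :: real
        using abs_ge_self[of "s * w"] unfolding abs_mult by linarith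
      then have "2 * (\<beta> z + \<gamma> z) * (u z * v z) \<le> \<bar>\<beta> z + \<gamma> z\<bar> * (2 * \<bar>u z * v z\<bar>)" .
      also have "\<dots> \<le> (\<bar>\<beta> z\<bar> + \<bar>\<gamma> z\<bar>) * W z" using uv by (intro mult_mono) auto
      finally show "2 * (\<beta> z + \<gamma> z) * (u z * v z) \<le> (\<bar>\<beta> z\<bar> + \<bar>\<gamma> z\<bar>) * W z" .
    qed
    also have "\<dots> \<le> c z * W z"
      using mult_right_mono[of "2 * \<bar>\<alpha> z\<bar> + (\<bar>\<beta> z\<bar> + \<bar>\<gamma> z\<bar>) + 2 * \<bar>\<delta> z\<bar>" "c z" "W z"]
      by (simp add: W_def c_def algebra_simps)
    also have "\<dots> \<le> C * W z" using C[OF that] by (intro mult_right_mono) (auto simp: W_def)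
    finally show ?thesis .
  qed
  have "W b * exp (- C * b) \<le> W 0 * exp (- C * 0)"
  proof (rule DERIV_nonpos_imp_nonincreasing[OF b])
    fix z assume z: "0 \<le> z" "z \<le> b"
    have "((\<lambda>z. W z * exp (- C * z)) has_real_derivative (W' z - C * W z) * exp (- C * z)) (at z)"
      by (auto intro!: derivative_eq_intros W' z simp: algebra_simps)
    moreover have "(W' z - C * W z) * exp (- C * z) \<le> 0"
      using le[OF z] by (intro mult_nonpos_nonneg) auto
    ultimately show "\<exists>y. ((\<lambda>z. W z * exp (- C * z)) has_real_derivative y) (at z) \<and> y \<le> 0" by blast
  qed
  then have "W b * exp (- C * b) \<le> 0" by (simp add: W_def 0)
  then have "W b \<le> 0" by (metis exp_gt_zero mult_le_0_iff not_le)
  then show "u b = 0" "v b = 0" by (auto simp: W_def sum_power2_le_zero_iff)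
qed

lemma DERIV_cong_disk:
  assumes "(g has_real_derivative D) (at t)" "\<bar>t\<bar> < 3/2" "\<And>t. \<bar>t\<bar> < 3/2 \<Longrightarrow> f t = g t"
  shows "(f has_real_derivative D) (at t)"
  by (rule has_field_derivative_transform_within_open[OF assms(1), of "{-3/2<..<3/2}"])
     (use assms in auto)

text \<open>The polynomial equations fix only the squares of \<open>p\<close> and \<open>x\<close>;
  positivity selects the geometric branches. The condition \<open>equator\<close> is the one met by
  shooting.\<close>

locale profile =
  fixes K E l a :: real and q p x n :: dseries
  assumes eqs: "profile_eqs K E l a q p x n"
    and pos: "\<And>t. \<bar>t\<bar> \<le> 3/2 \<Longrightarrow> 0 < dval q t" "\<And>t. \<bar>t\<bar> \<le> 3/2 \<Longrightarrow> 0 < dval p t"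
      "\<And>t. \<bar>t\<bar> \<le> 3/2 \<Longrightarrow> 0 < dval x t"
    and equator: "dval n 1 = 0"
begin

abbreviation "tau t \<equiv> t * (2 - t :: real)"
definition "flux t = tau t * dval x t * dval n t"

lemma eqs':
  "q = of_real a - dint (q * p * n)" "p * p * q = q + of_real (2 * K) + of_real E * (q * q * q)"
  "x * x = 1 - dtau * (x * x * n * n)" "x * n = dflux (of_real l * q - 2 * (p * x))"
  using eqs by (simp_all add: profile_eqs_def)

lemma q_0: "dval q 0 = a"
  by (subst eqs'(1)) (simp add: dval_diff dint_def dval_mult)

lemma p_square:
  assumes "\<bar>t\<bar> \<le> 3/2"
  shows "(dval p t)\<^sup>2 = 1 + 2 * K / dval q t + E * (dval q t)\<^sup>2"
proof -
  have "(dval p t)\<^sup>2 * dval q t = dval q t + 2 * K + E * dval q t ^ 3"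
    using arg_cong[OF eqs'(2), of "\<lambda>c. dval c t"] assms
    by (simp add: dval_mult dval_add power2_eq_square power3_eq_cube del: of_real_mult)
  then show ?thesis using pos(1)[OF assms] by (simp add: field_simps power3_eq_cube power2_eq_square)
qed

lemma p_psi: "\<bar>t\<bar> \<le> 3/2 \<Longrightarrow> psi K E (- dval q t) = dval p t"
  using p_square[of t] pos(2)[of t] by (simp add: psi_def psi_sq_neg real_sqrt_unique)

lemma x_square:
  assumes "\<bar>t\<bar> \<le> 3/2"
  shows "(dval x t)\<^sup>2 * (1 + tau t * (dval n t)\<^sup>2) = 1"
  using arg_cong[OF eqs'(3), of "\<lambda>c. dval c t"] assms
  by (simp add: dval_mult dval_diff dval_dtau power2_eq_square algebra_simps)

lemma q_deriv:
  assumes "\<bar>t\<bar> < 3/2"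
  shows "(dval q has_real_derivative - (dval q t * dval p t * dval n t)) (at t)"
proof -
  have eq: "dval q t = a - dval (dint (q * p * n)) t" if "\<bar>t\<bar> < 3/2" for t
    using that by (subst eqs'(1)) (simp add: dval_diff)
  have "((\<lambda>t. a - dval (dint (q * p * n)) t) has_real_derivative - (dval q t * dval p t * dval n t)) (at t)"
    using has_derivative_dval_dint[OF assms, of "q * p * n"] assms
    by (auto intro!: derivative_eq_intros simp: dval_mult)
  then show ?thesis by (rule DERIV_cong_disk[OF _ assms eq])
qed

lemma flux_deriv:
  assumes "\<bar>t\<bar> < 3/2"
  shows "(flux has_real_derivative l * dval q t - 2 * dval p t * dval x t) (at t)"
proof -
  have "dtau * (x * n) = dint (of_real l * q - 2 * (p * x))"
    by (simp add: eqs'(4) dtau_dflux)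
  then have eq: "flux t = dval (dint (of_real l * q - 2 * (p * x))) t" if "\<bar>t\<bar> < 3/2" for t
    using that arg_cong[of "dtau * (x * n)" _ "\<lambda>c. dval c t"]
    by (metis dval_dtau dval_mult flux_def less_imp_le mult.assoc)
  have "(dval (dint (of_real l * q - 2 * (p * x))) has_real_derivative
      l * dval q t - 2 * dval p t * dval x t) (at t)"
    using has_derivative_dval_dint[OF assms, of "of_real l * q - 2 * (p * x)"] assms
    by (simp add: dval_mult dval_diff mult.assoc)
  then show ?thesis by (rule DERIV_cong_disk[OF _ assms eq])
qed

text \<open>The first integral is differentiated back. The derivative of \<open>x\<close> is
  eliminated through the normalization \<open>x\<^sup>2 (1 + tau n\<^sup>2) = 1\<close>, which
  leaves the second order equation that matches the pointwise curvature formula.\<close>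

lemma cmc_ode:
  assumes "\<bar>t\<bar> < 3/2"
  defines "z \<equiv> 1 - t" and "n' \<equiv> dder 1 n t"
  shows "dval x t * (z * dval n t + tau t * (dval x t)\<^sup>2 * n' + z * dval n t * (dval x t)\<^sup>2)
    = l * dval q t - 2 * dval p t * dval x t"
proof -
  let ?x = "dval x t" and ?n = "dval n t" and ?x' = "dder 1 x t"
  have le: "\<bar>t\<bar> \<le> 3/2" using assms by simp
  note dx = has_derivative_dval[OF assms(1), of x] and dn = has_derivative_dval[OF assms(1), of n]
  have d1: "((\<lambda>t. (dval x t)\<^sup>2 * (1 + tau t * (dval n t)\<^sup>2)) has_real_derivative
     2 * ?x * ?x' * (1 + tau t * ?n\<^sup>2) + ?x\<^sup>2 * (2 * z * ?n\<^sup>2 + tau t * (2 * ?n * n'))) (at t)"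
    by (auto intro!: derivative_eq_intros dx dn simp: z_def n'_def algebra_simps power2_eq_square)
  have "((\<lambda>t. 1::real) has_real_derivative
     2 * ?x * ?x' * (1 + tau t * ?n\<^sup>2) + ?x\<^sup>2 * (2 * z * ?n\<^sup>2 + tau t * (2 * ?n * n'))) (at t)"
    by (rule DERIV_cong_disk[OF d1 assms(1)]) (use x_square in simp)
  then have "2 * ?x * ?x' * (1 + tau t * ?n\<^sup>2) + ?x\<^sup>2 * (2 * z * ?n\<^sup>2 + tau t * (2 * ?n * n')) = 0"
    using DERIV_unique DERIV_const by blast
  then have "?x\<^sup>2 * (2 * ?x * ?x' * (1 + tau t * ?n\<^sup>2)) = - ?x\<^sup>2 * (?x\<^sup>2 * (2 * z * ?n\<^sup>2 + tau t * (2 * ?n * n')))"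
    by (simp add: add_eq_0_iff)
  moreover have "?x\<^sup>2 * (2 * ?x * ?x' * (1 + tau t * ?n\<^sup>2)) = 2 * ?x * ?x' * (?x\<^sup>2 * (1 + tau t * ?n\<^sup>2))"
    by (simp only: mult_ac)
  ultimately have "2 * ?x * ?x' = 2 * ?x * (- (?x ^ 3) * ?n * (z * ?n + tau t * n'))"
    unfolding x_square[OF le] by (simp add: algebra_simps power2_eq_square power3_eq_cube)
  then have x': "?x' = - (?x ^ 3) * ?n * (z * ?n + tau t * n')"
    using mult_left_cancel[of "2 * ?x"] pos(3)[OF le] by (metis mult_eq_0_iff less_irrefl zero_neq_numeral)
  have d2: "(flux has_real_derivative 2 * z * ?x * ?n + tau t * ?x' * ?n + tau t * ?x * n') (at t)"
    unfolding flux_def [abs_def]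
    by (auto intro!: derivative_eq_intros dx dn simp: z_def n'_def algebra_simps)
  have fl: "2 * z * ?x * ?n + tau t * ?x' * ?n + tau t * ?x * n' = l * dval q t - 2 * dval p t * ?x"
    by (rule DERIV_unique[OF d2 flux_deriv[OF assms(1)]])
  have tn: "?x\<^sup>2 * tau t * ?n\<^sup>2 = 1 - ?x\<^sup>2" using x_square[OF le] by (simp add: algebra_simps)
  have "2 * z * ?x * ?n + tau t * ?x' * ?n + tau t * ?x * n'
     = 2 * z * ?x * ?n - z * ?x * ?n * (?x\<^sup>2 * tau t * ?n\<^sup>2) + tau t * ?x * n' * (1 - ?x\<^sup>2 * tau t * ?n\<^sup>2)"
    unfolding x' by (simp add: algebra_simps power2_eq_square power3_eq_cube)
  also have "\<dots> = ?x * (z * ?n + tau t * ?x\<^sup>2 * n' + z * ?n * ?x\<^sup>2)"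
    unfolding tn by (simp add: algebra_simps power2_eq_square)
  finally show ?thesis using fl by simp
qed

text \<open>Given \<open>t\<close>, the value of \<open>x\<close> is determined by the flux. As
  \<open>tau\<close> takes equal values at reflected points, \<open>x\<close> is even once the flux
  is odd.\<close>

lemma flux_square:
  assumes "\<bar>t\<bar> \<le> 3/2"
  shows "tau t * (dval x t)\<^sup>2 = tau t - (flux t)\<^sup>2"
proof -
  have *: "T * X\<^sup>2 = T - (T * X * N)\<^sup>2" if "X\<^sup>2 * (1 + T * N\<^sup>2) = 1" for T X N :: real
    using arg_cong[OF that, of "(*) T"] by (simp add: algebra_simps power2_eq_square)
  show ?thesis unfolding flux_def by (rule *[OF x_square[OF assms]])
qed

text \<open>The reflected profile solves the same initial value problem at the equator \<open>t = 1\<close>.\<close>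

lemma even:
  assumes "0 \<le> z" "z < 1/2"
  shows "dval q (1 + z) = dval q (1 - z)" "flux (1 + z) = - flux (1 - z)"
proof -
  define b where "b = z"
  let ?q = "\<lambda>z. dval q (1 + z)" and ?qm = "\<lambda>z. dval q (1 - z)"
  let ?p = "\<lambda>z. dval p (1 + z)" and ?pm = "\<lambda>z. dval p (1 - z)"
  let ?x = "\<lambda>z. dval x (1 + z)" and ?xm = "\<lambda>z. dval x (1 - z)"
  let ?n = "\<lambda>z. dval n (1 + z)" and ?nm = "\<lambda>z. dval n (1 - z)"
  let ?m = "\<lambda>z. flux (1 + z)" and ?mm = "\<lambda>z. flux (1 - z)"
  define u v where "u z = ?q z - ?qm z" and "v z = ?m z + ?mm z" for z
  \<comment> \<open>At reflected points \<open>p\<close> and \<open>x\<close> are recovered from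
    \<open>q\<close> and the flux through their squares. Dividing differences of squares by positive
    sums shows that the differences of \<open>p\<close> and of \<open>x\<close> and the sum of the
    slopes are continuous multiples of \<open>u\<close> or \<open>v\<close>, which makes the system
    for \<open>u\<close> and \<open>v\<close> linear.\<close>
  define \<kappa> where "\<kappa> z = (- 2 * K / (?q z * ?qm z) + E * (?q z + ?qm z)) / (?p z + ?pm z)" for z
  define \<mu> where "\<mu> z = - (?m z - ?mm z) / ((1 - z\<^sup>2) * (?x z + ?xm z))" for z
  define \<nu> where "\<nu> z = (1 + ?mm z * \<mu> z / ?xm z) / ((1 - z\<^sup>2) * ?x z)" for z
  have ineq: "\<bar>1 + z\<bar> < 3/2" "\<bar>1 - z\<bar> < 3/2" "0 < 1 - z\<^sup>2" if "0 \<le> z" "z \<le> b" for z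
    using that assms by (auto simp: b_def abs_square_less_1)
  have pos': "0 < ?q z" "0 < ?qm z" "0 < ?p z" "0 < ?pm z" "0 < ?x z" "0 < ?xm z"
    if "0 \<le> z" "z \<le> b" for z
    using ineq[OF that] pos[of "1 + z"] pos[of "1 - z"] by auto
  have pd: "?p z - ?pm z = \<kappa> z * u z" if z: "0 \<le> z" "z \<le> b" for z
  proof -
    note P = pos'[OF z]
    have "(?p z - ?pm z) * (?p z + ?pm z) = (?p z)\<^sup>2 - (?pm z)\<^sup>2" by (simp add: power2_eq_square algebra_simps)
    also have "\<dots> = (- 2 * K / (?q z * ?qm z) + E * (?q z + ?qm z)) * u z"
      unfolding p_square[OF less_imp_le[OF ineq(1)[OF z]]] p_square[OF less_imp_le[OF ineq(2)[OF z]]] u_def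
      using P by (simp add: field_simps power2_eq_square)
    finally have "?p z - ?pm z = (- 2 * K / (?q z * ?qm z) + E * (?q z + ?qm z)) * u z / (?p z + ?pm z)"
      using P by (metis add_pos_pos less_irrefl nonzero_mult_div_cancel_right)
    then show ?thesis by (simp add: \<kappa>_def)
  qed
  have xd: "?x z - ?xm z = \<mu> z * v z" if z: "0 \<le> z" "z \<le> b" for z
  proof -
    note P = pos'[OF z]
    have tau: "tau (1 + z) = 1 - z\<^sup>2" "tau (1 - z) = 1 - z\<^sup>2" by (auto simp: algebra_simps power2_eq_square)
    have "(1 - z\<^sup>2) * ((?x z - ?xm z) * (?x z + ?xm z)) = (1 - z\<^sup>2) * (?x z)\<^sup>2 - (1 - z\<^sup>2) * (?xm z)\<^sup>2"
      by (simp add: power2_eq_square algebra_simps)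
    also have "\<dots> = - (?m z - ?mm z) * v z"
      using flux_square[OF less_imp_le[OF ineq(1)[OF z]]] flux_square[OF less_imp_le[OF ineq(2)[OF z]]]
      unfolding tau
      by (simp add: v_def algebra_simps power2_eq_square)
    finally have "(?x z - ?xm z) * ((1 - z\<^sup>2) * (?x z + ?xm z)) = - (?m z - ?mm z) * v z"
      by (simp add: mult_ac)
    moreover have "(1 - z\<^sup>2) * (?x z + ?xm z) \<noteq> 0" using P ineq(3)[OF z] by auto
    ultimately have "?x z - ?xm z = - (?m z - ?mm z) * v z / ((1 - z\<^sup>2) * (?x z + ?xm z))"
      by (metis nonzero_mult_div_cancel_right)
    then show ?thesis by (simp add: \<mu>_def)
  qed
  have nd: "?n z + ?nm z = \<nu> z * v z" if z: "0 \<le> z" "z \<le> b" for z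
  proof -
    note P = pos'[OF z]
    have n: "(1 - z\<^sup>2) * ?x z * ?n z = ?m z" "(1 - z\<^sup>2) * ?xm z * ?nm z = ?mm z"
      by (simp_all add: flux_def algebra_simps power2_eq_square)
    have "((1 - z\<^sup>2) * ?x z) * (?n z + ?nm z) * ?xm z = ?m z * ?xm z + ?mm z * ?x z"
      unfolding n[symmetric] by (simp add: algebra_simps)
    also have "\<dots> = v z * ?xm z + ?mm z * (?x z - ?xm z)" by (simp add: v_def algebra_simps)
    also have "\<dots> = (?xm z + ?mm z * \<mu> z) * v z" by (simp add: xd[OF z] algebra_simps)
    finally have "((1 - z\<^sup>2) * ?x z) * (?n z + ?nm z) = (1 + ?mm z * \<mu> z / ?xm z) * v z"
      using P by (simp add: field_simps)
    moreover have "(1 - z\<^sup>2) * ?x z \<noteq> 0" using P ineq(3)[OF z] by auto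
    ultimately have "?n z + ?nm z = (1 + ?mm z * \<mu> z / ?xm z) * v z / ((1 - z\<^sup>2) * ?x z)"
      by (metis nonzero_mult_div_cancel_left)
    then show ?thesis by (simp add: \<nu>_def)
  qed
  define \<alpha> where "\<alpha> z = ?nm z * (?p z + ?qm z * \<kappa> z)" for z
  define \<beta> where "\<beta> z = - (?q z * ?p z * \<nu> z)" for z
  define \<gamma> where "\<gamma> z = l - 2 * ?x z * \<kappa> z" for z
  define \<delta> where "\<delta> z = - (2 * ?pm z * \<mu> z)" for z
  have shift: "((\<lambda>z. f (1 + z)) has_real_derivative D) (at z)" if "(f has_real_derivative D) (at (1 + z))" for f D z
    using that by (rule DERIV_chain2[where g = "\<lambda>z. 1 + z", THEN DERIV_cong]) (auto intro!: derivative_eq_intros)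
  have shift': "((\<lambda>z. f (1 - z)) has_real_derivative - D) (at z)" if "(f has_real_derivative D) (at (1 - z))" for f D z
    using that by (rule DERIV_chain2[where g = "\<lambda>z. 1 - z", THEN DERIV_cong]) (auto intro!: derivative_eq_intros)
  have du: "(u has_real_derivative \<alpha> z * u z + \<beta> z * v z) (at z)" if z: "0 \<le> z" "z \<le> b" for z
  proof -
    have "(u has_real_derivative - (?q z * ?p z * ?n z) - (- (- (?qm z * ?pm z * ?nm z)))) (at z)"
      unfolding u_def [abs_def]
      by (intro DERIV_diff shift shift' q_deriv ineq[OF z])
    moreover have "- (?q z * ?p z * ?n z) - (- (- (?qm z * ?pm z * ?nm z)))
      = - (?q z * ?p z * (?n z + ?nm z)) + ?nm z * (?p z * u z + ?qm z * (?p z - ?pm z))"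
      by (simp add: u_def algebra_simps)
    moreover have "\<dots> = \<alpha> z * u z + \<beta> z * v z"
      unfolding nd[OF z] pd[OF z] by (simp add: \<alpha>_def \<beta>_def algebra_simps)
    ultimately show ?thesis by simp
  qed
  have dv: "(v has_real_derivative \<gamma> z * u z + \<delta> z * v z) (at z)" if z: "0 \<le> z" "z \<le> b" for z
  proof -
    have "(v has_real_derivative (l * ?q z - 2 * ?p z * ?x z) + - (l * ?qm z - 2 * ?pm z * ?xm z)) (at z)"
      unfolding v_def [abs_def]
      by (intro DERIV_add shift shift' flux_deriv ineq[OF z])
    moreover have "(l * ?q z - 2 * ?p z * ?x z) + - (l * ?qm z - 2 * ?pm z * ?xm z)
      = l * u z - 2 * ?x z * (?p z - ?pm z) - 2 * ?pm z * (?x z - ?xm z)"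
      by (simp add: u_def algebra_simps)
    moreover have "\<dots> = \<gamma> z * u z + \<delta> z * v z"
      unfolding xd[OF z] pd[OF z] by (simp add: \<gamma>_def \<delta>_def algebra_simps)
    ultimately show ?thesis by simp
  qed
  have cd: "continuous_on {0..b} (\<lambda>z. dval c (1 + z))" "continuous_on {0..b} (\<lambda>z. dval c (1 - z))" for c
    by (auto intro!: DERIV_atLeastAtMost_imp_continuous_on shift shift' has_derivative_dval ineq)
  have cm: "continuous_on {0..b} ?m" "continuous_on {0..b} ?mm"
    unfolding flux_def by (intro continuous_intros cd)+
  have nz: "?p z + ?pm z \<noteq> 0" "?x z + ?xm z \<noteq> 0" "?x z \<noteq> 0" "?xm z \<noteq> 0" "?q z \<noteq> 0" "?qm z \<noteq> 0"
    "1 - z\<^sup>2 \<noteq> 0" if "z \<in> {0..b}" for z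
    using pos'[of z] ineq(3)[of z] that by auto
  have c\<kappa>: "continuous_on {0..b} \<kappa>"
    unfolding \<kappa>_def by (intro continuous_intros cd) (use nz in auto)
  have c\<mu>: "continuous_on {0..b} \<mu>"
    unfolding \<mu>_def by (intro continuous_intros cd cm) (use nz in auto)
  have c\<nu>: "continuous_on {0..b} \<nu>"
    unfolding \<nu>_def by (intro continuous_intros cd cm c\<mu>) (use nz in auto)
  have cc: "continuous_on {0..b} \<alpha>" "continuous_on {0..b} \<beta>" "continuous_on {0..b} \<gamma>" "continuous_on {0..b} \<delta>"
    unfolding \<alpha>_def \<beta>_def \<gamma>_def \<delta>_def by (intro continuous_intros cd cm c\<kappa> c\<mu> c\<nu>)+
  have "u 0 = 0" "v 0 = 0" by (simp_all add: u_def v_def flux_def equator)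
  moreover have "0 \<le> b" using assms by (simp add: b_def)
  ultimately have "u b = 0" "v b = 0" using linear_ode_zero[OF du dv cc] by blast+
  then show "dval q (1 + z) = dval q (1 - z)" "flux (1 + z) = - flux (1 - z)"
    by (simp_all add: u_def v_def b_def)
qed

lemma n_odd:
  assumes "0 \<le> z" "z < 1/2"
  shows "dval n (1 + z) = - dval n (1 - z)"
proof -
  have t: "\<bar>1 + z\<bar> \<le> 3/2" "\<bar>1 - z\<bar> \<le> 3/2" using assms by auto
  have z2: "0 < 1 - z\<^sup>2" using assms by (simp add: abs_square_less_1)
  have tau: "tau (1 + z) = 1 - z\<^sup>2" "tau (1 - z) = 1 - z\<^sup>2"
    by (auto simp: algebra_simps power2_eq_square)
  have "(1 - z\<^sup>2) * (dval x (1 + z))\<^sup>2 = (1 - z\<^sup>2) * (dval x (1 - z))\<^sup>2"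
    using flux_square[OF t(1)] flux_square[OF t(2)] unfolding tau even(2)[OF assms] by simp
  then have x: "dval x (1 + z) = dval x (1 - z)"
    using z2 pos(3)[OF t(1)] pos(3)[OF t(2)] by (simp add: power2_eq_iff_nonneg)
  have "(1 - z\<^sup>2) * dval x (1 - z) * dval n (1 + z) = (1 - z\<^sup>2) * dval x (1 - z) * - dval n (1 - z)"
    using even(2)[OF assms] tau x by (simp add: flux_def)
  moreover have "(1 - z\<^sup>2) * dval x (1 - z) \<noteq> 0" using z2 pos(3)[OF t(2)] by simp
  ultimately show ?thesis by (metis mult_left_cancel)
qed

text \<open>The coordinate \<open>s\<close> along the profile: \<open>ds = q n dt\<close>, starting
  at the pole from the arc length that belongs to \<open>r = - a\<close>.\<close>

definition height :: dseries where
  "height = of_real (arclength K E (- a)) + dint (q * n)"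

lemma height_deriv:
  assumes "\<bar>t\<bar> < 3/2"
  shows "(dval height has_real_derivative dval q t * dval n t) (at t)"
proof -
  have eq: "dval height t = arclength K E (- a) + dval (dint (q * n)) t" if "\<bar>t\<bar> < 3/2" for t
    using that by (simp add: height_def dval_add)
  have "((\<lambda>t. arclength K E (- a) + dval (dint (q * n)) t) has_real_derivative dval q t * dval n t) (at t)"
    using has_derivative_dval_dint[OF assms, of "q * n"] assms
    by (auto intro!: derivative_eq_intros simp: dval_mult)
  then show ?thesis by (rule DERIV_cong_disk[OF _ assms eq])
qed

lemma dder_height:
  assumes "\<bar>t\<bar> < 3/2"
  shows "dder 1 height t = dval q t * dval n t"
    "dder 2 height t = - (dval q t * dval p t * dval n t) * dval n t + dval q t * dder 1 n t"
proof -
  have 1: "dder 1 height t = dval q t * dval n t" if "\<bar>t\<bar> < 3/2" for t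
    using DERIV_unique[OF has_derivative_dval[OF that] height_deriv[OF that]] .
  then show "dder 1 height t = dval q t * dval n t" using assms .
  have "((\<lambda>t. dval q t * dval n t) has_real_derivative
     - (dval q t * dval p t * dval n t) * dval n t + dval q t * dder 1 n t) (at t)"
    by (rule DERIV_cong[OF DERIV_mult[OF q_deriv[OF assms] has_derivative_dval[OF assms]]]) simp
  then have "(dder 1 height has_real_derivative
     - (dval q t * dval p t * dval n t) * dval n t + dval q t * dder 1 n t) (at t)"
    by (rule DERIV_cong_disk[OF _ assms 1])
  moreover have "(dder 1 height has_real_derivative dder 2 height t) (at t)"
    using has_derivative_dder[OF assms, of 1 height] by (simp add: numeral_2_eq_2)
  ultimately show "dder 2 height t = - (dval q t * dval p t * dval n t) * dval n t + dval q t * dder 1 n t"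
    by (rule DERIV_unique[symmetric])
qed

lemma height_even:
  assumes "\<bar>z\<bar> < 1/2"
  shows "dval height (1 + z) = dval height (1 - z)"
proof -
  have pos: "dval height (1 + z) = dval height (1 - z)" if z: "0 \<le> z" "z < 1/2" for z
  proof -
    have "dval height (1 + z) - dval height (1 - z) = 0"
    proof (rule linear_ode_zero(1)[where u = "\<lambda>z. dval height (1 + z) - dval height (1 - z)" and v = "\<lambda>_. 0"
          and \<alpha> = "\<lambda>_. 0" and \<beta> = "\<lambda>_. 0" and \<gamma> = "\<lambda>_. 0" and \<delta> = "\<lambda>_. 0"])
      fix y assume y: "0 \<le> y" "y \<le> z"
      have 1: "((\<lambda>z. dval height (1 + z)) has_real_derivative dval q (1 + y) * dval n (1 + y)) (at y)"
        by (rule DERIV_chain2[where g = "\<lambda>z. 1 + z", THEN DERIV_cong, OF height_deriv])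
           (use y z in \<open>auto intro!: derivative_eq_intros\<close>)
      have 2: "((\<lambda>z. dval height (1 - z)) has_real_derivative - (dval q (1 - y) * dval n (1 - y))) (at y)"
        by (rule DERIV_chain2[where g = "\<lambda>z. 1 - z", THEN DERIV_cong, OF height_deriv])
           (use y z in \<open>auto intro!: derivative_eq_intros\<close>)
      show "((\<lambda>z. dval height (1 + z) - dval height (1 - z)) has_real_derivative
         0 * (dval height (1 + y) - dval height (1 - y)) + 0 * 0) (at y)"
        using DERIV_diff[OF 1 2] even(1)[of y] n_odd[of y] y z by simp
    qed (use z in auto)
    then show ?thesis by simp
  qed
  show ?thesis using pos[of z] pos[of "- z"] assms by (cases "0 \<le> z") auto
qed

text \<open>The candidate for the \<open>k\<close>-th derivative of the height with respect to
  \<open>z = 1 - t\<close>, mirrored for negative \<open>z\<close>. Keeping all orders in one family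
  is the form in which smooth functions of one variable are used later.\<close>

definition profile :: "nat \<Rightarrow> real \<Rightarrow> real" where
  "profile k z = (if 0 \<le> z then (- 1) ^ k * dder k height (1 - z) else dder k height (1 + z))"

text \<open>Evenness of the height makes the two formulas agree near \<open>z = 0\<close>, and
  differentiation preserves the agreement order by order. Overlapping intervals of validity then
  give smoothness across the equator; the bound 5/2 is where \<open>\<bar>1 - z\<bar>\<close>
  reaches 3/2.\<close>

lemma profile_eq:
  shows "- 1/2 < z \<Longrightarrow> z < 5/2 \<Longrightarrow> profile k z = (- 1) ^ k * dder k height (1 - z)"
    and "- 5/2 < z \<Longrightarrow> z < 1/2 \<Longrightarrow> profile k z = dder k height (1 + z)"
proof -
  have *: "(- 1) ^ k * dder k height (1 - z) = dder k height (1 + z)" if "\<bar>z\<bar> < 1/2" for z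
    using that
  proof (induction k arbitrary: z)
    case 0
    then show ?case by (simp add: dder_0 height_even)
  next
    case (Suc k)
    have 1: "((\<lambda>z. dder k height (1 + z)) has_real_derivative dder (Suc k) height (1 + z)) (at z)"
      by (rule DERIV_chain2[where g = "\<lambda>z. 1 + z", THEN DERIV_cong, OF has_derivative_dder])
         (use Suc.prems in \<open>auto intro!: derivative_eq_intros\<close>)
    have "((\<lambda>z. dder k height (1 - z)) has_real_derivative - dder (Suc k) height (1 - z)) (at z)"
      by (rule DERIV_chain2[where g = "\<lambda>z. 1 - z", THEN DERIV_cong, OF has_derivative_dder])
         (use Suc.prems in \<open>auto intro!: derivative_eq_intros\<close>)
    from DERIV_cmult[OF this, of "(- 1) ^ k"]
    have "((\<lambda>z. dder k height (1 + z)) has_real_derivative (- 1) ^ k * - dder (Suc k) height (1 - z)) (at z)"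
      by (rule has_field_derivative_transform_within_open[of _ _ _ "{-1/2<..<1/2}"])
         (use Suc in auto)
    from DERIV_unique[OF this 1] show ?case by simp
  qed
  show "- 1/2 < z \<Longrightarrow> z < 5/2 \<Longrightarrow> profile k z = (- 1) ^ k * dder k height (1 - z)"
    using *[of z] by (auto simp: profile_def)
  show "- 5/2 < z \<Longrightarrow> z < 1/2 \<Longrightarrow> profile k z = dder k height (1 + z)"
    using *[of z] by (auto simp: profile_def)
qed

lemma profile_deriv:
  assumes "\<bar>z\<bar> < 5/2"
  shows "(profile k has_real_derivative profile (Suc k) z) (at z)"
proof (cases "0 \<le> z")
  case True
  then have "\<bar>1 - z\<bar> < 3/2" using assms by linarith
  then have "((\<lambda>z. dder k height (1 - z)) has_real_derivative - dder (Suc k) height (1 - z)) (at z)"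
    by (rule DERIV_chain2[where g = "\<lambda>z. 1 - z", THEN DERIV_cong, OF has_derivative_dder])
       (auto intro!: derivative_eq_intros)
  from DERIV_cmult[OF this, of "(- 1) ^ k"]
  have "(profile k has_real_derivative (- 1) ^ k * - dder (Suc k) height (1 - z)) (at z)"
    by (rule has_field_derivative_transform_within_open[of _ _ _ "{-1/2<..<5/2}"])
       (use True assms profile_eq(1) in auto)
  then show ?thesis using True by (simp add: profile_def)
next
  case False
  then have "\<bar>1 + z\<bar> < 3/2" using assms by linarith
  then have "((\<lambda>z. dder k height (1 + z)) has_real_derivative dder (Suc k) height (1 + z)) (at z)"
    by (rule DERIV_chain2[where g = "\<lambda>z. 1 + z", THEN DERIV_cong, OF has_derivative_dder])
       (auto intro!: derivative_eq_intros)
  then have "(profile k has_real_derivative dder (Suc k) height (1 + z)) (at z)"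
    by (rule has_field_derivative_transform_within_open[of _ _ _ "{-5/2<..<1/2}"])
       (use False assms profile_eq(2) in auto)
  then show ?thesis using False by (simp add: profile_def)
qed

end

text \<open>The mean curvature of a rotationally symmetric graph \<open>s = f(z)\<close> over the sphere, where \<open>z\<close> is
  the third coordinate, \<open>f'\<close> and \<open>f''\<close> are the derivatives of \<open>f\<close>, and \<open>r\<close> and \<open>r'\<close> are the values of
  the warping function and of its derivative.\<close>

definition graph_curvature :: "real \<Rightarrow> real \<Rightarrow> real \<Rightarrow> real \<Rightarrow> real \<Rightarrow> real" where
  "graph_curvature r r' f' f'' z = (let R = r\<^sup>2 + f'\<^sup>2 * (1 - z\<^sup>2) in
     \<bar>r\<bar> / sqrt R * ((f'' * (1 - z\<^sup>2) - f' * z - 2 * r' * f'\<^sup>2 * (1 - z\<^sup>2) / r - r * r') / R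
       + (- f' * z - r * r') / r\<^sup>2))"

text \<open>The parameter \<open>w\<close> stands for \<open>\<bar>z\<bar>\<close>, so both
  hemispheres are covered without fixing the sign of \<open>f'\<close>. The normalization of
  \<open>x\<close> turns \<open>R\<close> into \<open>(q / x)\<^sup>2\<close>, so the leading factor
  is just \<open>x\<close>.\<close>

lemma graph_curvature_eq:
  fixes q x n n' l p z f' f'' w :: real
  assumes "0 < q" "0 < x" "x\<^sup>2 * (1 + (1 - z\<^sup>2) * n\<^sup>2) = 1"
    and f': "f' * z = - (q * n * w)" "f'\<^sup>2 = q\<^sup>2 * n\<^sup>2"
    and f'': "f'' = - (q * p * n) * n + q * n'"
    and ode: "x * (w * n + (1 - z\<^sup>2) * x\<^sup>2 * n' + w * n * x\<^sup>2) = l * q - 2 * p * x"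
  shows "graph_curvature (- q) p f' f'' z = l"
proof -
  define \<tau> where "\<tau> = 1 - z\<^sup>2"
  have tn: "1 + \<tau> * n\<^sup>2 = 1 / x\<^sup>2" using assms(2,3) by (simp add: \<tau>_def field_simps)
  have "(- q)\<^sup>2 + f'\<^sup>2 * \<tau> = q\<^sup>2 * (1 + \<tau> * n\<^sup>2)" by (simp add: f' algebra_simps)
  then have R: "(- q)\<^sup>2 + f'\<^sup>2 * \<tau> = (q / x)\<^sup>2" by (simp add: tn power_divide)
  have sq: "sqrt ((q / x)\<^sup>2) = q / x" using assms by simp
  have mf: "- f' * z = q * n * w" using f'(1) by simp
  have "graph_curvature (- q) p f' f'' z = \<bar>- q\<bar> / (q / x) *
     ((f'' * \<tau> - f' * z - 2 * p * f'\<^sup>2 * \<tau> / (- q) - (- q) * p) / (q / x)\<^sup>2 + (- f' * z - (- q) * p) / (- q)\<^sup>2)"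
    unfolding graph_curvature_def Let_def \<tau>_def[symmetric] R sq ..
  also have "\<dots> = q / (q / x) *
     ((f'' * \<tau> + q * n * w + 2 * p * (q\<^sup>2 * n\<^sup>2) * \<tau> / q + q * p) / (q / x)\<^sup>2 + (q * n * w + q * p) / q\<^sup>2)"
    using assms(1) unfolding mf f' by simp
  also have "\<dots> = x * ((f'' * \<tau> + q * n * w + 2 * p * q * n\<^sup>2 * \<tau> + q * p) * x\<^sup>2 + (q * n * w + q * p)) / q\<^sup>2"
    using assms(1,2) by (simp add: field_simps power2_eq_square)
  also have "f'' * \<tau> + q * n * w + 2 * p * q * n\<^sup>2 * \<tau> + q * p = q * (n' * \<tau> + n * w + p * (1 + \<tau> * n\<^sup>2))"
    unfolding f'' by (simp add: algebra_simps power2_eq_square)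
  also have "\<dots> * x\<^sup>2 = q * (x\<^sup>2 * (n' * \<tau> + n * w) + p)"
    using assms(2) unfolding tn by (simp add: field_simps)
  also have "x * (q * (x\<^sup>2 * (n' * \<tau> + n * w) + p) + (q * n * w + q * p)) / q\<^sup>2
     = (x * (w * n + \<tau> * x\<^sup>2 * n' + w * n * x\<^sup>2) + 2 * p * x) / q"
    using assms(1) by (simp add: field_simps power2_eq_square)
  also have "\<dots> = l" using assms(1) ode by (simp add: \<tau>_def)
  finally show ?thesis .
qed

context profile
begin

lemma profile_curvature:
  assumes "\<bar>z\<bar> \<le> 1"
  shows "graph_curvature (- dval q (1 - \<bar>z\<bar>)) (dval p (1 - \<bar>z\<bar>)) (profile 1 z) (profile 2 z) z = l"
proof -
  define t where "t = 1 - \<bar>z\<bar>"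
  have t: "\<bar>t\<bar> < 3/2" "\<bar>t\<bar> \<le> 3/2" using assms by (auto simp: t_def)
  have tau: "1 - z\<^sup>2 = tau t" by (simp add: t_def algebra_simps power2_eq_square abs_if)
  have p1: "profile 1 z = (if 0 \<le> z then - (dval q t * dval n t) else dval q t * dval n t)"
    using dder_height(1)[OF t(1)] by (auto simp: profile_def t_def)
  have p2: "profile 2 z = - (dval q t * dval p t * dval n t) * dval n t + dval q t * dder 1 n t"
    using dder_height(2)[OF t(1)] by (auto simp: profile_def t_def)
  show ?thesis
    unfolding t_def[symmetric]
  proof (rule graph_curvature_eq[where w = "1 - t"])
    show "(dval x t)\<^sup>2 * (1 + (1 - z\<^sup>2) * (dval n t)\<^sup>2) = 1" using x_square[OF t(2)] by (simp add: tau)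
    show "dval x t * ((1 - t) * dval n t + (1 - z\<^sup>2) * (dval x t)\<^sup>2 * dder 1 n t
       + (1 - t) * dval n t * (dval x t)\<^sup>2) = l * dval q t - 2 * dval p t * dval x t"
      using cmc_ode[OF t(1)] by (simp add: tau)
    show "profile 1 z * z = - (dval q t * dval n t * (1 - t))" unfolding p1 by (auto simp: t_def)
    show "(profile 1 z)\<^sup>2 = (dval q t)\<^sup>2 * (dval n t)\<^sup>2" unfolding p1 by (auto simp: power_mult_distrib)
  qed (use pos t p2 in auto)
qed

end

section \<open>Arc length and the warping function\<close>

locale desitter =
  fixes K E :: real
  assumes K: "0 < K" and E: "E < 0"
begin

lemma psi_sq_diff: "a < 0 \<Longrightarrow> b < 0 \<Longrightarrow>
  psi_sq K E b - psi_sq K E a = (b - a) * (2 * K / (a * b) + E * (a + b))"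
  by (simp add: psi_sq_def field_simps power2_eq_square)

lemma psi_sq_mono:
  assumes "a < b" "b < 0"
  shows "psi_sq K E a < psi_sq K E b"
proof -
  have "0 < a * b" using assms by (intro mult_neg_neg) auto
  then have "0 < 2 * K / (a * b)" using K by simp
  moreover have "0 < E * (a + b)" using assms E by (intro mult_neg_neg) auto
  ultimately have "0 < (b - a) * (2 * K / (a * b) + E * (a + b))"
    using assms by (intro mult_pos_pos) auto
  then show ?thesis using psi_sq_diff[of a b] assms by simp
qed

lemma continuous_psi_sq: "S \<subseteq> {..<0} \<Longrightarrow> continuous_on S (psi_sq K E)"
  unfolding psi_sq_def [abs_def] by (intro continuous_intros) auto

lemma psi_sq_zero: "\<exists>r<0. psi_sq K E r = 0"
proof -
  \<comment> \<open>At \<open>- M\<close> the term \<open>E M\<^sup>2\<close> outweighs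
    \<open>1 + 2 K\<close>; at \<open>- m\<close> it is at least \<open>-1\<close>. These give the
    two signs for the intermediate value theorem.\<close>
  define M where "M = 1 + (1 + 2 * K) / (- E)"
  define m where "m = min 1 (1 / (- E))"
  have M: "1 \<le> M" "M * (- E) = - E + (1 + 2 * K)" using K E by (simp_all add: M_def field_simps)
  have m: "0 < m" "m \<le> 1" "m * (- E) \<le> 1" using E by (auto simp: m_def min_def field_simps)
  have "psi_sq K E (- M) = 1 + 2 * K / M - M * (M * (- E))"
    by (simp add: psi_sq_neg power2_eq_square)
  also have "\<dots> \<le> 1 + 2 * K - 1 * (M * (- E))"
  proof (intro diff_mono add_mono mult_right_mono order_refl)
    show "2 * K / M \<le> 2 * K" using M K by (simp add: pos_divide_le_eq)
    show "0 \<le> M * - E" using M E by (intro mult_nonneg_nonneg) auto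
  qed (use M in auto)
  also have "\<dots> < 0" using M E by simp
  finally have 1: "psi_sq K E (- M) \<le> 0" by simp
  have "0 \<le> m * (- E)" using m E by (intro mult_nonneg_nonneg) auto
  then have "m * (m * (- E)) \<le> 1 * 1" using m by (intro mult_mono) auto
  moreover have "0 \<le> 2 * K / m" using m K by simp
  ultimately have 2: "0 \<le> psi_sq K E (- m)"
    unfolding psi_sq_neg power2_eq_square by (simp add: mult_ac)
  have "\<exists>x\<ge>- M. x \<le> - m \<and> psi_sq K E x = 0"
    by (rule IVT'[of "psi_sq K E" "- M" 0 "- m", OF 1 2]) (use M m in \<open>auto intro!: continuous_psi_sq\<close>)
  then show ?thesis using m by force
qed

lemma rhat: "rhat K E < 0" "psi_sq K E (rhat K E) = 0"
proof -
  obtain r where r: "r < 0" "psi_sq K E r = 0" using psi_sq_zero by blast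
  have "rhat K E = r"
    unfolding rhat_def
  proof (rule the_equality)
    show "r < 0 \<and> psi K E r = 0 \<and> (\<forall>t\<in>{r<..<0}. 0 \<le> psi_sq K E t) \<and>
      (\<forall>a<r. \<exists>t\<in>{a<..<r}. psi_sq K E t < 0)"
    proof (intro conjI allI impI ballI)
      fix t assume "t \<in> {r<..<0}"
      then show "0 \<le> psi_sq K E t" using psi_sq_mono[of r t] r by simp
    next
      fix a assume "a < r"
      then have "(a + r) / 2 \<in> {a<..<r}" "psi_sq K E ((a + r) / 2) < 0"
        using psi_sq_mono[of "(a + r) / 2" r] r by auto
      then show "\<exists>t\<in>{a<..<r}. psi_sq K E t < 0" by blast
    qed (use r in \<open>auto simp: psi_def\<close>)
    fix r' assume "r' < 0 \<and> psi K E r' = 0 \<and> (\<forall>t\<in>{r'<..<0}. 0 \<le> psi_sq K E t) \<and>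
      (\<forall>a<r'. \<exists>t\<in>{a<..<r'}. psi_sq K E t < 0)"
    then have "r' < 0" "psi_sq K E r' = 0" by (auto simp: psi_def)
    then show "r' = r" using psi_sq_mono[of r r'] psi_sq_mono[of r' r] r by (cases r r' rule: linorder_cases) auto
  qed
  with r show "rhat K E < 0" "psi_sq K E (rhat K E) = 0" by auto
qed

lemma psi_sq_pos: "rhat K E < t \<Longrightarrow> t < 0 \<Longrightarrow> 0 < psi_sq K E t"
  using psi_sq_mono[of "rhat K E" t] rhat by simp

lemma psi_pos: "rhat K E < t \<Longrightarrow> t < 0 \<Longrightarrow> 0 < psi K E t"
  using psi_sq_pos by (simp add: psi_def)

lemma continuous_inverse_psi: "S \<subseteq> {rhat K E<..<0} \<Longrightarrow> continuous_on S (\<lambda>t. 1 / psi K E t)"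
  unfolding psi_def
  by (intro continuous_intros continuous_psi_sq) (use psi_sq_pos in \<open>fastforce+\<close>)

text \<open>The radicand vanishes only to first order at \<open>rhat\<close>: its secant slopes from
  there are at least \<open>2 * K / r\<^sup>2\<close>. The integrand is therefore dominated by a
  multiple of \<open>(t - r) powr (- 1/2)\<close>.\<close>

lemma integrable_inverse_psi: "(\<lambda>t. 1 / psi K E t) integrable_on {rhat K E..0}"
proof -
  define r where "r = rhat K E"
  define c where "c = 2 * K / r\<^sup>2"
  have r: "r < 0" "psi_sq K E r = 0" using rhat by (simp_all add: r_def)
  have c: "0 < c" using K r by (simp add: c_def)
  have lower: "c * (t - r) \<le> psi_sq K E t" if "r < t" "t < 0" for t
  proof -
    have "0 < r * t" using that r by (intro mult_neg_neg) auto
    then have "0 < r\<^sup>2 * (r * t)" using r by (intro mult_pos_pos[of "r\<^sup>2"]) auto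
    moreover have "r * t \<le> r\<^sup>2"
      unfolding power2_eq_square using that r by (intro mult_left_mono_neg) auto
    ultimately have "2 * K / r\<^sup>2 \<le> 2 * K / (r * t)"
      using K by (intro divide_left_mono) auto
    moreover have "0 < E * (r + t)" using E that r by (intro mult_neg_neg) auto
    ultimately have "(t - r) * c \<le> (t - r) * (2 * K / (r * t) + E * (r + t))"
      using that by (intro mult_left_mono) (auto simp: c_def)
    then show ?thesis using psi_sq_diff[of r t] that r by (simp add: mult.commute)
  qed
  \<comment> \<open>The summand 1 covers the endpoints, where division by zero yields the value 0 of
    the integrand at \<open>rhat\<close> and the value 1 at 0.\<close>
  define g where "g t = 1 / (sqrt c * sqrt (t - r)) + 1" for t
  have "((\<lambda>t. 1 / (sqrt c * sqrt (t - r))) has_integral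
     (2 / sqrt c * sqrt (0 - r) - 2 / sqrt c * sqrt (r - r))) {r..0}"
  proof (rule fundamental_theorem_of_calculus_interior)
    show "continuous_on {r..0} (\<lambda>t. 2 / sqrt c * sqrt (t - r))" by (intro continuous_intros)
    fix t assume t: "t \<in> {r<..<0}"
    show "((\<lambda>t. 2 / sqrt c * sqrt (t - r)) has_vector_derivative 1 / (sqrt c * sqrt (t - r))) (at t)"
      unfolding has_real_derivative_iff_has_vector_derivative[symmetric]
      using t c by (auto intro!: derivative_eq_intros simp: field_simps)
  qed (use r in auto)
  then have g: "g integrable_on {r..0}"
    unfolding g_def [abs_def] by (intro integrable_add) auto
  show ?thesis
    unfolding r_def[symmetric]
  proof (rule measurable_bounded_by_integrable_imp_integrable[OF _ g])
    show "(\<lambda>t. 1 / psi K E t) \<in> borel_measurable (lebesgue_on {r..0})"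
    proof (intro measurable_restrict_space1 measurable_completion)
      have "(\<lambda>t. 1 / psi K E t) \<in> borel_measurable borel"
        unfolding psi_def psi_sq_def by measurable
      then show "(\<lambda>t. 1 / psi K E t) \<in> borel_measurable lborel" by simp
    qed
    fix t assume t: "t \<in> {r..0}"
    show "norm (1 / psi K E t) \<le> g t"
    proof (cases "r < t \<and> t < 0")
      case True
      then have "sqrt (c * (t - r)) \<le> psi K E t" using lower[of t] by (simp add: psi_def)
      moreover have "0 < sqrt (c * (t - r))" using True c by simp
      ultimately have "0 < psi K E t" "1 / psi K E t \<le> 1 / sqrt (c * (t - r))"
        by (linarith, intro divide_left_mono mult_pos_pos) linarith+
      then show ?thesis by (simp add: g_def real_sqrt_mult)
    next
      case False
      then have "t = r \<or> t = 0" using t by auto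
      then have "\<bar>1 / psi K E t\<bar> \<le> 1" using r by (auto simp: psi_def psi_sq_def)
      also have "\<dots> \<le> g t" using t c by (simp add: g_def)
      finally show ?thesis by simp
    qed
  qed auto
qed

lemma integrable_inverse_psi_sub: "rhat K E \<le> a \<Longrightarrow> b \<le> 0 \<Longrightarrow> (\<lambda>t. 1 / psi K E t) integrable_on {a..b}"
  by (rule integrable_on_subinterval[OF integrable_inverse_psi]) auto

lemma arclength_diff:
  assumes "rhat K E \<le> a" "a \<le> b" "b \<le> 0"
  shows "arclength K E b = arclength K E a + integral {a..b} (\<lambda>t. 1 / psi K E t)"
  using Henstock_Kurzweil_Integration.integral_combine[OF assms(2,3) integrable_inverse_psi_sub[OF assms(1) order_refl]]
  by (simp add: arclength_def)

lemma arclength_deriv: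
  assumes "rhat K E < r" "r < 0"
  shows "(arclength K E has_real_derivative 1 / psi K E r) (at r)"
proof -
  define a b where "a = (rhat K E + r) / 2" and "b = r / 2"
  have ab: "rhat K E < a" "a < r" "r < b" "b < 0" using assms by (auto simp: a_def b_def)
  have "((\<lambda>x. integral {a..x} (\<lambda>t. 1 / psi K E t)) has_real_derivative 1 / psi K E r) (at r within {a..b})"
    using ab by (intro integral_has_real_derivative continuous_inverse_psi) auto
  then have "((\<lambda>x. integral {a..x} (\<lambda>t. 1 / psi K E t)) has_real_derivative 1 / psi K E r) (at r)"
    using ab by (subst (asm) at_within_interior) auto
  then have "((\<lambda>x. arclength K E a + integral {a..x} (\<lambda>t. 1 / psi K E t)) has_real_derivative 1 / psi K E r) (at r)"
    by (auto intro!: derivative_eq_intros)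
  then show ?thesis
    by (rule has_field_derivative_transform_within_open[of _ _ _ "{a<..<b}"])
       (use ab in \<open>auto intro!: arclength_diff[symmetric]\<close>)
qed

lemma arclength_strict_mono:
  assumes "rhat K E \<le> a" "a < b" "b < 0"
  shows "arclength K E a < arclength K E b"
proof -
  \<comment> \<open>The left end may be \<open>rhat\<close>, where the derivative is singular, so
    strictness is taken from the right half of the interval.\<close>
  define m where "m = (a + b) / 2"
  have m: "rhat K E < m" "a < m" "m < b" using assms by (auto simp: m_def)
  have "0 \<le> integral {a..m} (\<lambda>t. 1 / psi K E t)"
  proof (rule integral_nonneg[OF integrable_inverse_psi_sub])
    fix t assume "t \<in> {a..m}"
    then have "0 \<le> psi_sq K E t" using rhat psi_sq_pos[of t] assms m by (cases "t = rhat K E") auto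
    then show "0 \<le> 1 / psi K E t" by (simp add: psi_def)
  qed (use assms m in auto)
  then have "arclength K E a \<le> arclength K E m"
    using arclength_diff[of a m] assms m by simp
  also have "\<dots> < arclength K E b"
  proof (rule DERIV_pos_imp_increasing[OF m(3)])
    fix x assume "m \<le> x" "x \<le> b"
    then show "\<exists>y. (arclength K E has_real_derivative y) (at x) \<and> 0 < y"
      using arclength_deriv[of x] psi_pos[of x] m assms by auto
  qed
  finally show ?thesis .
qed

lemma arclength_range:
  assumes "rhat K E < r" "r < 0"
  shows "shat K E < arclength K E r" "arclength K E r < 0"
proof -
  show "shat K E < arclength K E r"
    unfolding shat_def using assms by (intro arclength_strict_mono) auto
  have "arclength K E r < arclength K E (r / 2)" using assms by (intro arclength_strict_mono) auto
  also have "\<dots> \<le> 0"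
  proof -
    have "0 \<le> integral {r / 2..0} (\<lambda>t. 1 / psi K E t)"
    proof (rule integral_nonneg[OF integrable_inverse_psi_sub])
      fix t assume t: "t \<in> {r / 2..0}"
      have "psi_sq K E 0 = 1" by (simp add: psi_sq_def)
      then have "0 \<le> psi_sq K E t" using psi_sq_pos[of t] assms t by (cases "t = 0") auto
      then show "0 \<le> 1 / psi K E t" by (simp add: psi_def)
    qed (use assms in auto)
    then show ?thesis by (simp add: arclength_def)
  qed
  finally show "arclength K E r < 0" .
qed

lemma inj_on_arclength: "inj_on (arclength K E) {rhat K E..<0}"
  using arclength_strict_mono by (intro linorder_inj_onI) force+

lemma radius_arclength: "rhat K E \<le> r \<Longrightarrow> r < 0 \<Longrightarrow> radius K E (arclength K E r) = r"
  unfolding radius_def by (rule the_inv_into_f_f[OF inj_on_arclength]) auto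

lemma radius_deriv:
  assumes "rhat K E < r" "r < 0"
  shows "(radius K E has_real_derivative psi K E r) (at (arclength K E r))"
proof -
  have p: "psi K E r \<noteq> 0" using psi_pos[OF assms] by simp
  have "(radius K E has_derivative (*) (psi K E r)) (at (arclength K E r))"
  proof (rule has_derivative_inverse_strong[where S = "{rhat K E<..<0}" and f = "arclength K E" and x = r])
    show "continuous_on {rhat K E<..<0} (arclength K E)"
      by (intro DERIV_continuous_on[where D = "\<lambda>r. 1 / psi K E r"])
         (auto intro: has_field_derivative_at_within arclength_deriv)
    show "(arclength K E has_derivative (*) (1 / psi K E r)) (at r)"
      using arclength_deriv[OF assms] by (simp add: has_field_derivative_def)
    show "(*) (1 / psi K E r) \<circ> (*) (psi K E r) = id" using p by (auto simp: fun_eq_iff)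
  qed (use assms radius_arclength in auto)
  then show ?thesis by (simp add: has_field_derivative_def)
qed

lemma slice_curvature_arclength:
  assumes "rhat K E < r" "r < 0"
  shows "slice_curvature K E (arclength K E r) = - 2 * psi K E r / r"
  using DERIV_imp_deriv[OF radius_deriv[OF assms]] radius_arclength assms
  by (simp add: slice_curvature_def)

end

locale desitter_profile = desitter K E + profile K E l a q p x n for K E l a q p x n +
  assumes range: "\<And>t. 0 \<le> t \<Longrightarrow> t \<le> 1 \<Longrightarrow> dval q t < - rhat K E"
begin

text \<open>Both sides start at the same value and have derivative \<open>q n\<close>: on the right,
  \<open>dr/dt = q p n\<close>, and the factor \<open>p\<close> cancels against
  \<open>ds = dr / psi\<close>.\<close>

lemma height_arclength:
  assumes "0 \<le> t" "t \<le> 1"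
  shows "dval height t = arclength K E (- dval q t)"
proof -
  have "dval height t - arclength K E (- dval q t) = 0"
  proof (rule linear_ode_zero(1)[where u = "\<lambda>t. dval height t - arclength K E (- dval q t)" and v = "\<lambda>_. 0"
        and \<alpha> = "\<lambda>_. 0" and \<beta> = "\<lambda>_. 0" and \<gamma> = "\<lambda>_. 0" and \<delta> = "\<lambda>_. 0"])
    fix y assume "0 \<le> y" "y \<le> t"
    then have y: "0 \<le> y" "y \<le> 1" "\<bar>y\<bar> < 3/2" "\<bar>y\<bar> \<le> 3/2" using assms by auto
    have r: "rhat K E < - dval q y" "- dval q y < 0" using range[OF y(1,2)] pos(1)[OF y(4)] by auto
    have "((\<lambda>t. - dval q t) has_real_derivative dval q y * dval p y * dval n y) (at y)"
      using q_deriv[OF y(3)] by (auto intro!: derivative_eq_intros)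
    from DERIV_chain2[OF arclength_deriv[OF r] this]
    have "((\<lambda>t. arclength K E (- dval q t)) has_real_derivative dval q y * dval n y) (at y)"
      using pos(2)[OF y(4)] by (simp add: p_psi[OF y(4)])
    from DERIV_diff[OF height_deriv[OF y(3)] this]
    show "((\<lambda>t. dval height t - arclength K E (- dval q t)) has_real_derivative
       0 * (dval height y - arclength K E (- dval q y)) + 0 * 0) (at y)" by simp
  next
    show "dval height 0 - arclength K E (- dval q 0) = 0"
      by (simp add: height_def dval_add dint_def dval_mult q_0)
  qed (use assms in auto)
  then show ?thesis by simp
qed

lemma profile_0:
  assumes "\<bar>z\<bar> \<le> 1"
  shows "profile 0 z = arclength K E (- dval q (1 - \<bar>z\<bar>))"
    "rhat K E < - dval q (1 - \<bar>z\<bar>)" "- dval q (1 - \<bar>z\<bar>) < 0"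
proof -
  have t: "0 \<le> 1 - \<bar>z\<bar>" "1 - \<bar>z\<bar> \<le> 1" "\<bar>1 - \<bar>z\<bar>\<bar> \<le> 3/2" using assms by auto
  show "profile 0 z = arclength K E (- dval q (1 - \<bar>z\<bar>))"
    using height_arclength[OF t(1,2)] by (auto simp: profile_def dder_0)
  show "rhat K E < - dval q (1 - \<bar>z\<bar>)" "- dval q (1 - \<bar>z\<bar>) < 0"
    using range[OF t(1,2)] pos(1)[OF t(3)] by auto
qed

lemma profile_graph_curvature:
  assumes "\<bar>z\<bar> \<le> 1"
  shows "graph_curvature (radius K E (profile 0 z)) (psi K E (radius K E (profile 0 z)))
    (profile 1 z) (profile 2 z) z = l"
proof -
  have "\<bar>1 - \<bar>z\<bar>\<bar> \<le> 3/2" using assms by auto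
  then show ?thesis
    using profile_curvature[OF assms] profile_0[OF assms]
    by (simp add: radius_arclength p_psi)
qed

end

section \<open>Smooth functions\<close>

lemma Ck_on_cong:
  fixes f g :: "'a::euclidean_space \<Rightarrow> 'b::euclidean_space"
  assumes "open S" "\<And>x. x \<in> S \<Longrightarrow> f x = g x" "Ck_on k S f"
  shows "Ck_on k S g"
  using assms(2,3)
proof (induction k arbitrary: f g)
  case 0
  then show ?case by (simp cong: continuous_on_cong)
next
  case (Suc k)
  have d: "(g has_derivative frechet_derivative f (at x)) (at x)" if "x \<in> S" for x
    using Suc.prems that assms(1)
    by (auto intro: has_derivative_transform_within_open[of f _ _ UNIV] simp: frechet_derivative_works)
  then have "frechet_derivative f (at x) v = frechet_derivative g (at x) v" if "x \<in> S" for x v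
    using frechet_derivative_at[OF d[OF that]] by simp
  from Suc.IH[OF this] have "Ck_on k S (\<lambda>x. frechet_derivative g (at x) v)" for v
    using Suc.prems(2) by simp
  with d show ?case by (auto simp: differentiable_def)
qed

lemma Ck_on_SucI:
  assumes "open S" "\<And>x. x \<in> S \<Longrightarrow> (f has_derivative f' x) (at x)"
    and "\<And>v. Ck_on k S (\<lambda>x. f' x v)"
  shows "Ck_on (Suc k) S f"
proof -
  have "f' x v = frechet_derivative f (at x) v" if "x \<in> S" for x v
    using frechet_derivative_at[OF assms(2)[OF that]] by simp
  from Ck_on_cong[OF assms(1) this assms(3)] show ?thesis
    using assms(2) by (auto simp: differentiable_def)
qed

lemma Ck_on_SucD:
  assumes "Ck_on (Suc k) S f"
  shows "Ck_on k S f"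
  using assms
proof (induction k arbitrary: f)
  case 0
  then show ?case
    by (auto intro!: continuous_at_imp_continuous_on differentiable_imp_continuous_within)
qed simp

lemma Ck_on_has_derivative:
  "Ck_on (Suc k) S f \<Longrightarrow> x \<in> S \<Longrightarrow> (f has_derivative frechet_derivative f (at x)) (at x)"
  by (simp add: frechet_derivative_works)

lemma Ck_on_const: "open S \<Longrightarrow> Ck_on k S (\<lambda>x. c)"
proof (induction k arbitrary: c)
  case (Suc k)
  show ?case by (rule Ck_on_SucI[where f' = "\<lambda>_ _. 0"]) (use Suc in auto)
qed simp

lemma Ck_on_bounded_linear:
  assumes "open S" "bounded_linear L"
  shows "Ck_on k S L"
proof (cases k)
  case 0
  then show ?thesis using assms by (simp add: linear_continuous_on)
next
  case (Suc j)
  show ?thesis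
    unfolding Suc
    by (rule Ck_on_SucI[where f' = "\<lambda>_. L"])
       (use assms in \<open>auto intro!: bounded_linear_imp_has_derivative Ck_on_const\<close>)
qed

lemma Ck_on_add:
  assumes "open S" "Ck_on k S f" "Ck_on k S g"
  shows "Ck_on k S (\<lambda>x. f x + g x)"
  using assms(2,3)
proof (induction k arbitrary: f g)
  case (Suc k)
  show ?case
    by (rule Ck_on_SucI[OF assms(1) has_derivative_add[OF Ck_on_has_derivative Ck_on_has_derivative]])
       (use Suc in auto)
qed (auto intro: continuous_intros)

lemma Ck_on_bilinear:
  assumes "open S" "bounded_bilinear b" "Ck_on k S f" "Ck_on k S g"
  shows "Ck_on k S (\<lambda>x. b (f x) (g x))"
  using assms(3,4)
proof (induction k arbitrary: f g)
  case 0
  then show ?case by (auto intro: bounded_bilinear.continuous_on[OF assms(2)])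
next
  case (Suc k)
  show ?case
  proof (rule Ck_on_SucI[OF assms(1)
        bounded_bilinear.FDERIV[OF assms(2) Ck_on_has_derivative Ck_on_has_derivative]])
    fix v
    show "Ck_on k S (\<lambda>x. b (f x) (frechet_derivative g (at x) v) + b (frechet_derivative f (at x) v) (g x))"
      using Suc.prems Ck_on_SucD[OF Suc.prems(1)] Ck_on_SucD[OF Suc.prems(2)]
      by (intro Ck_on_add assms(1) Suc.IH) auto
  qed (use Suc.prems in auto)
qed

text \<open>The outer function comes with its whole sequence of derivatives, so the induction on
  \<open>k\<close> can shift \<open>j\<close>.\<close>

lemma Ck_on_compose_real:
  fixes \<phi> :: "nat \<Rightarrow> real \<Rightarrow> real"
  assumes "open S" "\<And>j y. y \<in> T \<Longrightarrow> (\<phi> j has_real_derivative \<phi> (Suc j) y) (at y)"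
    and "f ` S \<subseteq> T" "Ck_on k S f"
  shows "Ck_on k S (\<lambda>x. \<phi> j (f x))"
  using assms(4)
proof (induction k arbitrary: j)
  case 0
  have "continuous_on T (\<phi> j)"
    using assms(2) by (intro DERIV_continuous_on[where D = "\<phi> (Suc j)"]) (auto intro: has_field_derivative_at_within)
  then show ?case using 0 assms(3) by (auto intro: continuous_on_compose2)
next
  case (Suc k)
  show ?case
  proof (rule Ck_on_SucI[OF assms(1)])
    fix x assume x: "x \<in> S"
    then have "(\<phi> j has_derivative (*) (\<phi> (Suc j) (f x))) (at (f x))"
      using assms(2)[of "f x" j] assms(3) by (auto simp: has_field_derivative_def)
    from has_derivative_compose[OF Ck_on_has_derivative[OF Suc.prems x] this]
    show "((\<lambda>x. \<phi> j (f x)) has_derivative (\<lambda>v. \<phi> (Suc j) (f x) * frechet_derivative f (at x) v)) (at x)" .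
  next
    show "Ck_on k S (\<lambda>x. \<phi> (Suc j) (f x) * frechet_derivative f (at x) v)" for v
      using Suc.prems Suc.IH[OF Ck_on_SucD[OF Suc.prems]]
      by (intro Ck_on_bilinear[OF assms(1) bounded_bilinear_mult]) auto
  qed
qed

lemma Ck_on_compose_affine:
  assumes "open S" "open T" "bounded_linear L" "\<And>x. x \<in> T \<Longrightarrow> c + L x \<in> S" "Ck_on k S f"
  shows "Ck_on k T (\<lambda>x. f (c + L x))"
  using assms(5)
proof (induction k arbitrary: f)
  case 0
  have "continuous_on T (\<lambda>x. c + L x)"
    using assms(3) by (intro continuous_intros linear_continuous_on)
  then show ?case using 0 assms(4) by (auto intro: continuous_on_compose2)
next
  case (Suc k)
  show ?case
  proof (rule Ck_on_SucI[OF assms(2)])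
    fix x assume x: "x \<in> T"
    have "((\<lambda>x. c + L x) has_derivative L) (at x)"
      using bounded_linear_imp_has_derivative[OF assms(3)] by (auto intro!: derivative_eq_intros)
    from has_derivative_compose[OF this Ck_on_has_derivative[OF Suc.prems assms(4)[OF x]]]
    show "((\<lambda>x. f (c + L x)) has_derivative (\<lambda>v. frechet_derivative f (at (c + L x)) (L v))) (at x)" .
  next
    show "Ck_on k T (\<lambda>x. frechet_derivative f (at (c + L x)) (L v))" for v
      using Suc.prems by (intro Suc.IH) auto
  qed
qed

lemma Ck_on_Pair:
  assumes "open S" "Ck_on k S f" "Ck_on k S g"
  shows "Ck_on k S (\<lambda>x. (f x, g x))"
proof -
  have "Ck_on k S (\<lambda>x. (f x, 0) + (0, g x))"
  proof (intro Ck_on_add assms(1))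
    have 1: "bounded_linear (\<lambda>x. (x, 0))" and 2: "bounded_linear (\<lambda>x. (0, x))"
      by (auto intro!: bounded_linear_Pair bounded_linear_ident bounded_linear_zero)
    have *: "Ck_on k S (\<lambda>x. L (h x))" if "bounded_linear L" "Ck_on k S h"
      for L :: "'x::euclidean_space \<Rightarrow> 'y::euclidean_space" and h
      using that(2)
    proof (induction k arbitrary: h)
      case 0
      then show ?case by (auto intro: bounded_linear.continuous_on[OF that(1)])
    next
      case (Suc k)
      show ?case
        by (rule Ck_on_SucI[OF assms(1) bounded_linear.has_derivative[OF that(1) Ck_on_has_derivative]])
           (use Suc in auto)
    qed
    show "Ck_on k S (\<lambda>x. (f x, 0))" "Ck_on k S (\<lambda>x. (0, g x))"
      using *[OF 1 assms(2)] *[OF 2 assms(3)] by auto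
  qed
  then show ?thesis by simp
qed

lemma Ck_on_sgn: "Ck_on k (- {0::'a::euclidean_space}) sgn"
proof -
  \<comment> \<open>These are the factors produced by differentiating \<open>s powr (- 1/2)\<close>
    repeatedly; at \<open>s = y \<bullet> y\<close> the power is the inverse norm.\<close>
  define c where "c j = (\<Prod>i<j. - 1 / 2 - real i)" for j
  define \<phi> where "\<phi> j = (\<lambda>s. c j * s powr (- 1 / 2 - real j))" for j
  have o: "open (- {0::'a})" by auto
  have \<phi>: "(\<phi> j has_real_derivative \<phi> (Suc j) s) (at s)" if "s \<in> {0<..}" for j s
    unfolding \<phi>_def using that
    by (auto intro!: derivative_eq_intros simp: c_def algebra_simps)
  have C: "Ck_on k (- {0}) (\<lambda>y::'a. \<phi> 0 (y \<bullet> y) *\<^sub>R y)"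
    by (intro Ck_on_bilinear[OF o bounded_bilinear_scaleR] Ck_on_compose_real[where \<phi> = \<phi> and T = "{0<..}" and j = 0, OF o \<phi>]
        Ck_on_bilinear[OF o bounded_bilinear_inner] Ck_on_bounded_linear[OF o] bounded_linear_ident) auto
  have eq: "\<phi> 0 (y \<bullet> y) *\<^sub>R y = sgn y" if "y \<in> - {0}" for y :: 'a
  proof -
    have "(y \<bullet> y) powr (- 1 / 2) = inverse (norm y)"
      by (simp add: norm_eq_sqrt_inner powr_minus flip: powr_half_sqrt)
    then show ?thesis by (simp add: \<phi>_def c_def sgn_div_norm)
  qed
  show ?thesis by (rule Ck_on_cong[OF o eq C])
qed

section \<open>Derivatives of the radial projection\<close>

definition dsgn :: "'a::real_inner \<Rightarrow> 'a \<Rightarrow> 'a" where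
  "dsgn y v = inverse (norm y) *\<^sub>R v - (inverse (norm y) ^ 3 * (y \<bullet> v)) *\<^sub>R y"

text \<open>The second derivative of \<open>sgn\<close> at a unit vector.\<close>

definition d2sgn :: "'a::real_inner \<Rightarrow> 'a \<Rightarrow> 'a \<Rightarrow> 'a" where
  "d2sgn y a b = - (y \<bullet> a) *\<^sub>R b - (a \<bullet> b) *\<^sub>R y - (y \<bullet> b) *\<^sub>R a + (3 * (y \<bullet> a) * (y \<bullet> b)) *\<^sub>R y"

lemma has_derivative_inverse_norm:
  assumes "y \<noteq> 0"
  shows "((\<lambda>y. inverse (norm y)) has_derivative (\<lambda>v. - (inverse (norm y) ^ 3 * (y \<bullet> v)))) (at y)"
proof -
  have "((\<lambda>y. inverse (norm y)) has_derivative (\<lambda>v. - (inverse (norm y) * (v \<bullet> sgn y) * inverse (norm y)))) (at y)"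
    using assms by (intro Deriv.has_derivative_inverse has_derivative_norm) auto
  then show ?thesis
    by (simp add: sgn_div_norm inner_commute power3_eq_cube mult_ac)
qed

lemma has_derivative_sgn:
  assumes "y \<noteq> 0"
  shows "(sgn has_derivative dsgn y) (at y)"
proof -
  have "((\<lambda>y. inverse (norm y) *\<^sub>R y) has_derivative
     (\<lambda>v. inverse (norm y) *\<^sub>R v + (- (inverse (norm y) ^ 3 * (y \<bullet> v))) *\<^sub>R y)) (at y)"
    by (intro has_derivative_scaleR has_derivative_inverse_norm assms has_derivative_ident)
  moreover have "(\<lambda>y::'a. inverse (norm y) *\<^sub>R y) = sgn" by (simp add: sgn_div_norm fun_eq_iff)
  moreover have "(\<lambda>v. inverse (norm y) *\<^sub>R v + (- (inverse (norm y) ^ 3 * (y \<bullet> v))) *\<^sub>R y) = dsgn y"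
    by (simp add: dsgn_def fun_eq_iff)
  ultimately show ?thesis by simp
qed

lemma has_derivative_dsgn:
  assumes "norm y = 1"
  shows "((\<lambda>y. dsgn y b) has_derivative (\<lambda>a. d2sgn y a b)) (at y)"
proof -
  have y: "y \<noteq> 0" using assms by auto
  note d = has_derivative_inverse_norm[OF y]
  have d3: "((\<lambda>y. inverse (norm y) ^ 3) has_derivative (\<lambda>v. - 3 * (y \<bullet> v))) (at y)"
    by (rule has_derivative_eq_rhs[OF has_derivative_power[OF d]]) (simp add: assms fun_eq_iff)
  have "((\<lambda>y. dsgn y b) has_derivative
    (\<lambda>a. (- (inverse (norm y) ^ 3 * (y \<bullet> a))) *\<^sub>R b - ((inverse (norm y) ^ 3 * (y \<bullet> b)) *\<^sub>R a
      + (inverse (norm y) ^ 3 * (a \<bullet> b) + - 3 * (y \<bullet> a) * (y \<bullet> b)) *\<^sub>R y))) (at y)"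
    unfolding dsgn_def
    by (intro has_derivative_diff has_derivative_scaleR has_derivative_scaleR_left has_derivative_mult
        has_derivative_inner_left d d3 has_derivative_ident)
  moreover have "(\<lambda>a. (- (inverse (norm y) ^ 3 * (y \<bullet> a))) *\<^sub>R b - ((inverse (norm y) ^ 3 * (y \<bullet> b)) *\<^sub>R a
      + (inverse (norm y) ^ 3 * (a \<bullet> b) + - 3 * (y \<bullet> a) * (y \<bullet> b)) *\<^sub>R y)) = (\<lambda>a. d2sgn y a b)"
    by (simp add: d2sgn_def assms fun_eq_iff algebra_simps)
  ultimately show ?thesis by simp
qed

text \<open>Functions of one linear coordinate on the sphere, extended to be constant along rays.\<close>

locale zonal =
  fixes e :: "'a::euclidean_space" and f :: "nat \<Rightarrow> real \<Rightarrow> real"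
  assumes e: "norm e = 1"
    and f: "\<And>k z. \<bar>z\<bar> < 2 \<Longrightarrow> (f k has_real_derivative f (Suc k) z) (at z)"
begin

definition "ext y = f 0 (e \<bullet> sgn y)"

lemma abs_inner_sgn: "\<bar>e \<bullet> sgn y\<bar> \<le> 1"
  using Cauchy_Schwarz_ineq2[of e "sgn y"] e by (auto simp: norm_sgn split: if_splits)

lemma has_derivative_zonal:
  assumes "y \<noteq> 0"
  shows "((\<lambda>y. f k (e \<bullet> sgn y)) has_derivative (\<lambda>b. f (Suc k) (e \<bullet> sgn y) * (e \<bullet> dsgn y b))) (at y)"
proof -
  have "(f k has_derivative (*) (f (Suc k) (e \<bullet> sgn y))) (at (e \<bullet> sgn y))"
    using f[of "e \<bullet> sgn y" k] abs_inner_sgn[of y] by (auto simp: has_field_derivative_def)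
  from has_derivative_compose[OF has_derivative_inner_right[OF has_derivative_sgn[OF assms]] this]
  show ?thesis .
qed

lemma frechet_ext: "y \<noteq> 0 \<Longrightarrow> frechet_derivative ext (at y) = (\<lambda>b. f 1 (e \<bullet> sgn y) * (e \<bullet> dsgn y b))"
  using frechet_derivative_at[OF has_derivative_zonal[of y 0]] by (simp add: ext_def [abs_def])

definition "hess y a b = f 2 (e \<bullet> y) * (e \<bullet> dsgn y a) * (e \<bullet> dsgn y b) + f 1 (e \<bullet> y) * (e \<bullet> d2sgn y a b)"

lemma has_derivative_frechet_ext:
  assumes "norm y = 1"
  shows "((\<lambda>y. frechet_derivative ext (at y) b) has_derivative (\<lambda>a. hess y a b)) (at y)"
proof -
  have y: "y \<noteq> 0" "sgn y = y" using assms by (auto simp: sgn_div_norm)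
  have "((\<lambda>y. f 1 (e \<bullet> sgn y) * (e \<bullet> dsgn y b)) has_derivative
     (\<lambda>a. f 1 (e \<bullet> sgn y) * (e \<bullet> d2sgn y a b) + f (Suc 1) (e \<bullet> sgn y) * (e \<bullet> dsgn y a) * (e \<bullet> dsgn y b))) (at y)"
    by (intro has_derivative_mult has_derivative_zonal y has_derivative_inner_right has_derivative_dsgn assms)
  then have "((\<lambda>y. f 1 (e \<bullet> sgn y) * (e \<bullet> dsgn y b)) has_derivative (\<lambda>a. hess y a b)) (at y)"
    by (simp add: hess_def y numeral_2_eq_2 add.commute)
  then show ?thesis
    by (rule has_derivative_transform_within_open[of _ _ _ _ "- {0}"]) (use y in \<open>auto simp: frechet_ext\<close>)
qed

lemma Ck_on_ext: "Ck_on k (- {0}) ext"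
  unfolding ext_def [abs_def]
proof (rule Ck_on_compose_real[where T = "{-2<..<2}" and \<phi> = f and j = 0 and f = "\<lambda>y. e \<bullet> sgn y"])
  show "Ck_on k (- {0}) (\<lambda>y. e \<bullet> sgn y)"
    by (intro Ck_on_bilinear[OF _ bounded_bilinear_inner] Ck_on_const Ck_on_sgn) auto
  show "(\<lambda>y. e \<bullet> sgn y) ` (- {0}) \<subseteq> {-2<..<2}"
  proof (rule image_subsetI)
    show "e \<bullet> sgn y \<in> {-2<..<2}" for y using abs_inner_sgn[of y] by auto
  qed
qed (use f in \<open>auto simp: abs_less_iff\<close>)

end

section \<open>Gnomonic charts of graphs over the sphere\<close>

text \<open>Positively oriented orthonormal frames; \<open>gno n a b\<close> parametrizes the affine tangent plane at \<open>n\<close>.\<close>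

definition frame :: "real^3 \<Rightarrow> real^3 \<Rightarrow> real^3 \<Rightarrow> bool" where
  "frame n a b \<longleftrightarrow> norm n = 1 \<and> norm a = 1 \<and> n \<bullet> a = 0 \<and> b = cross3 n a"

definition gno0 :: "real^3 \<Rightarrow> real^3 \<Rightarrow> real^2 \<Rightarrow> real^3" where
  "gno0 a b h = (h $ 1) *\<^sub>R a + (h $ 2) *\<^sub>R b"

definition gno :: "real^3 \<Rightarrow> real^3 \<Rightarrow> real^3 \<Rightarrow> real^2 \<Rightarrow> real^3" where
  "gno n a b h = n + gno0 a b h"

lemma frame_simps:
  assumes "frame n a b"
  shows "n \<bullet> n = 1" "a \<bullet> a = 1" "b \<bullet> b = 1" "n \<bullet> a = 0" "a \<bullet> n = 0" "n \<bullet> b = 0" "b \<bullet> n = 0"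
    "a \<bullet> b = 0" "b \<bullet> a = 0" "cross3 a b = n"
proof -
  have f: "norm n = 1" "norm a = 1" "n \<bullet> a = 0" "b = cross3 n a" using assms by (auto simp: frame_def)
  show nn: "n \<bullet> n = 1" and aa: "a \<bullet> a = 1" using f by (simp_all flip: power2_norm_eq_inner)
  show "n \<bullet> a = 0" "a \<bullet> n = 0" using f by (simp_all add: inner_commute)
  show "n \<bullet> b = 0" "b \<bullet> n = 0" "a \<bullet> b = 0" "b \<bullet> a = 0"
    using f by (simp_all add: dot_cross_self)
  have "(norm b)\<^sup>2 = 1" using norm_cross_dot[of n a] f by simp
  then show "b \<bullet> b = 1" by (simp add: power2_norm_eq_inner)
  show "cross3 a b = n" using f aa by (simp add: Lagrange inner_commute)
qed

lemma frame_expand: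
  assumes "frame n a b"
  shows "x = (n \<bullet> x) *\<^sub>R n + (a \<bullet> x) *\<^sub>R a + (b \<bullet> x) *\<^sub>R b"
proof -
  note f = frame_simps[OF assms]
  have b: "b = cross3 n a" using assms by (simp add: frame_def)
  define y where "y = x - ((n \<bullet> x) *\<^sub>R n + (a \<bullet> x) *\<^sub>R a + (b \<bullet> x) *\<^sub>R b)"
  have y: "n \<bullet> y = 0" "a \<bullet> y = 0" "b \<bullet> y = 0"
    by (simp_all add: y_def inner_diff_right inner_add_right f)
  have "cross3 y b = 0" unfolding b Lagrange using y by (simp add: inner_commute)
  then have "(norm y * norm b)\<^sup>2 = 0" using norm_cross_dot[of y b] y by (simp add: inner_commute)
  then have "y = 0" using f(3) by auto
  then show ?thesis by (simp add: y_def)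
qed

lemma gno_inner:
  assumes "frame n a b"
  shows "n \<bullet> gno n a b h = 1" "a \<bullet> gno n a b h = h $ 1" "b \<bullet> gno n a b h = h $ 2"
    "n \<bullet> gno0 a b h = 0" "a \<bullet> gno0 a b h = h $ 1" "b \<bullet> gno0 a b h = h $ 2"
  using frame_simps[OF assms] by (simp_all add: gno_def gno0_def inner_add_right)

lemma gno_nonzero: "frame n a b \<Longrightarrow> gno n a b h \<noteq> 0"
  by (metis gno_inner(1) inner_zero_right zero_neq_one)

lemma bounded_linear_gno0: "bounded_linear (gno0 a b)"
  unfolding gno0_def [abs_def]
  by (intro bounded_linear_add bounded_linear_compose[OF bounded_linear_scaleR_left] bounded_linear_vec_nth)

lemma has_derivative_gno: "(gno n a b has_derivative gno0 a b) (at u)"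
  unfolding gno_def [abs_def]
  using bounded_linear_imp_has_derivative[OF bounded_linear_gno0] by (auto intro!: derivative_eq_intros)

lemma dsgn_self: "y \<noteq> 0 \<Longrightarrow> dsgn y y = 0"
  by (simp add: dsgn_def power3_eq_cube power2_eq_square flip: power2_norm_eq_inner)
     (simp add: field_simps)

lemma dsgn_scaleR: "0 < c \<Longrightarrow> dsgn (c *\<^sub>R y) w = (1 / c) *\<^sub>R dsgn y w"
  by (simp add: dsgn_def algebra_simps power3_eq_cube divide_inverse) (auto simp: field_simps)

text \<open>Two gnomonic charts overlap with a change of coordinates \<open>v = (b \<bullet> y) / (n' \<bullet> y)\<close> of positive
  Jacobian \<open>(n' \<bullet> y)\<^sup>-\<^sup>3\<close>.\<close>

lemma gno_transition:
  assumes F: "frame n a b" and G: "frame n' a' b'"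
    and eq: "sgn (gno n a b u) = sgn (gno n' a' b' v)"
  obtains L where "linear L" "0 < det (matrix L)"
    "\<And>h. dsgn (gno n a b u) (gno0 a b h) = dsgn (gno n' a' b' v) (gno0 a' b' (L h))"
proof -
  note f = frame_simps[OF F] and g = frame_simps[OF G]
  define y where "y = gno n a b u"
  define y' where "y' = gno n' a' b' v"
  have y0: "y \<noteq> 0" "y' \<noteq> 0" unfolding y_def y'_def using gno_nonzero F G by auto
  have "y = norm y *\<^sub>R sgn y" using y0 by (simp add: sgn_div_norm)
  also have "sgn y = sgn y'" using eq by (simp add: y_def y'_def)
  finally have yy: "y = (norm y / norm y') *\<^sub>R y'" by (simp add: sgn_div_norm divide_inverse)
  define c where "c = n' \<bullet> y"
  have cy: "c = norm y / norm y'"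
    by (subst c_def, subst yy) (simp add: y'_def gno_inner(1)[OF G])
  have c: "0 < c" using y0 by (simp add: cy)
  have y: "y = c *\<^sub>R y'" using yy by (simp add: cy)
  \<comment> \<open>The differential at \<open>y\<close> of the central projection with coordinates
    \<open>(a' \<bullet> y) / (n' \<bullet> y)\<close> and
    \<open>(b' \<bullet> y) / (n' \<bullet> y)\<close>.\<close>
  define L0 :: "real^3 \<Rightarrow> real^2" where
    "L0 w = vector [(a' \<bullet> w) / c - (a' \<bullet> y) * (n' \<bullet> w) / c\<^sup>2, (b' \<bullet> w) / c - (b' \<bullet> y) * (n' \<bullet> w) / c\<^sup>2]" for w
  define L where "L h = L0 (gno0 a b h)" for h
  have gL0: "gno0 a' b' (L0 w) = (1 / c) *\<^sub>R w - ((n' \<bullet> w) / c\<^sup>2) *\<^sub>R y" for w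
  proof -
    have "(1 / c) *\<^sub>R w - ((n' \<bullet> w) / c\<^sup>2) *\<^sub>R y
       = (1 / c) *\<^sub>R ((n' \<bullet> w) *\<^sub>R n' + (a' \<bullet> w) *\<^sub>R a' + (b' \<bullet> w) *\<^sub>R b')
         - ((n' \<bullet> w) / c\<^sup>2) *\<^sub>R ((n' \<bullet> y) *\<^sub>R n' + (a' \<bullet> y) *\<^sub>R a' + (b' \<bullet> y) *\<^sub>R b')"
      using frame_expand[OF G, of w] frame_expand[OF G, of y] by simp
    also have "\<dots> = gno0 a' b' (L0 w)"
      using c by (simp add: gno0_def L0_def c_def[symmetric] algebra_simps power2_eq_square)
    finally show ?thesis ..
  qed
  have lin: "linear L"
    unfolding L_def L0_def
    by (rule linearI)
       (simp_all add: gno0_def vec_eq_iff forall_2 vector_2 inner_add_right algebra_simps add_divide_distrib diff_divide_distrib)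
  have "dsgn y w = dsgn y' (gno0 a' b' (L0 w))" for w
  proof -
    have "dsgn y' (gno0 a' b' (L0 w)) = (1 / c) *\<^sub>R dsgn y' w - ((n' \<bullet> w) / c\<^sup>2 * c) *\<^sub>R dsgn y' y'"
      unfolding gL0 by (subst y) (simp add: dsgn_def inner_diff_right algebra_simps)
    also have "\<dots> = dsgn y w" using dsgn_self[OF y0(2)] dsgn_scaleR[OF c, of y' w] y by simp
    finally show ?thesis ..
  qed
  then have dd: "dsgn y (gno0 a b h) = dsgn y' (gno0 a' b' (L h))" for h by (simp add: L_def)
  \<comment> \<open>The triple product of \<open>y\<close> with the two image vectors is computed
    twice: in the second frame it is \<open>c\<close> times the determinant, and after dropping
    multiples of \<open>y\<close> it is \<open>y \<bullet> cross3 a b\<close> divided by the square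
    of \<open>c\<close>.\<close>
  have "c * det (matrix L) = 1 / c\<^sup>2"
  proof -
    define w1 where "w1 = gno0 a' b' (L (axis 1 1))"
    define w2 where "w2 = gno0 a' b' (L (axis 2 1))"
    have "cross3 w1 w2 = det (matrix L) *\<^sub>R cross3 a' b'"
      by (simp add: w1_def w2_def gno0_def det_2 matrix_def cross_add_left cross_add_right cross_mult_left
          cross_mult_right cross_skew[of b' a'] algebra_simps)
    then have 1: "y \<bullet> cross3 w1 w2 = c * det (matrix L)"
      by (simp add: g c_def inner_commute mult.commute)
    have ax: "gno0 a b (axis 1 1) = a" "gno0 a b (axis 2 1) = b" by (simp_all add: gno0_def axis_def)
    have w: "w1 = (1 / c) *\<^sub>R a - ((n' \<bullet> a) / c\<^sup>2) *\<^sub>R y" "w2 = (1 / c) *\<^sub>R b - ((n' \<bullet> b) / c\<^sup>2) *\<^sub>R y"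
      by (simp_all add: w1_def w2_def L_def gL0 ax)
    have "y \<bullet> cross3 w1 w2 = (1 / c\<^sup>2) * (y \<bullet> cross3 a b)"
      unfolding w Cross3.left_diff_distrib Cross3.right_diff_distrib
      by (simp add: cross_mult_left cross_mult_right dot_cross_self inner_diff_right power2_eq_square)
    also have "y \<bullet> cross3 a b = 1" using gno_inner(1)[OF F, of u] by (simp add: f y_def inner_commute)
    finally show ?thesis using 1 by simp
  qed
  then have "0 < det (matrix L)" using c by (metis divide_pos_pos zero_less_mult_pos zero_less_one zero_less_power)
  with that lin dd show thesis by (simp add: y_def y'_def)
qed

locale sphere_graph = zonal e f for e :: "real^3" and f
begin

definition "chart n a b u = (ext (gno n a b u), sgn (gno n a b u))"
definition "Dchart n a b u h =
  (f 1 (e \<bullet> sgn (gno n a b u)) * (e \<bullet> dsgn (gno n a b u) (gno0 a b h)), dsgn (gno n a b u) (gno0 a b h))"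
definition "graph = (\<lambda>x. (ext x, x)) ` sphere 0 1"

lemma ext_sgn: "ext (sgn y) = ext y"
  by (cases "y = 0") (simp_all add: ext_def sgn_div_norm[of "sgn y"] norm_sgn)

lemma sgn_unit: "norm x = 1 \<Longrightarrow> sgn x = x" by (simp add: sgn_div_norm)

lemma has_derivative_chart:
  assumes "frame n a b"
  shows "(chart n a b has_derivative Dchart n a b u) (at u)"
proof -
  note nz = gno_nonzero[OF assms, of u]
  have 1: "((\<lambda>u. ext (gno n a b u)) has_derivative
     (\<lambda>h. f 1 (e \<bullet> sgn (gno n a b u)) * (e \<bullet> dsgn (gno n a b u) (gno0 a b h)))) (at u)"
    using has_derivative_compose[OF has_derivative_gno has_derivative_zonal[OF nz, of 0]]
    by (simp add: ext_def)
  have 2: "((\<lambda>u. sgn (gno n a b u)) has_derivative (\<lambda>h. dsgn (gno n a b u) (gno0 a b h))) (at u)"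
    by (rule has_derivative_compose[OF has_derivative_gno has_derivative_sgn[OF nz]])
  show ?thesis
    unfolding chart_def [abs_def] Dchart_def [abs_def] by (rule has_derivative_Pair[OF 1 2])
qed

lemma frechet_chart: "frame n a b \<Longrightarrow> frechet_derivative (chart n a b) (at u) = Dchart n a b u"
  using frechet_derivative_at[OF has_derivative_chart] by simp

lemma continuous_ext: "S \<subseteq> - {0} \<Longrightarrow> continuous_on S ext"
  using Ck_on_ext[of 0] by (auto intro: continuous_on_subset)

text \<open>A gnomonic chart covers exactly the part over an open hemisphere, and central projection
  onto the tangent plane is an explicit continuous inverse.\<close>

lemma local_param_chart:
  assumes F: "frame n a b"
  shows "local_param graph UNIV (chart n a b)" "chart n a b ` UNIV = {p \<in> graph. 0 < n \<bullet> snd p}"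
proof -
  note fr = frame_simps[OF F]
  have in_graph: "chart n a b u \<in> graph" for u
    unfolding graph_def chart_def using gno_nonzero[OF F, of u]
    by (intro image_eqI[where x = "sgn (gno n a b u)"]) (auto simp: ext_sgn norm_sgn)
  have nx: "n \<bullet> sgn (gno n a b u) = inverse (norm (gno n a b u))" for u
    by (simp add: sgn_div_norm gno_inner(1)[OF F])
  define Y :: "point \<Rightarrow> real^2" where
    "Y p = vector [(a \<bullet> snd p) / (n \<bullet> snd p), (b \<bullet> snd p) / (n \<bullet> snd p)]" for p
  have YX: "Y (chart n a b u) = u" for u
    using gno_nonzero[OF F, of u]
    by (simp add: Y_def chart_def nx vec_eq_iff forall_2 sgn_div_norm gno_inner[OF F])
  have XY: "chart n a b (Y p) = p" if p: "p \<in> graph" "0 < n \<bullet> snd p" for p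
  proof -
    define x where "x = snd p"
    have x: "norm x = 1" "p = (ext x, x)" using p by (auto simp: graph_def x_def)
    have c: "0 < n \<bullet> x" using p by (simp add: x_def)
    have "gno n a b (Y p) = (1 / (n \<bullet> x)) *\<^sub>R ((n \<bullet> x) *\<^sub>R n + (a \<bullet> x) *\<^sub>R a + (b \<bullet> x) *\<^sub>R b)"
      using c by (simp add: gno_def gno0_def Y_def x_def[symmetric] algebra_simps)
    also have "\<dots> = (1 / (n \<bullet> x)) *\<^sub>R x" using frame_expand[OF F, of x] by simp
    finally have "sgn (gno n a b (Y p)) = x" using c x by (simp add: sgn_scaleR sgn_unit)
    then show ?thesis unfolding chart_def using x by (metis ext_sgn)
  qed
  show img: "chart n a b ` UNIV = {p \<in> graph. 0 < n \<bullet> snd p}"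
  proof (intro equalityI subsetI)
    fix p assume "p \<in> chart n a b ` UNIV"
    then obtain u where "p = chart n a b u" by auto
    then show "p \<in> {p \<in> graph. 0 < n \<bullet> snd p}"
      using in_graph[of u] nx[of u] gno_nonzero[OF F, of u] by (simp add: chart_def)
  next
    fix p assume "p \<in> {p \<in> graph. 0 < n \<bullet> snd p}"
    then show "p \<in> chart n a b ` UNIV" using XY by (metis (mono_tags, lifting) mem_Collect_eq rangeI)
  qed
  have "open {p :: point. 0 < n \<bullet> snd p}" by (intro open_Collect_less continuous_intros)
  then have op: "openin (top_of_set graph) (chart n a b ` UNIV)"
    unfolding img by (auto simp: openin_open intro!: exI[of _ "{p. 0 < n \<bullet> snd p}"])
  have sm: "smooth_on UNIV (chart n a b)"
    unfolding smooth_on_def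
  proof
    fix k
    have "Ck_on k (- {0}) (\<lambda>y. (ext y, sgn y))"
      by (intro Ck_on_Pair Ck_on_ext Ck_on_sgn) auto
    then have "Ck_on k UNIV (\<lambda>u. (ext (n + gno0 a b u), sgn (n + gno0 a b u)))"
      using gno_nonzero[OF F]
      by (intro Ck_on_compose_affine[where f = "\<lambda>y. (ext y, sgn y)" and S = "- {0}"] bounded_linear_gno0)
         (auto simp: gno_def)
    then show "Ck_on k UNIV (chart n a b)" by (simp add: chart_def [abs_def] gno_def)
  qed
  have inj: "inj (frechet_derivative (chart n a b) (at u))" for u
  proof -
    have lin: "linear (Dchart n a b u)"
      using has_derivative_chart[OF F] has_derivative_linear by blast
    have "h = 0" if "Dchart n a b u h = 0" for h
    proof -
      let ?y = "gno n a b u" and ?w = "gno0 a b h"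
      have "dsgn ?y ?w = 0" using that by (simp add: Dchart_def zero_prod_def)
      \<comment> \<open>Only multiples of \<open>y\<close> are killed by \<open>dsgn y\<close>.
        Pairing with \<open>n\<close>, which is orthogonal to \<open>?w\<close> and has product 1
        with \<open>?y\<close>, excludes a nonzero multiple.\<close>
      then have w: "inverse (norm ?y) *\<^sub>R ?w = (inverse (norm ?y) ^ 3 * (?y \<bullet> ?w)) *\<^sub>R ?y" by (simp add: dsgn_def)
      from arg_cong[OF this, of "\<lambda>x. n \<bullet> x"] have "inverse (norm ?y) ^ 3 * (?y \<bullet> ?w) = 0"
        by (simp add: gno_inner[OF F])
      with w have "?w = 0" using gno_nonzero[OF F, of u] by simp
      then have "h $ 1 = 0" "h $ 2 = 0" using gno_inner(5,6)[OF F, of h] by simp_all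
      then show ?thesis by (simp add: vec_eq_iff forall_2)
    qed
    then show ?thesis unfolding frechet_chart[OF F] using linear_injective_0[OF lin] by blast
  qed
  have "homeomorphism UNIV (chart n a b ` UNIV) (chart n a b) Y"
  proof (rule homeomorphismI)
    show "continuous_on UNIV (chart n a b)" using sm by (auto simp: smooth_on_def dest: spec[of _ 0])
    have Y: "Y = (\<lambda>p. \<chi> i. if i = 1 then (a \<bullet> snd p) / (n \<bullet> snd p) else (b \<bullet> snd p) / (n \<bullet> snd p))"
      by (simp add: Y_def fun_eq_iff vec_eq_iff forall_2)
    have "continuous_on {p \<in> graph. 0 < n \<bullet> snd p}
       (\<lambda>p. if i = 1 then (a \<bullet> snd p) / (n \<bullet> snd p) else (b \<bullet> snd p) / (n \<bullet> snd p))" for i :: 2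
      by (cases "i = 1") (auto intro!: continuous_intros)
    then show "continuous_on (chart n a b ` UNIV) Y"
      unfolding img Y by (intro continuous_on_vec_lambda)
  qed (auto simp: YX)
  then show "local_param graph UNIV (chart n a b)"
    unfolding local_param_def using sm op inj by auto
qed

lemma ex_frame:
  assumes "norm n = 1"
  obtains a b where "frame n a b"
proof -
  have "n \<noteq> 0" using assms by auto
  then obtain v where "cross3 n v \<noteq> 0" using cross_basis_nonzero by blast
  then have "frame n (sgn (cross3 n v)) (cross3 n (sgn (cross3 n v)))"
    using assms by (simp add: frame_def norm_sgn sgn_div_norm dot_cross_self)
  then show thesis by (rule that)
qed

text \<open>The height depends only on the point of the sphere, so coordinate changes on the graph
  are those between gnomonic charts of the sphere, all taken with positively oriented
  frames.\<close>

lemma orientable_graph: "orientable_surface graph"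
  unfolding orientable_surface_def
proof (intro exI conjI)
  let ?A = "{(UNIV :: (real^2) set, chart n a b) | n a b. frame n a b}"
  show "\<forall>(U, X)\<in>?A. local_param graph U X" using local_param_chart by auto
  show "graph = (\<Union>(U, X)\<in>?A. X ` U)"
  proof (intro equalityI subsetI)
    fix p assume p: "p \<in> graph"
    then have n: "norm (snd p) = 1" by (auto simp: graph_def)
    then obtain a b where F: "frame (snd p) a b" by (rule ex_frame)
    have "p \<in> chart (snd p) a b ` UNIV"
      unfolding local_param_chart(2)[OF F] using p frame_simps(1)[OF F] by simp
    then show "p \<in> (\<Union>(U, X)\<in>?A. X ` U)" using F by blast
  next
    fix p assume "p \<in> (\<Union>(U, X)\<in>?A. X ` U)"
    then obtain n a b where "frame n a b" "p \<in> chart n a b ` UNIV" by auto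
    then show "p \<in> graph" using local_param_chart(2) by auto
  qed
  have "\<exists>L. linear L \<and> frechet_derivative (chart n a b) (at u) = frechet_derivative (chart n' a' b') (at v) \<circ> L \<and>
      0 < det (matrix L)"
    if F: "frame n a b" "frame n' a' b'" and eq: "chart n a b u = chart n' a' b' v" for n a b n' a' b' u v
  proof -
    have s: "sgn (gno n a b u) = sgn (gno n' a' b' v)" using eq by (simp add: chart_def)
    obtain L where "linear L" "0 < det (matrix L)"
      "\<And>h. dsgn (gno n a b u) (gno0 a b h) = dsgn (gno n' a' b' v) (gno0 a' b' (L h))"
      by (rule gno_transition[OF F s]) blast
    then show ?thesis
      by (intro exI[of _ L]) (auto simp: frechet_chart F Dchart_def s)
  qed
  then show "\<forall>(U, X)\<in>?A. \<forall>(V, Y)\<in>?A. \<forall>u\<in>U. \<forall>v\<in>V. X u = Y v \<longrightarrow>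
        (\<exists>L. linear L \<and> frechet_derivative X (at u) = frechet_derivative Y (at v) \<circ> L \<and> 0 < det (matrix L))"
    by blast
qed

end

section \<open>Domains bounded by graphs of constant mean curvature\<close>

locale cmc_graph = desitter K E + sphere_graph e f for K E and e :: "real^3" and f +
  fixes l :: real
  assumes in_range: "\<And>z. \<bar>z\<bar> \<le> 1 \<Longrightarrow> \<exists>r. rhat K E < r \<and> r < 0 \<and> f 0 z = arclength K E r"
    and curvature: "\<And>z. \<bar>z\<bar> \<le> 1 \<Longrightarrow> graph_curvature (radius K E (f 0 z)) (psi K E (radius K E (f 0 z)))
      (f 1 z) (f 2 z) z = l"
begin

definition "region = {(t, x). x \<in> sphere 0 1 \<and> shat K E < t \<and> t < ext x}"

lemma ext_range: "shat K E < ext y" "ext y < 0"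
  using in_range[OF abs_inner_sgn[of y]] arclength_range by (auto simp: ext_def)

text \<open>Straightens the region to a cylinder over the sphere; its closure and the compactness of
  that closure are transported from \<open>{0..1} \<times> sphere 0 1\<close>.\<close>

definition "interp p = (shat K E + fst p * (ext (snd p) - shat K E), snd p :: real^3)"

lemma continuous_interp: "continuous_on ({0..1} \<times> sphere 0 1) interp"
  unfolding interp_def [abs_def]
  by (intro continuous_intros continuous_on_compose2[OF continuous_ext[of "sphere 0 1"]]) auto

lemma interp_image:
  "interp ` ({0<..<1} \<times> sphere 0 1) = region"
  "interp ` ({0..1} \<times> sphere 0 1) = {(t, x). x \<in> sphere 0 1 \<and> shat K E \<le> t \<and> t \<le> ext x}"
proof -
  have inv: "interp ((t - shat K E) / (ext x - shat K E), x) = (t, x)" for t x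
    using ext_range(1)[of x] by (simp add: interp_def)
  show "interp ` ({0<..<1} \<times> sphere 0 1) = region"
  proof (intro equalityI subsetI)
    fix p assume "p \<in> interp ` ({0<..<1} \<times> sphere 0 1)"
    then obtain a x where ax: "0 < a" "a < 1" "x \<in> sphere 0 1" "p = interp (a, x)" by auto
    have "a * (ext x - shat K E) < 1 * (ext x - shat K E)" "0 < a * (ext x - shat K E)"
      using ax ext_range(1)[of x] by (auto intro!: mult_strict_right_mono)
    then show "p \<in> region" using ax by (simp add: interp_def region_def)
  next
    fix p assume p: "p \<in> region"
    obtain t x where tx: "p = (t, x)" by (cases p)
    let ?a = "(t - shat K E) / (ext x - shat K E)"
    have "?a \<in> {0<..<1}"
      using p ext_range(1)[of x] by (auto simp: tx region_def field_simps)
    moreover have "x \<in> sphere 0 1" using p by (simp add: tx region_def)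
    ultimately have "interp (?a, x) \<in> interp ` ({0<..<1} \<times> sphere 0 1)" by blast
    then show "p \<in> interp ` ({0<..<1} \<times> sphere 0 1)" by (simp only: inv tx)
  qed
  show "interp ` ({0..1} \<times> sphere 0 1) = {(t, x). x \<in> sphere 0 1 \<and> shat K E \<le> t \<and> t \<le> ext x}"
  proof (intro equalityI subsetI)
    fix p assume "p \<in> interp ` ({0..1} \<times> sphere 0 1)"
    then obtain a x where ax: "0 \<le> a" "a \<le> 1" "x \<in> sphere 0 1" "p = interp (a, x)" by auto
    have "a * (ext x - shat K E) \<le> 1 * (ext x - shat K E)" "0 \<le> a * (ext x - shat K E)"
      using ax ext_range(1)[of x] by (auto intro!: mult_right_mono)
    then show "p \<in> {(t, x). x \<in> sphere 0 1 \<and> shat K E \<le> t \<and> t \<le> ext x}"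
      using ax by (simp add: interp_def)
  next
    fix p assume p: "p \<in> {(t, x). x \<in> sphere 0 1 \<and> shat K E \<le> t \<and> t \<le> ext x}"
    obtain t x where tx: "p = (t, x)" by (cases p)
    let ?a = "(t - shat K E) / (ext x - shat K E)"
    have "?a \<in> {0..1}"
      using p ext_range(1)[of x] by (auto simp: tx field_simps)
    moreover have "x \<in> sphere 0 1" using p by (simp add: tx)
    ultimately have "interp (?a, x) \<in> interp ` ({0..1} \<times> sphere 0 1)" by blast
    then show "p \<in> interp ` ({0..1} \<times> sphere 0 1)" by (simp only: inv tx)
  qed
qed

lemma closure_region: "closure region = {(t, x). x \<in> sphere 0 1 \<and> shat K E \<le> t \<and> t \<le> ext x}"
proof
  let ?C = "{(t, x). x \<in> sphere 0 1 \<and> shat K E \<le> t \<and> t \<le> ext x}"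
  have "compact ?C"
    unfolding interp_image(2)[symmetric]
    by (intro compact_continuous_image continuous_interp compact_Times) auto
  then show "closure region \<subseteq> ?C" by (intro closure_minimal compact_imp_closed) (auto simp: region_def)
  have cl: "closure ({0<..<1::real} \<times> sphere (0::real^3) 1) = {0..1} \<times> sphere 0 1"
    by (simp add: closure_Times)
  show "?C \<subseteq> closure region"
    unfolding interp_image(2)[symmetric] cl[symmetric]
    by (rule image_closure_subset) (auto simp: cl continuous_interp interp_image(1) closure_subset)
qed

lemma openin_region: "openin (top_of_set (fiber K E)) region"
proof -
  let ?U = "(UNIV :: real set) \<times> (- {0 :: real^3})"
  have "continuous_on ?U (\<lambda>p. ext (snd p) - fst p)"
    by (intro continuous_intros continuous_on_compose2[OF continuous_ext[of "- {0}"]]) auto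
  moreover have "open ?U" by (intro open_Times) auto
  ultimately have "open (?U \<inter> (\<lambda>p. ext (snd p) - fst p) -` {0<..})"
    by (rule continuous_open_preimage) simp
  then have "open ((?U \<inter> (\<lambda>p. ext (snd p) - fst p) -` {0<..}) \<inter> {p. shat K E < fst p})"
    by (rule open_Int) (intro open_Collect_less continuous_intros)
  moreover have "region = fiber K E \<inter> ((?U \<inter> (\<lambda>p. ext (snd p) - fst p) -` {0<..}) \<inter> {p. shat K E < fst p})"
  proof (rule set_eqI)
    fix p :: point
    obtain t x where p: "p = (t, x)" by (cases p)
    have "t < 0" if "t < ext x" using that ext_range(2)[of x] by simp
    then show "p \<in> region \<longleftrightarrow> p \<in> fiber K E \<inter> ((?U \<inter> (\<lambda>p. ext (snd p) - fst p) -` {0<..}) \<inter> {p. shat K E < fst p})"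
      by (auto simp: p region_def fiber_def)
  qed
  ultimately show ?thesis by (auto simp: openin_open)
qed

lemma closure_of_region: "(top_of_set (fiber K E)) closure_of region = closure region"
proof -
  have "region \<subseteq> fiber K E" using openin_region openin_imp_subset by blast
  moreover have "closure region \<subseteq> fiber K E"
  proof
    fix p assume p: "p \<in> closure region"
    obtain t x where tx: "p = (t, x)" by (cases p)
    show "p \<in> fiber K E" using p ext_range(2)[of x] by (simp add: tx closure_region fiber_def)
  qed
  ultimately show ?thesis by (simp add: closure_of_subtopology inf.absorb2)
qed

lemma frontier_of_region:
  "(top_of_set (fiber K E)) frontier_of region = {(t, x). x \<in> sphere 0 1 \<and> (t = shat K E \<or> t = ext x)}"
  unfolding frontier_of_def closure_of_region interior_of_openin[OF openin_region] closure_region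
  using ext_range(1) by (auto simp: region_def less_imp_le)

lemma free_boundary_region: "free_boundary K E region = graph"
proof (rule set_eqI)
  fix p :: point
  obtain t x where p: "p = (t, x)" by (cases p)
  have "ext x \<noteq> shat K E" using ext_range(1)[of x] by simp
  then show "p \<in> free_boundary K E region \<longleftrightarrow> p \<in> graph"
    unfolding free_boundary_def frontier_of_region fixed_boundary_def graph_def p by auto
qed

lemma admissible_region: "admissible K E region"
proof -
  have cont: "continuous_on (sphere 0 1) (\<lambda>x. (ext x, x))"
    by (intro continuous_intros continuous_ext) auto
  have "compact (closure region)"
    unfolding closure_region interp_image(2)[symmetric]
    by (intro compact_continuous_image continuous_interp compact_Times) auto
  moreover have "compact graph" unfolding graph_def by (intro compact_continuous_image cont) auto
  moreover have "connected graph"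
    unfolding graph_def by (intro connected_continuous_image cont connected_sphere) auto
  moreover have "graph \<noteq> {}" by (auto simp: graph_def)
  ultimately show ?thesis
    unfolding admissible_def free_boundary_region closure_of_region frontier_of_region fixed_boundary_def
    using openin_region orientable_graph by auto
qed

text \<open>If \<open>b\<close> is orthogonal to the axis, the graph rises only in direction
  \<open>a\<close>, and both fundamental forms become diagonal. Where \<open>x\<close> is parallel
  to the axis any frame has this property.\<close>

lemma frame_axis:
  assumes "norm x = 1"
  obtains a b where "frame x a b" "e \<bullet> b = 0"
proof (cases "cross3 x e = 0")
  case True
  obtain a b where F: "frame x a b" using ex_frame[OF assms] .
  have "(x \<bullet> e) *\<^sub>R x - (x \<bullet> x) *\<^sub>R e = 0"
    using True by (simp flip: Lagrange)
  then have "e = (x \<bullet> e) *\<^sub>R x" using frame_simps(1)[OF F] by simp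
  then have "e \<bullet> b = 0" using frame_simps(6)[OF F] by (metis inner_scaleR_left mult_zero_right)
  with F that show thesis by blast
next
  case False
  define b where "b = sgn (cross3 x e)"
  have b: "norm b = 1" "x \<bullet> b = 0" "e \<bullet> b = 0"
    using False by (simp_all add: b_def norm_sgn sgn_div_norm dot_cross_self)
  have xx: "x \<bullet> x = 1" using assms by (simp flip: power2_norm_eq_inner)
  define a where "a = cross3 b x"
  have "cross3 x a = b" unfolding a_def Lagrange using xx b by (simp add: inner_commute)
  moreover have "norm a = 1"
  proof -
    have "(norm a)\<^sup>2 = 1" using norm_cross_dot[of b x] b assms by (simp add: a_def inner_commute)
    then show ?thesis by (simp add: power2_eq_1_iff) (metis norm_ge_zero not_one_le_zero neg_0_le_iff_le)
  qed
  moreover have "x \<bullet> a = 0" by (simp add: a_def dot_cross_self)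
  ultimately have "frame x a b" using assms by (simp add: frame_def)
  with b that show thesis by blast
qed

text \<open>Everything is evaluated at the centre of a gnomonic chart, where the differential of the
  radial projection is the identity on the tangent plane. The principal directions are the meridian
  \<open>a\<close> and the parallel \<open>b\<close>, and their curvatures add up to
  \<open>graph_curvature\<close>.\<close>

lemma mean_curvature_region:
  assumes "norm x = 1"
  shows "has_mean_curvature_at K E region (ext x, x) l"
proof -
  obtain a b where F: "frame x a b" and eb: "e \<bullet> b = 0" using frame_axis[OF assms] .
  note fr = frame_simps[OF F]
  define z where "z = e \<bullet> x"
  define c where "c = e \<bullet> a"
  define r where "r = radius K E (ext x)"
  define r' where "r' = psi K E r"
  define R where "R = sqrt (r\<^sup>2 + (f 1 z)\<^sup>2 * c\<^sup>2)"
  \<comment> \<open>Orthogonality to the graph fixes the ratio \<open>N1 / N0\<close>, unit length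
    then fixes \<open>N0\<close> up to sign, and the positive sign points out of the region.\<close>
  define N0 where "N0 = \<bar>r\<bar> / R"
  define N1 where "N1 = - N0 * f 1 z * c / r\<^sup>2"
  define N where "N = (N0, N1 *\<^sub>R a)"
  let ?X = "chart x a b" and ?G = "warped_metric K E"
  have ez: "ext x = f 0 z" using sgn_unit[OF assms] by (simp add: ext_def z_def)
  have z1: "\<bar>z\<bar> \<le> 1" using abs_inner_sgn[of x] sgn_unit[OF assms] by (simp add: z_def)
  obtain r0 where r0: "rhat K E < r0" "r0 < 0" "f 0 z = arclength K E r0" using in_range[OF z1] by blast
  then have rr: "r = r0" unfolding r_def ez by (simp add: radius_arclength)
  then have r: "r < 0" using r0 by simp
  have dr: "(radius K E has_real_derivative r') (at (ext x))"
    using radius_deriv[OF r0(1,2)] by (simp add: ez r0(3) r'_def rr)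
  have cz: "c\<^sup>2 = 1 - z\<^sup>2"
  proof -
    have "e \<bullet> e = e \<bullet> ((x \<bullet> e) *\<^sub>R x + (a \<bullet> e) *\<^sub>R a + (b \<bullet> e) *\<^sub>R b)"
      using frame_expand[OF F, of e] by simp
    then have "1 = z\<^sup>2 + c\<^sup>2"
      using e eb by (simp add: inner_add_right z_def c_def inner_commute power2_eq_square flip: power2_norm_eq_inner)
    then show ?thesis by simp
  qed
  have R2: "R\<^sup>2 = r\<^sup>2 + (f 1 z)\<^sup>2 * c\<^sup>2" by (simp add: R_def)
  have Rpos: "0 < R" unfolding R_def using r by (simp add: add_pos_nonneg)
  have N0pos: "0 < N0" using r Rpos by (simp add: N0_def divide_neg_pos)
  have g0: "gno x a b 0 = x" by (simp add: gno_def gno0_def)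
  have X0: "?X 0 = (ext x, x)" by (simp add: chart_def g0 sgn_unit assms)
  have xg: "x \<bullet> gno0 a b h = 0" for h using gno_inner(4)[OF F] .
  have eg: "e \<bullet> gno0 a b h = c * h $ 1" for h by (simp add: gno0_def inner_add_right eb c_def mult.commute)
  have gg: "gno0 a b h \<bullet> gno0 a b k = h $ 1 * k $ 1 + h $ 2 * k $ 2" for h k
    by (simp add: gno0_def inner_add_left inner_add_right fr algebra_simps)
  have ag: "gno0 a b h \<bullet> a = h $ 1" for h by (simp add: gno0_def inner_add_left fr)
  have ds: "dsgn x (gno0 a b h) = gno0 a b h" for h by (simp add: dsgn_def assms xg)
  have D1: "frechet_derivative ?X (at 0) h = (f 1 z * (c * h $ 1), gno0 a b h)" for h
    by (simp add: frechet_chart[OF F] Dchart_def g0 sgn_unit assms ds eg z_def)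
  have D2: "frechet_derivative (\<lambda>w. frechet_derivative ?X (at w) h) (at 0) k =
     (f 2 z * (c * k $ 1) * (c * h $ 1) - f 1 z * z * (h $ 1 * k $ 1 + h $ 2 * k $ 2),
      - (h $ 1 * k $ 1 + h $ 2 * k $ 2) *\<^sub>R x)" for h k
  proof -
    let ?w = "gno0 a b h"
    have H1: "((\<lambda>y. frechet_derivative ext (at y) ?w) has_derivative (\<lambda>k. hess x k ?w)) (at (gno x a b 0))"
      using has_derivative_frechet_ext[OF assms, of ?w] by (simp add: g0)
    have H2: "((\<lambda>y. dsgn y ?w) has_derivative (\<lambda>k. d2sgn x k ?w)) (at (gno x a b 0))"
      using has_derivative_dsgn[OF assms, of ?w] by (simp add: g0)
    have "((\<lambda>w. frechet_derivative ?X (at w) h) has_derivative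
       (\<lambda>k. (hess x (gno0 a b k) ?w, d2sgn x (gno0 a b k) ?w))) (at 0)"
      using has_derivative_Pair[OF has_derivative_compose[OF has_derivative_gno H1]
          has_derivative_compose[OF has_derivative_gno H2]] frechet_ext[OF gno_nonzero[OF F]]
      by (simp add: frechet_chart[OF F] Dchart_def)
    then have "frechet_derivative (\<lambda>w. frechet_derivative ?X (at w) h) (at 0) k
       = (hess x (gno0 a b k) ?w, d2sgn x (gno0 a b k) ?w)"
      using frechet_derivative_at by (metis (no_types, lifting))
    moreover have "d2sgn x (gno0 a b k) ?w = - (h $ 1 * k $ 1 + h $ 2 * k $ 2) *\<^sub>R x"
      by (simp add: d2sgn_def xg gg mult.commute flip: scaleR_minus_left)
    ultimately show ?thesis
      by (simp add: hess_def ds eg z_def[symmetric] algebra_simps)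
  qed
  have metric: "?G (?X 0) V W = fst V * fst W + r\<^sup>2 * (snd V \<bullet> snd W)" for V W
    by (simp add: warped_metric_def X0 r_def)
  have chr: "christoffel ?G (?X 0) V W Z = r * r' *
     (fst V * (snd W \<bullet> snd Z) + fst W * (snd V \<bullet> snd Z) - fst Z * (snd V \<bullet> snd W))" for V W Z
  proof -
    have d: "frechet_derivative (\<lambda>q. ?G q A B) (at (ext x, x)) C = 2 * r * r' * fst C * (snd A \<bullet> snd B)" for A B C
    proof -
      have "(radius K E has_derivative (*) r') (at (fst (ext x, x)))"
        using dr by (simp add: has_field_derivative_def)
      from has_derivative_compose[OF has_derivative_fst[OF has_derivative_ident] this]
      have [derivative_intros]: "((\<lambda>q :: point. radius K E (fst q)) has_derivative (\<lambda>C. r' * fst C)) (at (ext x, x))" .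
      have "((\<lambda>q. ?G q A B) has_derivative (\<lambda>C. 2 * r * r' * fst C * (snd A \<bullet> snd B))) (at (ext x, x))"
        unfolding warped_metric_def
        by (auto intro!: derivative_eq_intros simp: r_def fun_eq_iff algebra_simps)
      then show ?thesis using frechet_derivative_at by metis
    qed
    show ?thesis unfolding christoffel_def X0 d by (simp add: field_simps)
  qed
  have second: "second_form K E ?X N 0 h k = N0 * (f 2 z * c\<^sup>2 * (h $ 1 * k $ 1) - f 1 z * z * (h $ 1 * k $ 1 + h $ 2 * k $ 2))
      + r * r' * (2 * f 1 z * c * N1 * (h $ 1 * k $ 1) - N0 * (h $ 1 * k $ 1 + h $ 2 * k $ 2))" for h k
    unfolding second_form_def D1 D2 metric chr N_def
    by (simp add: xg gg ag fr algebra_simps power2_eq_square inner_commute[of x])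
  define h :: "real^2" where "h = axis 1 (1 / R)"
  define k :: "real^2" where "k = axis 2 (1 / \<bar>r\<bar>)"
  have hk: "h $ 1 = 1 / R" "h $ 2 = 0" "k $ 1 = 0" "k $ 2 = 1 / \<bar>r\<bar>" by (simp_all add: h_def k_def axis_def)
  have N01: "N0\<^sup>2 * R\<^sup>2 = r\<^sup>2" using Rpos by (simp add: N0_def power_divide)
  have rN1: "r\<^sup>2 * N1 = - N0 * f 1 z * c" using r by (simp add: N1_def)
  have first: "first_form K E ?X 0 u v = (f 1 z)\<^sup>2 * c\<^sup>2 * (u $ 1 * v $ 1) + r\<^sup>2 * (u $ 1 * v $ 1 + u $ 2 * v $ 2)" for u v
    unfolding first_form_def D1 metric by (simp add: gg power2_eq_square algebra_simps)
  have "first_form K E ?X 0 h h = R\<^sup>2 * (1 / R * (1 / R))"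
    unfolding first hk R2 by (simp add: add_divide_distrib)
  then have "first_form K E ?X 0 h h = 1" using Rpos by (simp add: power2_eq_square)
  moreover have "first_form K E ?X 0 k k = 1" "first_form K E ?X 0 h k = 0"
    unfolding first hk using r by (simp_all add: power2_eq_square)
  moreover have "second_form K E ?X N 0 h k = 0" unfolding second hk by simp
  moreover have "l = second_form K E ?X N 0 h h + second_form K E ?X N 0 k k"
  proof -
    have "second_form K E ?X N 0 h h + second_form K E ?X N 0 k k =
       (N0 * (f 2 z * c\<^sup>2 - f 1 z * z) + r' / r * (2 * f 1 z * c * (r\<^sup>2 * N1)) - r * r' * N0) / R\<^sup>2
       + (- N0 * f 1 z * z - r * r' * N0) / r\<^sup>2"
      unfolding second hk using r Rpos by (simp add: field_simps power2_eq_square)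
    also have "\<dots> = N0 * ((f 2 z * c\<^sup>2 - f 1 z * z - 2 * r' * (f 1 z)\<^sup>2 * c\<^sup>2 / r - r * r') / R\<^sup>2 + (- f 1 z * z - r * r') / r\<^sup>2)"
      unfolding rN1 by (simp add: algebra_simps power2_eq_square add_divide_distrib diff_divide_distrib)
    also have "\<dots> = graph_curvature r r' (f 1 z) (f 2 z) z"
      unfolding graph_curvature_def Let_def cz[symmetric] R2[symmetric] N0_def using Rpos by simp
    also have "\<dots> = l" using curvature[OF z1] by (simp add: r_def r'_def ez)
    finally show ?thesis ..
  qed
  moreover have "outward_unit_normal K E region ?X 0 N"
    unfolding outward_unit_normal_def Let_def
  proof (intro conjI allI)
    show "snd N \<bullet> snd (?X 0) = 0" by (simp add: N_def X0 fr)
    have "N0\<^sup>2 + r\<^sup>2 * N1\<^sup>2 = N0\<^sup>2 * R\<^sup>2 / r\<^sup>2"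
      unfolding R2 N1_def using r by (simp add: field_simps power2_eq_square)
    then show "?G (?X 0) N N = 1"
      unfolding metric N_def using r N01 by (simp add: fr power2_eq_square)
    have "?G (?X 0) (frechet_derivative ?X (at 0) h) N = h $ 1 * (N0 * f 1 z * c + r\<^sup>2 * N1)" for h
      unfolding metric D1 N_def by (simp add: ag algebra_simps)
    then show "?G (?X 0) (frechet_derivative ?X (at 0) h) N = 0" for h by (simp add: rN1)
    let ?c = "\<lambda>t. (fst (?X 0) + t * fst N, sgn (snd (?X 0) + t *\<^sub>R snd N))"
    \<comment> \<open>The signed height of the test curve above the graph. Its derivative at 0 is
      \<open>N0 - f 1 z * N1 * c\<close>, which is positive because the product has the sign
      opposite to \<open>N0\<close> or vanishes.\<close>
    define \<phi> where "\<phi> t = ext x + t * N0 - ext (x + t *\<^sub>R (N1 *\<^sub>R a))" for t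
    have nz: "x + t *\<^sub>R (N1 *\<^sub>R a) \<noteq> 0" for t
    proof
      assume "x + t *\<^sub>R (N1 *\<^sub>R a) = 0"
      then have "x \<bullet> (x + t *\<^sub>R (N1 *\<^sub>R a)) = 0" by simp
      then show False by (simp add: inner_add_right fr)
    qed
    have cregion: "?c t \<in> region \<longleftrightarrow> shat K E < ext x + t * N0 \<and> \<phi> t < 0" for t
      using nz[of t] by (simp add: region_def X0 N_def \<phi>_def norm_sgn ext_sgn)
    have x0: "x \<noteq> 0" using assms by auto
    have "((\<lambda>t. x + t *\<^sub>R (N1 *\<^sub>R a)) has_derivative (\<lambda>t. t *\<^sub>R (N1 *\<^sub>R a))) (at 0)"
      by (auto intro!: derivative_eq_intros)
    moreover have "(ext has_derivative (\<lambda>b. f 1 z * (e \<bullet> dsgn x b))) (at (x + 0 *\<^sub>R (N1 *\<^sub>R a)))"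
      using has_derivative_zonal[OF x0, of 0] sgn_unit[OF assms]
      by (simp add: ext_def [abs_def] z_def)
    ultimately have "((\<lambda>t. ext (x + t *\<^sub>R (N1 *\<^sub>R a))) has_derivative (\<lambda>t. f 1 z * (e \<bullet> dsgn x (t *\<^sub>R (N1 *\<^sub>R a))))) (at 0)"
      by (rule has_derivative_compose)
    moreover have "(\<lambda>t. f 1 z * (e \<bullet> dsgn x (t *\<^sub>R (N1 *\<^sub>R a)))) = (*) (f 1 z * N1 * c)"
      by (simp add: fun_eq_iff dsgn_def fr assms c_def)
    ultimately have "((\<lambda>t. ext (x + t *\<^sub>R (N1 *\<^sub>R a))) has_real_derivative f 1 z * N1 * c) (at 0)"
      unfolding has_field_derivative_def by (simp only:)
    then have d\<phi>: "(\<phi> has_real_derivative N0 - f 1 z * N1 * c) (at 0)"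
      unfolding \<phi>_def [abs_def] by (auto intro!: derivative_eq_intros)
    have "f 1 z * N1 * c \<le> 0"
    proof -
      have "f 1 z * N1 * c = - (N0 * (f 1 z * c)\<^sup>2 / r\<^sup>2)" by (simp add: N1_def power2_eq_square)
      then show ?thesis using N0pos by simp
    qed
    then have pos: "0 < N0 - f 1 z * N1 * c" using N0pos by simp
    have \<phi>0: "\<phi> 0 = 0" by (simp add: \<phi>_def)
    obtain d where d: "0 < d" "\<And>h. 0 < h \<Longrightarrow> h < d \<Longrightarrow> 0 < \<phi> h"
      using DERIV_pos_inc_right[OF d\<phi> pos] \<phi>0 by auto
    show "\<forall>\<^sub>F t in at_right 0. ?c t \<notin> region"
      unfolding cregion eventually_at_right_field using d by (intro exI[of _ d]) (auto simp: not_less less_imp_le)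
    obtain d' where d': "0 < d'" "\<And>h. 0 < h \<Longrightarrow> h < d' \<Longrightarrow> \<phi> (- h) < 0"
      using DERIV_pos_inc_left[OF d\<phi> pos] \<phi>0 by auto
    \<comment> \<open>Backwards, the curve must also stay above \<open>shat\<close>; the second
      entry of the minimum ensures this.\<close>
    define m where "m = min d' ((ext x - shat K E) / N0)"
    have m: "0 < m" using d'(1) N0pos ext_range(1)[of x] by (simp add: m_def)
    have "?c t \<in> region" if "- m < t" "t < 0" for t
    proof -
      have "(- t) * N0 < ((ext x - shat K E) / N0) * N0"
        using that N0pos by (intro mult_strict_right_mono) (auto simp: m_def)
      then have "shat K E < ext x + t * N0" using N0pos by simp
      moreover have "\<phi> t < 0" using d'(2)[of "- t"] that by (simp add: m_def)
      ultimately show ?thesis by (simp add: cregion)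
    qed
    then show "\<forall>\<^sub>F t in at_left 0. ?c t \<in> region"
      unfolding eventually_at_left_field using m by (intro exI[of _ "- m"]) auto
  qed
  moreover have "local_param (free_boundary K E region) UNIV ?X"
    unfolding free_boundary_region by (rule local_param_chart(1)[OF F])
  ultimately show ?thesis
    unfolding has_mean_curvature_at_def using X0
    by (intro exI[of _ UNIV] exI[of _ ?X] exI[of _ 0] exI[of _ N] exI[of _ h] exI[of _ k]) simp
qed

lemma critical_region: "critical K E l region"
  unfolding critical_def free_boundary_region
  using admissible_region mean_curvature_region by (auto simp: graph_def)

end

section \<open>Hoelder norms\<close>

lemma prod_diff_le:
  fixes u v u' v' d :: real
  assumes "\<bar>u - u'\<bar> \<le> A * d" "\<bar>v\<bar> \<le> B'" "\<bar>u'\<bar> \<le> B" "\<bar>v - v'\<bar> \<le> A' * d"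
  shows "\<bar>u * v - u' * v'\<bar> \<le> (A * B' + B * A') * d"
proof -
  have "u * v - u' * v' = (u - u') * v + u' * (v - v')" by (simp add: algebra_simps)
  then have "\<bar>u * v - u' * v'\<bar> \<le> \<bar>u - u'\<bar> * \<bar>v\<bar> + \<bar>u'\<bar> * \<bar>v - v'\<bar>"
    by (metis abs_mult abs_triangle_ineq)
  also have "\<dots> \<le> (A * d) * B' + B * (A' * d)"
    using assms by (intro add_mono mult_mono) (auto intro: order_trans[OF abs_ge_zero])
  finally show ?thesis by (simp add: algebra_simps)
qed

lemma dist_le_powr:
  fixes d :: real
  assumes "0 < \<alpha>" "\<alpha> < 1" "0 \<le> d" "d \<le> 2"
  shows "d \<le> 2 * d powr \<alpha>"
proof (cases "d = 0")
  case False
  then have d: "0 < d" using assms by simp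
  have "d powr (1 - \<alpha>) \<le> 2 powr (1 - \<alpha>)" using assms d by (intro powr_mono2) auto
  also have "\<dots> \<le> 2 powr 1" using assms by (intro powr_mono) auto
  finally have "d powr (1 - \<alpha>) * d powr \<alpha> \<le> 2 * d powr \<alpha>" by (intro mult_right_mono) auto
  moreover have "d powr (1 - \<alpha>) * d powr \<alpha> = d" using d by (simp flip: powr_add)
  ultimately show ?thesis by simp
qed simp

context sphere_graph
begin

text \<open>On unit vectors the Hessian is at most \<open>10 * m\<close> and has Lipschitz constant
  at most \<open>30 * m\<close>. Distances on the sphere are at most 2, so passing to the exponent
  \<alpha> costs a factor 2, which gives 60.\<close>

lemma holder_bound:
  assumes \<alpha>: "0 < \<alpha>" "\<alpha> < 1"
    and m: "\<And>z. \<bar>z\<bar> \<le> 1 \<Longrightarrow> \<bar>f 0 z - s\<bar> \<le> m" "\<And>z. \<bar>z\<bar> \<le> 1 \<Longrightarrow> \<bar>f 1 z\<bar> \<le> m"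
      "\<And>z. \<bar>z\<bar> \<le> 1 \<Longrightarrow> \<bar>f 2 z\<bar> \<le> m" "\<And>z. \<bar>z\<bar> \<le> 1 \<Longrightarrow> \<bar>f 3 z\<bar> \<le> m"
  shows "holder_norm_le \<alpha> (\<lambda>x. ext x - s) (60 * m)"
proof -
  have m0: "0 \<le> m" using m(2)[of 0] by simp
  define W where "W y = ext (sgn y) - s" for y
  have W: "W y = ext y - s" for y by (simp add: W_def ext_sgn)
  have dW: "frechet_derivative W (at y) = frechet_derivative ext (at y)" if "y \<noteq> 0" for y
  proof -
    have "(W has_derivative frechet_derivative ext (at y)) (at y)"
      unfolding W [abs_def] using Ck_on_has_derivative[OF Ck_on_ext, of y] that
      by (auto intro!: derivative_eq_intros)
    then show ?thesis by (rule frechet_derivative_at[symmetric])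
  qed
  have d2W: "frechet_derivative (\<lambda>y. frechet_derivative W (at y) b) (at x) a = hess x a b"
    if "norm x = 1" for x a b
  proof -
    have "((\<lambda>y. frechet_derivative W (at y) b) has_derivative (\<lambda>a. hess x a b)) (at x)"
      by (rule has_derivative_transform_within_open[OF has_derivative_frechet_ext[OF that], of "- {0}"])
         (use that dW in auto)
    then show ?thesis using frechet_derivative_at by metis
  qed
  have CW: "Ck_on 2 (- {0}) W"
  proof -
    have "Ck_on 2 (- {0}) (\<lambda>y. ext y + (- s))" by (intro Ck_on_add Ck_on_ext Ck_on_const) auto
    then show ?thesis by (simp add: W [abs_def])
  qed
  have ip: "\<bar>v \<bullet> w\<bar> \<le> 1" if "norm v = 1" "norm w = 1" for v w :: "real^3"
    using Cauchy_Schwarz_ineq2[of v w] that by simp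
  have ipd: "\<bar>v \<bullet> w - v' \<bullet> w\<bar> \<le> 1 * dist v v'" if "norm w = 1" for v v' w :: "real^3"
    using Cauchy_Schwarz_ineq2[of "v - v'" w] that by (simp add: inner_diff_left dist_norm)
  have ed: "e \<bullet> dsgn x a = e \<bullet> a - (x \<bullet> a) * (x \<bullet> e)" if "norm x = 1" for x a
    using that by (simp add: dsgn_def inner_diff_right inner_commute)
  have ed2: "e \<bullet> d2sgn x a b = 3 * ((x \<bullet> a) * (x \<bullet> b) * (x \<bullet> e)) - (x \<bullet> a) * (e \<bullet> b) - (a \<bullet> b) * (x \<bullet> e) - (x \<bullet> b) * (e \<bullet> a)"
    for x a b by (simp add: d2sgn_def inner_diff_right inner_add_right inner_commute)
  have P2: "\<bar>e \<bullet> dsgn x a\<bar> \<le> 2" if "norm x = 1" "norm a = 1" for x a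
  proof -
    have "\<bar>(x \<bullet> a) * (x \<bullet> e)\<bar> \<le> 1 * 1" unfolding abs_mult using that e by (intro mult_mono ip) auto
    then show ?thesis using ip[OF e that(2)] unfolding ed[OF that(1)] by linarith
  qed
  have PL: "\<bar>e \<bullet> dsgn x a - e \<bullet> dsgn y a\<bar> \<le> 2 * dist x y" if "norm x = 1" "norm y = 1" "norm a = 1" for x y a
    using prod_diff_le[OF ipd[OF that(3)] ip[OF that(1) e] ip[OF that(2,3)] ipd[OF e]]
    unfolding ed[OF that(1)] ed[OF that(2)] by simp
  have S6: "\<bar>e \<bullet> d2sgn x a b\<bar> \<le> 6" if "norm x = 1" "norm a = 1" "norm b = 1" for x a b
  proof -
    have "\<bar>(x \<bullet> a) * (x \<bullet> b) * (x \<bullet> e)\<bar> \<le> 1 * 1 * 1" unfolding abs_mult using that e by (intro mult_mono ip) auto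
    moreover have "\<bar>(x \<bullet> a) * (e \<bullet> b)\<bar> \<le> 1 * 1" "\<bar>(a \<bullet> b) * (x \<bullet> e)\<bar> \<le> 1 * 1" "\<bar>(x \<bullet> b) * (e \<bullet> a)\<bar> \<le> 1 * 1"
      unfolding abs_mult using that e by (intro mult_mono ip; simp)+
    ultimately show ?thesis unfolding ed2 by linarith
  qed
  have SL: "\<bar>e \<bullet> d2sgn x a b - e \<bullet> d2sgn y a b\<bar> \<le> 12 * dist x y"
    if n: "norm x = 1" "norm y = 1" "norm a = 1" "norm b = 1" for x y a b
  proof -
    have ab: "\<bar>(x \<bullet> a) * (x \<bullet> b) - (y \<bullet> a) * (y \<bullet> b)\<bar> \<le> 2 * dist x y"
      using prod_diff_le[OF ipd[OF n(3)] ip[OF n(1,4)] ip[OF n(2,3)] ipd[OF n(4)]] by simp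
    have yab: "\<bar>(y \<bullet> a) * (y \<bullet> b)\<bar> \<le> 1"
      using mult_mono[OF ip[OF n(2,3)] ip[OF n(2,4)]] by (simp add: abs_mult)
    have 1: "\<bar>(x \<bullet> a) * (x \<bullet> b) * (x \<bullet> e) - (y \<bullet> a) * (y \<bullet> b) * (y \<bullet> e)\<bar> \<le> 3 * dist x y"
      using prod_diff_le[OF ab ip[OF n(1) e] yab ipd[OF e]] by simp
    have lin: "\<bar>(x \<bullet> v) * c - (y \<bullet> v) * c\<bar> \<le> dist x y" if "norm v = 1" "\<bar>c\<bar> \<le> 1" for v c
    proof -
      have "\<bar>(x \<bullet> v) * c - (y \<bullet> v) * c\<bar> = \<bar>x \<bullet> v - y \<bullet> v\<bar> * \<bar>c\<bar>"
        by (simp add: left_diff_distrib flip: abs_mult)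
      also have "\<dots> \<le> dist x y * 1" using ipd[OF that(1), of x y] that(2) by (intro mult_mono) auto
      finally show ?thesis by simp
    qed
    have 2: "\<bar>(x \<bullet> a) * (e \<bullet> b) - (y \<bullet> a) * (e \<bullet> b)\<bar> \<le> dist x y"
      and 3: "\<bar>(x \<bullet> b) * (e \<bullet> a) - (y \<bullet> b) * (e \<bullet> a)\<bar> \<le> dist x y"
      and 4: "\<bar>(x \<bullet> e) * (a \<bullet> b) - (y \<bullet> e) * (a \<bullet> b)\<bar> \<le> dist x y"
      using n e by (intro lin ip; simp)+
    show ?thesis using 1 2 3 4 unfolding ed2 mult.commute[of "a \<bullet> b"] by linarith
  qed
  have fL: "\<bar>f k (e \<bullet> x) - f k (e \<bullet> y)\<bar> \<le> m * dist x y"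
    if n: "norm x = 1" "norm y = 1" and k: "\<And>z. \<bar>z\<bar> \<le> 1 \<Longrightarrow> \<bar>f (Suc k) z\<bar> \<le> m" for k x y
  proof -
    have "norm (f k (e \<bullet> x) - f k (e \<bullet> y)) \<le> m * norm (e \<bullet> x - e \<bullet> y)"
    proof (rule field_differentiable_bound[of "{-1..1}"])
      show "(f k has_field_derivative f (Suc k) z) (at z within {-1..1})" if "z \<in> {-1..1}" for z
        using f[of z k] that by (auto intro: has_field_derivative_at_within simp: abs_less_iff)
      show "norm (f (Suc k) z) \<le> m" if "z \<in> {-1..1}" for z using k[of z] that by (simp add: abs_le_iff)
    qed (use ip[OF e n(1)] ip[OF e n(2)] in \<open>auto simp: abs_le_iff\<close>)
    also have "\<dots> \<le> m * dist x y"
      using ipd[OF e, of x y] m0 by (intro mult_left_mono) (auto simp: inner_commute)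
    finally show ?thesis by simp
  qed
  have ez: "\<bar>e \<bullet> x\<bar> \<le> 1" if "norm x = 1" for x using ip[OF e that] .
  have H: "\<bar>hess x a b\<bar> \<le> 60 * m" if n: "norm x = 1" "norm a = 1" "norm b = 1" for x a b
  proof -
    have "\<bar>f 2 (e \<bullet> x) * (e \<bullet> dsgn x a) * (e \<bullet> dsgn x b)\<bar> \<le> m * 2 * 2"
      unfolding abs_mult using n m0 by (intro mult_mono m P2 ez) auto
    moreover have "\<bar>f 1 (e \<bullet> x) * (e \<bullet> d2sgn x a b)\<bar> \<le> m * 6"
      unfolding abs_mult using n m0 by (intro mult_mono m S6 ez) auto
    ultimately show ?thesis unfolding hess_def using m0 by linarith
  qed
  have HL: "\<bar>hess x a b - hess y a b\<bar> \<le> 30 * m * dist x y"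
    if n: "norm x = 1" "norm y = 1" "norm a = 1" "norm b = 1" for x y a b
  proof -
    have f2: "\<bar>f 2 (e \<bullet> x) - f 2 (e \<bullet> y)\<bar> \<le> m * dist x y"
      using m(4) by (intro fL n) (simp add: numeral_3_eq_3 numeral_2_eq_2)
    have f1: "\<bar>f 1 (e \<bullet> x) - f 1 (e \<bullet> y)\<bar> \<le> m * dist x y"
      using m(3) by (intro fL n) (simp add: numeral_2_eq_2)
    have 1: "\<bar>f 2 (e \<bullet> x) * (e \<bullet> dsgn x a) - f 2 (e \<bullet> y) * (e \<bullet> dsgn y a)\<bar> \<le> (m * 2 + m * 2) * dist x y"
      by (intro prod_diff_le f2 P2 PL n m ez)
    have 2: "\<bar>f 2 (e \<bullet> y) * (e \<bullet> dsgn y a)\<bar> \<le> m * 2"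
      unfolding abs_mult using n m0 by (intro mult_mono m P2 ez) auto
    have 3: "\<bar>f 2 (e \<bullet> x) * (e \<bullet> dsgn x a) * (e \<bullet> dsgn x b) - f 2 (e \<bullet> y) * (e \<bullet> dsgn y a) * (e \<bullet> dsgn y b)\<bar>
        \<le> ((m * 2 + m * 2) * 2 + m * 2 * 2) * dist x y"
      by (intro prod_diff_le 1 2 P2 PL n)
    have 4: "\<bar>f 1 (e \<bullet> x) * (e \<bullet> d2sgn x a b) - f 1 (e \<bullet> y) * (e \<bullet> d2sgn y a b)\<bar> \<le> (m * 6 + m * 12) * dist x y"
      by (intro prod_diff_le f1 S6 SL n m ez)
    have "\<bar>hess x a b - hess y a b\<bar> \<le> ((m * 2 + m * 2) * 2 + m * 2 * 2) * dist x y + (m * 6 + m * 12) * dist x y"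
      unfolding hess_def using 3 4 by linarith
    then show ?thesis by (simp add: algebra_simps)
  qed
  have HP: "\<bar>hess x a b - hess y a b\<bar> \<le> 60 * m * dist x y powr \<alpha>"
    if n: "norm x = 1" "norm y = 1" "norm a = 1" "norm b = 1" for x y a b
  proof -
    have "dist x y \<le> 2" using norm_triangle_ineq4[of x y] n by (simp add: dist_norm)
    then have "dist x y \<le> 2 * dist x y powr \<alpha>" using \<alpha> by (intro dist_le_powr) auto
    then have "30 * m * dist x y \<le> 30 * m * (2 * dist x y powr \<alpha>)" using m0 by (intro mult_left_mono) auto
    then show ?thesis using HL[OF n] by simp
  qed
  have D1: "\<bar>frechet_derivative W (at x) a\<bar> \<le> 60 * m" if n: "norm x = 1" "norm a = 1" for x a
  proof -
    have x: "x \<noteq> 0" using n by auto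
    have "\<bar>f 1 (e \<bullet> x) * (e \<bullet> dsgn x a)\<bar> \<le> m * 2"
      unfolding abs_mult using n m0 by (intro mult_mono m P2 ez) auto
    then show ?thesis using m0 by (simp add: dW[OF x] frechet_ext[OF x] sgn_unit[OF n(1)])
  qed
  have D0: "\<bar>W x\<bar> \<le> 60 * m" if "norm x = 1" for x
    using m(1)[OF ez[OF that]] m0 by (simp add: W ext_def sgn_unit[OF that])
  show ?thesis
    unfolding holder_norm_le_def Let_def W_def[symmetric, abs_def]
    using CW D0 D1 H HP by (simp add: d2W)
qed

end

section \<open>Bifurcation\<close>

lemma dder_Suc_add_const: "dder (Suc k) (of_real c + a) = dder (Suc k) a"
proof -
  have "diffs (dcoeff (of_real c + a)) = diffs (dcoeff a)"
    by (rule ext) (simp add: diffs_apply dcoeff_of_real)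
  then show ?thesis by (intro ext) (simp add: dder_def funpow_Suc_right del: funpow.simps)
qed

context desitter
begin

text \<open>The Hoelder estimate is stated for every reference level \<open>c\<close>, because the
  limiting slice is selected only afterwards by compactness.\<close>

definition nearby_graph ::
  "real \<Rightarrow> real \<Rightarrow> real \<Rightarrow> real \<Rightarrow> real \<Rightarrow> real \<Rightarrow> real \<Rightarrow> point set \<Rightarrow> (real^3 \<Rightarrow> real) \<Rightarrow> bool" where
  "nearby_graph q1 q2 \<alpha> B \<epsilon> d s D u \<longleftrightarrow> 0 < d \<and> d < \<epsilon> \<and> s \<in> {q1..q2} \<and>
      critical K E (slice_curvature K E (arclength K E (- s))) D \<and> D \<noteq> slab K E (arclength K E (- s)) \<and>
      D = {(t, x). x \<in> sphere 0 1 \<and> shat K E < t \<and> t < u x} \<and>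
      (\<forall>c. holder_norm_le \<alpha> (\<lambda>x. u x - c) (60 * (B * \<epsilon> + \<bar>arclength K E (- (s + d)) - c\<bar>)))"

lemma bifurcating_graphs:
  assumes q: "0 < q1" "q1 \<le> q2" "q2 < - rhat K E"
    and sgn: "dval (dflux (dsolve (2 + 6 * K / q1) 1)) 1 * dval (dflux (dsolve (2 + 6 * K / q2) 1)) 1 < 0"
    and \<alpha>: "0 < \<alpha>" "\<alpha> < 1"
  obtains B where "0 \<le> B"
    "\<And>\<epsilon>. 0 < \<epsilon> \<Longrightarrow> \<exists>d s D u. nearby_graph q1 q2 \<alpha> B \<epsilon> d s D u"
proof -
  interpret shooting K E q1 q2
    using q psi_sq_pos K by unfold_locales auto
  obtain D0 D1 D2 where D: "0 \<le> D0" "\<And>a t. \<bar>t\<bar> \<le> 1 \<Longrightarrow> \<bar>dder 0 a t\<bar> \<le> D0 * norm a"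
    "0 \<le> D1" "\<And>a t. \<bar>t\<bar> \<le> 1 \<Longrightarrow> \<bar>dder 1 a t\<bar> \<le> D1 * norm a"
    "0 \<le> D2" "\<And>a t. \<bar>t\<bar> \<le> 1 \<Longrightarrow> \<bar>dder 2 a t\<bar> \<le> D2 * norm a"
    using dder_bound[of 0] dder_bound[of 1] dder_bound[of 2] by metis
  \<comment> \<open>Here \<open>q2 + 1\<close> bounds the norm of \<open>Q\<close>, the
    \<open>D0\<close>, \<open>D1\<close>, \<open>D2\<close> control three derivatives of the height
    through \<open>Q * n\<close>, and the 2 covers the factor 3/2 lost by
    \<open>dint\<close>.\<close>
  define B where "B = (D0 + D1 + D2 + 2) * (q2 + 1)"
  obtain \<psi>0 where \<psi>0: "0 < \<psi>0" "\<And>s. s \<in> I \<Longrightarrow> \<psi>0 \<le> \<psi> s"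
  proof -
    have "I \<noteq> {}" using q by (simp add: I_def)
    then obtain s0 where "s0 \<in> I" "\<And>s. s \<in> I \<Longrightarrow> \<psi> s0 \<le> \<psi> s"
      using continuous_attains_inf[OF compact_I _ psi_cont] by blast
    then show thesis using that[of "\<psi> s0"] shooting.psi_pos[OF shooting_axioms] by blast
  qed
  \<comment> \<open>Perturbations below this size keep \<open>Q\<close>, \<open>P\<close> and
    \<open>X\<close> positive and keep \<open>Q\<close> below \<open>- rhat K E\<close>.\<close>
  define \<epsilon>0 where "\<epsilon>0 = min (min 1 (q1 / 2)) (min (- rhat K E - q2) \<psi>0) / 2"
  have \<epsilon>0: "0 < \<epsilon>0" "\<epsilon>0 < 1" "\<epsilon>0 < q1" "\<epsilon>0 < - rhat K E - q2" "\<epsilon>0 < \<psi>0"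
    using q \<psi>0 by (auto simp: \<epsilon>0_def min_def)
  show thesis
  proof
    show "0 \<le> B" using D q by (simp add: B_def)
    fix \<epsilon> :: real assume "0 < \<epsilon>"
    then have \<epsilon>': "0 < min \<epsilon> \<epsilon>0" using \<epsilon>0 by simp
    obtain d s \<xi> \<eta> \<zeta> n where S: "0 < d" "d < min \<epsilon> \<epsilon>0" "s \<in> {q1..q2}"
      "norm \<xi> < min \<epsilon> \<epsilon>0" "norm \<eta> < min \<epsilon> \<epsilon>0" "norm \<zeta> < min \<epsilon> \<epsilon>0" "norm n < min \<epsilon> \<epsilon>0" "dval n 1 = 0"
      "profile_eqs K E (lam s) (s + d) (of_real s + \<xi>) (of_real (\<psi> s) + \<eta>) (1 + \<zeta>) n"
      using shooting[OF _ \<epsilon>'] sgn unfolding nu_def by metis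
    have sI: "s \<in> I" using S by (simp add: I_def)
    define Q where "Q = of_real s + \<xi>"
    define P where "P = of_real (\<psi> s) + \<eta>"
    define X where "X = 1 + \<zeta>"
    have val: "\<bar>dval Q t - s\<bar> < \<epsilon>0" "\<bar>dval P t - \<psi> s\<bar> < \<epsilon>0" "\<bar>dval X t - 1\<bar> < \<epsilon>0" if "\<bar>t\<bar> \<le> 3/2" for t
      using abs_dval_le_norm[OF that, of \<xi>] abs_dval_le_norm[OF that, of \<eta>] abs_dval_le_norm[OF that, of \<zeta>] S that
      by (auto simp: Q_def P_def X_def dval_add)
    interpret prof: desitter_profile K E "lam s" "s + d" Q P X n
    proof unfold_locales
      show "profile_eqs K E (lam s) (s + d) Q P X n" using S(9) by (simp add: Q_def P_def X_def)
      show "dval n 1 = 0" by fact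
      fix t :: real assume "\<bar>t\<bar> \<le> 3/2"
      from val[OF this] show "0 < dval Q t" "0 < dval P t" "0 < dval X t"
        using \<epsilon>0 S(3) \<psi>0(2)[OF sI] by auto
    next
      fix t :: real assume "0 \<le> t" "t \<le> 1"
      then show "dval Q t < - rhat K E" using val(1)[of t] \<epsilon>0 S(3) by auto
    qed
    define e :: "real^3" where "e = axis 3 1"
    interpret gr: cmc_graph K E e prof.profile "lam s"
    proof unfold_locales
      show "norm e = 1" by (simp add: e_def)
      show "(prof.profile k has_real_derivative prof.profile (Suc k) z) (at z)" if "\<bar>z\<bar> < 2" for k z
        using that by (intro prof.profile_deriv) auto
      show "\<exists>r>rhat K E. r < 0 \<and> prof.profile 0 z = arclength K E r" if "\<bar>z\<bar> \<le> 1" for z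
        using prof.profile_0[OF that] by blast
      show "graph_curvature (radius K E (prof.profile 0 z)) (psi K E (radius K E (prof.profile 0 z)))
          (prof.profile 1 z) (prof.profile 2 z) z = lam s" if "\<bar>z\<bar> \<le> 1" for z
        by (rule prof.profile_graph_curvature[OF that])
    qed
    have rs: "rhat K E < - s" "- s < 0" "rhat K E < - (s + d)" "- (s + d) < - s"
      using S \<epsilon>0 q by auto
    have curv: "slice_curvature K E (arclength K E (- s)) = lam s"
      using slice_curvature_arclength[OF rs(1,2)] by (simp add: lam_def \<psi>_def)
    have p01: "prof.profile 0 1 = arclength K E (- (s + d))"
      using prof.profile_0(1)[of 1] prof.q_0 by simp
    \<comment> \<open>On the axis, at \<open>z = 1\<close>, the graph has the height belonging to
      \<open>- (s + d)\<close>, strictly below the slice because \<open>d > 0\<close>.\<close>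
    have ne: "gr.region \<noteq> slab K E (arclength K E (- s))"
    proof
      assume eq: "gr.region = slab K E (arclength K E (- s))"
      have lt: "arclength K E (- (s + d)) < arclength K E (- s)"
        using rs by (intro arclength_strict_mono) auto
      then obtain t where t: "arclength K E (- (s + d)) < t" "t < arclength K E (- s)" using dense by blast
      have "shat K E < t" using arclength_range(1)[of "- (s + d)"] rs t by simp
      then have "(t, e) \<in> slab K E (arclength K E (- s))" using t gr.e by (simp add: slab_def)
      moreover have "gr.ext e = arclength K E (- (s + d))"
        using gr.e p01 by (simp add: gr.ext_def gr.sgn_unit flip: power2_norm_eq_inner)
      then have "(t, e) \<notin> gr.region" using t by (simp add: gr.region_def)
      ultimately show False using eq by simp
    qed
    have nQ: "norm (Q * n) \<le> (q2 + 1) * \<epsilon>"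
    proof -
      have "norm Q \<le> \<bar>s\<bar> + norm \<xi>" unfolding Q_def using norm_triangle_ineq[of "of_real s" \<xi>] by simp
      also have "\<dots> \<le> q2 + 1" using S \<epsilon>0 q by auto
      finally have "norm Q * norm n \<le> (q2 + 1) * \<epsilon>" using S q by (intro mult_mono) auto
      then show ?thesis using norm_mult_ineq[of Q n] by linarith
    qed
    define w where "w = (q2 + 1) * \<epsilon>"
    have w: "0 \<le> w" "norm (Q * n) \<le> w" using nQ q \<open>0 < \<epsilon>\<close> by (auto simp: w_def)
    have Bw: "B * \<epsilon> = (D0 + D1 + D2 + 2) * w" by (simp add: B_def w_def)
    \<comment> \<open>Up to sign, derivatives of the profile of order \<open>Suc k\<close> are
      derivatives of \<open>Q * n\<close> of order \<open>k\<close>, so the small slope controls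
      them.\<close>
    have der: "\<bar>prof.profile (Suc k) z\<bar> \<le> B * \<epsilon>"
      if "\<bar>z\<bar> \<le> 1" "\<And>a t. \<bar>t\<bar> \<le> 1 \<Longrightarrow> \<bar>dder k a t\<bar> \<le> Dk * norm a" "0 \<le> Dk" "Dk \<le> D0 + D1 + D2 + 2" for k z Dk
    proof -
      have "\<bar>prof.profile (Suc k) z\<bar> = \<bar>dder k (Q * n) (1 - \<bar>z\<bar>)\<bar>"
        by (auto simp: prof.profile_def prof.height_def dder_Suc_add_const dder_dint abs_mult)
      also have "\<dots> \<le> Dk * norm (Q * n)" using that(1) by (intro that(2)) auto
      also have "\<dots> \<le> (D0 + D1 + D2 + 2) * w" using that w by (intro mult_mono) auto
      finally show ?thesis by (simp add: Bw)
    qed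
    have val0: "\<bar>prof.profile 0 z - c\<bar> \<le> B * \<epsilon> + \<bar>arclength K E (- (s + d)) - c\<bar>" if "\<bar>z\<bar> \<le> 1" for z c
    proof -
      have t: "\<bar>1 - \<bar>z\<bar>\<bar> \<le> 3/2" using that by auto
      have "prof.profile 0 z = arclength K E (- (s + d)) + dval (dint (Q * n)) (1 - \<bar>z\<bar>)"
        using t by (auto simp: prof.profile_def prof.height_def dder_0 dval_add)
      moreover have "\<bar>dval (dint (Q * n)) (1 - \<bar>z\<bar>)\<bar> \<le> B * \<epsilon>"
      proof -
        have "\<bar>dval (dint (Q * n)) (1 - \<bar>z\<bar>)\<bar> \<le> norm (dint (Q * n))" by (rule abs_dval_le_norm[OF t])
        also have "\<dots> \<le> 3/2 * norm (davg (Q * n))"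
          unfolding dint_def using norm_mult_ineq[of dvar] by (simp add: norm_dvar)
        also have "\<dots> \<le> 2 * w" using norm_davg[of "Q * n"] w by linarith
        also have "\<dots> \<le> (D0 + D1 + D2 + 2) * w" using D w by (intro mult_right_mono) auto
        finally show ?thesis by (simp add: Bw)
      qed
      ultimately show ?thesis by linarith
    qed
    have "holder_norm_le \<alpha> (\<lambda>x. gr.ext x - c) (60 * (B * \<epsilon> + \<bar>arclength K E (- (s + d)) - c\<bar>))" for c
    proof (rule gr.holder_bound[OF \<alpha> val0])
      fix z :: real assume z: "\<bar>z\<bar> \<le> 1"
      show "\<bar>prof.profile 1 z\<bar> \<le> B * \<epsilon> + \<bar>arclength K E (- (s + d)) - c\<bar>"
        using der[OF z D(2)] D by simp
      show "\<bar>prof.profile 2 z\<bar> \<le> B * \<epsilon> + \<bar>arclength K E (- (s + d)) - c\<bar>"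
        using der[OF z D(4)] D by (simp add: numeral_2_eq_2)
      show "\<bar>prof.profile 3 z\<bar> \<le> B * \<epsilon> + \<bar>arclength K E (- (s + d)) - c\<bar>"
        using der[OF z D(6)] D by (simp add: numeral_3_eq_3 numeral_2_eq_2)
    qed
    then show "\<exists>d s D u. nearby_graph q1 q2 \<alpha> B \<epsilon> d s D u"
      using S gr.critical_region ne
      by (intro exI[of _ d] exI[of _ s] exI[of _ gr.region] exI[of _ gr.ext]) (simp add: nearby_graph_def curv gr.region_def)
  qed
qed

lemma holder_norm_le_mono:
  assumes "holder_norm_le \<alpha> w c" "c \<le> c'"
  shows "holder_norm_le \<alpha> w c'"
  using assms(1) unfolding holder_norm_le_def Let_def
  by (meson assms(2) mult_right_mono order_trans powr_ge_zero)

text \<open>Compactness of the interval yields a limiting slice along a subsequence. Since the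
  displacement at the pole tends to 0, the graphs and the slices whose curvature they share converge
  to that same slice.\<close>

lemma bifurcation_between:
  assumes q: "0 < q1" "q1 \<le> q2" "q2 < - rhat K E"
    and sgn: "dval (dflux (dsolve (2 + 6 * K / q1) 1)) 1 * dval (dflux (dsolve (2 + 6 * K / q2) 1)) 1 < 0"
    and \<alpha>: "0 < \<alpha>" "\<alpha> < 1"
  obtains q where "q \<in> {q1..q2}" "bifurcation_point K E \<alpha> (arclength K E (- q))"
proof -
  obtain B where B: "0 \<le> B" "\<And>\<epsilon>. 0 < \<epsilon> \<Longrightarrow> \<exists>d s D u. nearby_graph q1 q2 \<alpha> B \<epsilon> d s D u"
    using bifurcating_graphs[OF q sgn \<alpha>] by blast
  define \<epsilon> where "\<epsilon> n = 1 / real (Suc n)" for n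
  have \<epsilon>: "0 < \<epsilon> n" for n by (simp add: \<epsilon>_def)
  have "\<forall>n. \<exists>d s D u. nearby_graph q1 q2 \<alpha> B (\<epsilon> n) d s D u" using B(2)[OF \<epsilon>] by blast
  then obtain d s D u where "\<And>n. nearby_graph q1 q2 \<alpha> B (\<epsilon> n) (d n) (s n) (D n) (u n)" by metis
  then have S: "\<And>n. 0 < d n" "\<And>n. d n < \<epsilon> n" "\<And>n. s n \<in> {q1..q2}"
    "\<And>n. critical K E (slice_curvature K E (arclength K E (- s n))) (D n)"
    "\<And>n. D n \<noteq> slab K E (arclength K E (- s n))"
    "\<And>n. D n = {(t, x). x \<in> sphere 0 1 \<and> shat K E < t \<and> t < u n x}"
    "\<And>n c. holder_norm_le \<alpha> (\<lambda>x. u n x - c) (60 * (B * \<epsilon> n + \<bar>arclength K E (- (s n + d n)) - c\<bar>))"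
    unfolding nearby_graph_def by blast+
  have "compact {q1..q2}" by simp
  then have "seq_compact {q1..q2}" by (rule compact_imp_seq_compact)
  then obtain qs \<tau> where \<tau>: "qs \<in> {q1..q2}" "strict_mono \<tau>" "(s \<circ> \<tau>) \<longlonglongrightarrow> qs"
    using S(3) seq_compactE[of "{q1..q2}" s] by metis
  have rs: "rhat K E < - t" "- t < 0" if "t \<in> {q1..q2}" for t using that q by auto
  have \<epsilon>0: "\<epsilon> \<longlonglongrightarrow> 0" unfolding \<epsilon>_def [abs_def] by (rule LIMSEQ_inverse_real_of_nat[unfolded inverse_eq_divide])
  have "d \<longlonglongrightarrow> 0"
    by (rule tendsto_sandwich[OF _ _ tendsto_const \<epsilon>0]) (use S(1,2) in \<open>auto intro!: always_eventually less_imp_le\<close>)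
  then have d\<tau>: "(\<lambda>n. d (\<tau> n)) \<longlonglongrightarrow> 0" using LIMSEQ_subseq_LIMSEQ[OF _ \<tau>(2)] by (simp add: comp_def)
  have \<epsilon>\<tau>: "(\<lambda>n. \<epsilon> (\<tau> n)) \<longlonglongrightarrow> 0" using LIMSEQ_subseq_LIMSEQ[OF \<epsilon>0 \<tau>(2)] by (simp add: comp_def)
  have s\<tau>: "(\<lambda>n. s (\<tau> n)) \<longlonglongrightarrow> qs" using \<tau>(3) by (simp add: comp_def)
  have cont: "isCont (arclength K E) (- qs)"
    using arclength_deriv[OF rs[OF \<tau>(1)]] by (rule DERIV_isCont)
  have \<sigma>: "(\<lambda>n. arclength K E (- s (\<tau> n))) \<longlonglongrightarrow> arclength K E (- qs)"
    by (rule isCont_tendsto_compose[OF cont]) (intro tendsto_intros s\<tau>)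
  have "(\<lambda>n. - (s (\<tau> n) + d (\<tau> n))) \<longlonglongrightarrow> - (qs + 0)" by (intro tendsto_intros s\<tau> d\<tau>)
  then have \<sigma>': "(\<lambda>n. arclength K E (- (s (\<tau> n) + d (\<tau> n)))) \<longlonglongrightarrow> arclength K E (- qs)"
    by (intro isCont_tendsto_compose[OF cont]) simp
  have "bifurcation_point K E \<alpha> (arclength K E (- qs))"
    unfolding bifurcation_point_def
  proof (intro conjI exI[of _ "\<lambda>n. arclength K E (- s (\<tau> n))"] exI[of _ "\<lambda>n. D (\<tau> n)"] allI)
    show "arclength K E (- qs) \<in> {shat K E<..<0}" using arclength_range[OF rs[OF \<tau>(1)]] by simp
    show "arclength K E (- s (\<tau> n)) \<in> {shat K E<..<0}" for n using arclength_range[OF rs[OF S(3)]] by simp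
    show "(\<lambda>n. arclength K E (- s (\<tau> n))) \<longlonglongrightarrow> arclength K E (- qs)" by (rule \<sigma>)
    show "critical K E (slice_curvature K E (arclength K E (- s (\<tau> n)))) (D (\<tau> n))" for n by (rule S(4))
    show "D (\<tau> n) \<noteq> slab K E (arclength K E (- s (\<tau> n)))" for n by (rule S(5))
    show "converges_to_slab K E \<alpha> (\<lambda>n. D (\<tau> n)) (arclength K E (- qs))"
      unfolding converges_to_slab_def
    proof (intro allI impI)
      fix \<delta> :: real assume "0 < \<delta>"
      have "(\<lambda>n. 60 * (B * \<epsilon> (\<tau> n) + \<bar>arclength K E (- (s (\<tau> n) + d (\<tau> n))) - arclength K E (- qs)\<bar>))
          \<longlonglongrightarrow> 60 * (B * 0 + \<bar>arclength K E (- qs) - arclength K E (- qs)\<bar>)"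
        by (intro tendsto_intros \<epsilon>\<tau> \<sigma>')
      then have "\<forall>\<^sub>F n in sequentially. 60 * (B * \<epsilon> (\<tau> n) + \<bar>arclength K E (- (s (\<tau> n) + d (\<tau> n))) - arclength K E (- qs)\<bar>) < \<delta>"
        using \<open>0 < \<delta>\<close> by (intro order_tendstoD(2)) auto
      then show "\<forall>\<^sub>F n in sequentially. \<exists>u. D (\<tau> n) = {(t, x). x \<in> sphere 0 1 \<and> shat K E < t \<and> t < u x} \<and>
          holder_norm_le \<alpha> (\<lambda>x. u x - arclength K E (- qs)) \<delta>"
      proof (rule eventually_mono)
        fix n assume "60 * (B * \<epsilon> (\<tau> n) + \<bar>arclength K E (- (s (\<tau> n) + d (\<tau> n))) - arclength K E (- qs)\<bar>) < \<delta>"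
        then have "holder_norm_le \<alpha> (\<lambda>x. u (\<tau> n) x - arclength K E (- qs)) \<delta>"
          using holder_norm_le_mono[OF S(7)] by simp
        then show "\<exists>u. D (\<tau> n) = {(t, x). x \<in> sphere 0 1 \<and> shat K E < t \<and> t < u x} \<and>
          holder_norm_le \<alpha> (\<lambda>x. u x - arclength K E (- qs)) \<delta>"
          using S(6) by blast
      qed
    qed
  qed
  with \<tau>(1) that show thesis by blast
qed

lemma infinite_bifurcation_points:
  assumes \<alpha>: "0 < \<alpha>" "\<alpha> < 1"
  shows "infinite {s. bifurcation_point K E \<alpha> s}"
proof -
  \<comment> \<open>This is \<open>k (k + 1)\<close> for \<open>k = 2 m + 1\<close>, and
    \<open>Q m\<close> below is the \<open>q\<close> at which the Legendre parameter takes this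
    value.\<close>
  define eig where "eig m = real (2 * m + 1) * (real (2 * m + 1) + 1)" for m :: nat
  define Q where "Q m = 6 * K / (eig m - 2)" for m :: nat
  have eig_mono: "eig m < eig m'" if "m < m'" for m m'
    unfolding eig_def using that by (intro mult_strict_mono) auto
  have eig2: "2 < eig m" if "1 \<le> m" for m using eig_mono[of 0 m] that by (simp add: eig_def)
  have Qpos: "0 < Q m" if "1 \<le> m" for m using eig2[OF that] K by (simp add: Q_def)
  have Qmono: "Q m' < Q m" if "1 \<le> m" "m < m'" for m m'
    unfolding Q_def using eig2[OF that(1)] eig_mono[OF that(2)] K by (intro divide_strict_left_mono mult_pos_pos) auto
  have Qnu: "2 + 6 * K / Q m = eig m" if "1 \<le> m" for m
    using eig2[OF that] K by (simp add: Q_def)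
  have "\<exists>M\<ge>1. Q M < - rhat K E"
  proof -
    obtain M :: nat where M: "6 * K / (- rhat K E) + 2 < real M" using reals_Archimedean2 by blast
    have "0 < 6 * K / (- rhat K E)" using K rhat(1) by (intro divide_pos_pos) auto
    then have M1: "1 \<le> M" using M by (cases M) auto
    have "real M \<le> eig M" by (simp add: eig_def algebra_simps)
    then have "6 * K / (- rhat K E) < eig M - 2" using M by simp
    then have "Q M < - rhat K E" using eig2[OF M1] rhat(1) unfolding Q_def by (simp add: field_simps)
    with M1 show ?thesis by blast
  qed
  then obtain M where M: "1 \<le> M" "Q M < - rhat K E" by blast
  \<comment> \<open>Only every second interval is used: neighbouring ones share an endpoint and
    could produce the same point, whereas these are disjoint. Within each, \<open>m\<close> changes
    parity once, so the signs at the ends are opposite.\<close>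
  have "\<exists>q. q \<in> {Q (M + 2 * j + 1)..Q (M + 2 * j)} \<and> bifurcation_point K E \<alpha> (arclength K E (- q))" for j
  proof -
    let ?m = "M + 2 * j"
    have m: "1 \<le> ?m" "1 \<le> ?m + 1" using M by auto
    have "Q ?m \<le> Q M" using Qmono[of M ?m] M by (cases "j = 0") auto
    then have 1: "Q ?m < - rhat K E" using M by simp
    have 2: "Q (?m + 1) \<le> Q ?m" using Qmono[OF m(1), of "?m + 1"] by simp
    let ?v = "\<lambda>m. dval (dflux (dsolve (eig m) 1)) 1"
    have "0 < ((- 1) ^ ?m * ?v ?m) * ((- 1) ^ (?m + 1) * ?v (?m + 1))"
      using legendre_sign[of ?m] legendre_sign[of "?m + 1"] unfolding eig_def by (rule mult_pos_pos)
    also have "\<dots> = - (?v (?m + 1) * ?v ?m)" by (simp flip: power_mult_distrib)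
    finally have "?v (?m + 1) * ?v ?m < 0" by simp
    then show ?thesis
      using bifurcation_between[OF Qpos[OF m(2)] 2 1 _ \<alpha>] unfolding Qnu[OF m(1)] Qnu[OF m(2)] by metis
  qed
  then obtain q where q: "\<And>j. q j \<in> {Q (M + 2 * j + 1)..Q (M + 2 * j)}"
    "\<And>j. bifurcation_point K E \<alpha> (arclength K E (- q j))" by metis
  have qlt: "q j' < q j" if "j < j'" for j j'
  proof -
    have "q j' \<le> Q (M + 2 * j')" using q(1)[of j'] by simp
    also have "\<dots> < Q (M + 2 * j + 1)" using that M by (intro Qmono) auto
    also have "\<dots> \<le> q j" using q(1)[of j] by simp
    finally show ?thesis .
  qed
  have qr: "rhat K E \<le> - q j" "- q j < 0" for j
  proof -
    have "Q (M + 2 * j) \<le> Q M" using Qmono[of M "M + 2 * j"] M by (cases "j = 0") auto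
    then show "rhat K E \<le> - q j" using q(1)[of j] M by simp
    show "- q j < 0" using q(1)[of j] Qpos[of "M + 2 * j + 1"] by simp
  qed
  have "inj (\<lambda>j. arclength K E (- q j))"
  proof (rule linorder_injI)
    fix j j' :: nat assume "j < j'"
    then have "arclength K E (- q j) < arclength K E (- q j')"
      using qlt[of j j'] qr by (intro arclength_strict_mono) auto
    then show "arclength K E (- q j) \<noteq> arclength K E (- q j')" by simp
  qed
  moreover have "range (\<lambda>j. arclength K E (- q j)) \<subseteq> {s. bifurcation_point K E \<alpha> s}"
    using q(2) by auto
  ultimately show ?thesis
    using infinite_super range_inj_infinite by blast
qed

end

theorem corollary4p2:
  fixes K E \<alpha> :: real
  assumes "0 < K" and "E < 0" and "0 < \<alpha>" and "\<alpha> < 1"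
  shows "infinite {s. bifurcation_point K E \<alpha> s}"
proof -
  interpret desitter K E by unfold_locales fact+
  show ?thesis using assms(3,4) by (rule infinite_bifurcation_points)
qed

end
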